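(* For each $\chi \in \{TBR, SPR, rSPR\}$, both the $\chi$-diameter $D_\chi(n)$ and the $\chi$-radius $R_\chi(n)$ are $n - \Theta(\sqrt{n})$ as $n \to \infty$.
   Context: For a finite set $X$ with $|X|>1$, a binary leaf-labelled tree with label set $X$ is a finite tree whose vertices are either tree vertices of degree $3$ or leaves of degree $1$, the leaves being in bijection with $X$ (their labels); if $|X|=1$ it is the single vertex labelled by the element of $X$. $\mathcal{B}(X)$ denotes the set of all such trees; two trees are identified if there is a graph isomorphism preserving leaf labels. The leaf labelled $0$ (when $0\in X$) is called the root. A TBR (tree bisection and reconnection) move on $T\in\mathcal{B}(X)$, $|X|\ge 3$: delete an edge of $T$ and suppress all resulting degree-$2$ vertices, obtaining two binary trees $T_1,T_2$; then join them by a new edge between the midpoint of an edge of $T_1$ and the midpoint of an edge of $T_2$ (if $T_1$ or $T_2$ is a single vertex, the new edge is incident to that vertex). An SPR (subtree prune and regraft) move taking $xy$ from $ab$ to $cd$ can be performed on $T$ when $xy, ax, xb, cd$ are distinct edges (the vertices $a,b,c,d$ need not be distinct) and the path from $c$ to $y$ contains $x$: delete edges $ax, xb$ and add edge $ab$; then delete edge $cd$ and add edges $cx, xd$. It is an rSPR (rooted SPR) move if moreover $0\in X$ and the path from the leaf $0$ to $y$ passes through $x$. For $\chi\in\{TBR,SPR,rSPR\}$ and $A,B\in\mathcal{B}(X)$, $d_\chi(A,B)$ is the minimum number of $\chi$ moves needed to transform $A$ into $B$. For $n\ge1$ and $X=\{0,1,\dots,n\}$, $D_\chi(n)=\max_{A,B\in\mathcal{B}(X)}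 d_\chi(A,B)$ and $R_\chi(n)=\min_{C\in\mathcal{B}(X)}\max_{B\in\mathcal{B}(X)} d_\chi(B,C)$. *)

theory Defs
  imports Complex_Main "HOL-Library.Landau_Symbols"
begin

text \<open>Finite simple graphs. The vertices are natural numbers, which is no restriction since trees
  are only considered up to isomorphism; an edge is the set of its two end points.\<close>

record ugraph =
  verts :: "nat set"
  edges :: "nat set set"

definition ugraph_wf :: "ugraph \<Rightarrow> bool" where
  "ugraph_wf G \<longleftrightarrow> finite (verts G) \<and>
     (\<forall>e\<in>edges G. \<exists>u v. u \<in> verts G \<and> v \<in> verts G \<and> u \<noteq> v \<and> e = {u, v})"

definition vdegree :: "ugraph \<Rightarrow> nat \<Rightarrow> nat" where
  "vdegree G v = card {e \<in> edges G. v \<in> e}"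

definition is_path :: "ugraph \<Rightarrow> nat \<Rightarrow> nat list \<Rightarrow> nat \<Rightarrow> bool" where
  "is_path G u p v \<longleftrightarrow> p \<noteq> [] \<and> hd p = u \<and> last p = v \<and> set p \<subseteq> verts G \<and> distinct p \<and>
     successively (\<lambda>x y. {x, y} \<in> edges G) p"

definition is_cycle :: "ugraph \<Rightarrow> nat list \<Rightarrow> bool" where
  "is_cycle G p \<longleftrightarrow> length p \<ge> 3 \<and> distinct p \<and>
     successively (\<lambda>x y. {x, y} \<in> edges G) p \<and> {last p, hd p} \<in> edges G"

definition is_tree :: "ugraph \<Rightarrow> bool" where
  "is_tree G \<longleftrightarrow> ugraph_wf G \<and> verts G \<noteq> {} \<and>
     (\<forall>u\<in>verts G. \<forall>v\<in>verts G. \<exists>p. is_path G u p v) \<and> (\<nexists>p. is_cycle G p)"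

definition on_path :: "ugraph \<Rightarrow> nat \<Rightarrow> nat \<Rightarrow> nat \<Rightarrow> bool" where
  "on_path G u v x \<longleftrightarrow> (\<exists>p. is_path G u p v \<and> x \<in> set p)"

text \<open>A leaf-labelled tree; \<open>leaf T x\<close> is the leaf with label \<open>x\<close>, and only its values
  for \<open>x\<close> in the label set matter.\<close>

record ltree =
  shape :: ugraph
  leaf :: "nat \<Rightarrow> nat"

definition binary_ltree :: "nat set \<Rightarrow> ltree \<Rightarrow> bool" where
  "binary_ltree X T \<longleftrightarrow> finite X \<and> X \<noteq> {} \<and> is_tree (shape T) \<and>
     (if card X = 1 then verts (shape T) = leaf T ` X
      else (\<forall>v\<in>verts (shape T). vdegree (shape T) v \<in> {1, 3}) \<and>
           bij_betw (leaf T) X {v \<in> verts (shape T). vdegree (shape T) v = 1})"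

definition ltree_iso :: "nat set \<Rightarrow> (ltree \<times> ltree) set" where
  "ltree_iso X = {(S, T). binary_ltree X S \<and> binary_ltree X T \<and>
     (\<exists>f. bij_betw f (verts (shape S)) (verts (shape T)) \<and>
          edges (shape T) = (\<lambda>e. f ` e) ` edges (shape S) \<and>
          (\<forall>x\<in>X. f (leaf S x) = leaf T x))}"

definition BTrees :: "nat set \<Rightarrow> ltree set set" where
  "BTrees X = {T. binary_ltree X T} // ltree_iso X"

definition delete_edge :: "nat set \<Rightarrow> ugraph \<Rightarrow> ugraph" where
  "delete_edge e G = \<lparr>verts = verts G, edges = edges G - {e}\<rparr>"

definition suppress_step :: "ugraph \<Rightarrow> ugraph \<Rightarrow> bool" where
  "suppress_step G H \<longleftrightarrow> (\<exists>v a b. v \<in> verts G \<and> a \<noteq> b \<and>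
     {e \<in> edges G. v \<in> e} = {{a, v}, {v, b}} \<and>
     H = \<lparr>verts = verts G - {v}, edges = (edges G - {{a, v}, {v, b}}) \<union> {{a, b}}\<rparr>)"

definition suppress_all :: "ugraph \<Rightarrow> ugraph \<Rightarrow> bool" where
  "suppress_all G H \<longleftrightarrow> suppress_step\<^sup>*\<^sup>* G H \<and> (\<forall>v\<in>verts H. vdegree H v \<noteq> 2)"

text \<open>\<open>attach G p H\<close>: \<open>p\<close> is the end point in \<open>G\<close> of the new edge: the midpoint
  of an edge of \<open>G\<close>, which \<open>H\<close> subdivides, or the only vertex of \<open>G\<close>.\<close>

definition attach :: "ugraph \<Rightarrow> nat \<Rightarrow> ugraph \<Rightarrow> bool" where
  "attach G p H \<longleftrightarrow> (verts G = {p} \<and> H = G) \<or>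
     (\<exists>a b. {a, b} \<in> edges G \<and> p \<notin> verts G \<and>
        H = \<lparr>verts = insert p (verts G), edges = (edges G - {{a, b}}) \<union> {{a, p}, {p, b}}\<rparr>)"

definition tbr_graph :: "ugraph \<Rightarrow> ugraph \<Rightarrow> bool" where
  "tbr_graph G G' \<longleftrightarrow> (\<exists>e H T1 T2 p q H1 H2.
     e \<in> edges G \<and> suppress_all (delete_edge e G) H \<and>
     is_tree T1 \<and> is_tree T2 \<and> verts T1 \<inter> verts T2 = {} \<and>
     H = \<lparr>verts = verts T1 \<union> verts T2, edges = edges T1 \<union> edges T2\<rparr> \<and>
     attach T1 p H1 \<and> attach T2 q H2 \<and> verts H1 \<inter> verts H2 = {} \<and>
     G' = \<lparr>verts = verts H1 \<union> verts H2, edges = edges H1 \<union> edges H2 \<union> {{p, q}}\<rparr>)"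

text \<open>The operation taking \<open>xy\<close> from \<open>ab\<close> to \<open>cd\<close>.\<close>

definition spr_graph :: "nat \<Rightarrow> nat \<Rightarrow> nat \<Rightarrow> nat \<Rightarrow> nat \<Rightarrow> nat \<Rightarrow> ugraph \<Rightarrow> ugraph \<Rightarrow> bool" where
  "spr_graph x y a b c d G G' \<longleftrightarrow>
     {{x, y}, {a, x}, {x, b}, {c, d}} \<subseteq> edges G \<and>
     distinct [{x, y}, {a, x}, {x, b}, {c, d}] \<and>
     on_path G c y x \<and>
     G' = \<lparr>verts = verts G,
           edges = (((edges G - {{a, x}, {x, b}}) \<union> {{a, b}}) - {{c, d}}) \<union> {{c, x}, {x, d}}\<rparr>"

datatype move_kind = TBR | SPR | rSPR

fun move :: "move_kind \<Rightarrow> nat set \<Rightarrow> ltree \<Rightarrow> ltree \<Rightarrow> bool" where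
  "move TBR X S T \<longleftrightarrow> card X \<ge> 3 \<and> leaf T = leaf S \<and> tbr_graph (shape S) (shape T)"
| "move SPR X S T \<longleftrightarrow> leaf T = leaf S \<and>
     (\<exists>x y a b c d. spr_graph x y a b c d (shape S) (shape T))"
| "move rSPR X S T \<longleftrightarrow> 0 \<in> X \<and> leaf T = leaf S \<and>
     (\<exists>x y a b c d. spr_graph x y a b c d (shape S) (shape T) \<and>
        on_path (shape S) (leaf S 0) y x)"

definition class_moves :: "move_kind \<Rightarrow> nat set \<Rightarrow> (ltree set \<times> ltree set) set" where
  "class_moves \<chi> X = {(A, B). A \<in> BTrees X \<and> B \<in> BTrees X \<and> (\<exists>S\<in>A. \<exists>T\<in>B. move \<chi> X S T)}"

definition tree_dist :: "move_kind \<Rightarrow> nat set \<Rightarrow> ltree set \<Rightarrow> ltree set \<Rightarrow> nat" where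
  "tree_dist \<chi> X A B = (LEAST k. (A, B) \<in> class_moves \<chi> X ^^ k)"

definition tree_diameter :: "move_kind \<Rightarrow> nat \<Rightarrow> nat" where
  "tree_diameter \<chi> n = Max {tree_dist \<chi> {0..n} A B | A B. A \<in> BTrees {0..n} \<and> B \<in> BTrees {0..n}}"

definition tree_radius :: "move_kind \<Rightarrow> nat \<Rightarrow> nat" where
  "tree_radius \<chi> n =
     Min {Max {tree_dist \<chi> {0..n} B C | B. B \<in> BTrees {0..n}} | C. C \<in> BTrees {0..n}}"

text \<open>\<open>\<Theta>\<close> only bounds the absolute value of \<open>n - f n\<close>, whereas
  \<open>f n = n - \<Theta>(sqrt n)\<close> also asserts that \<open>f n\<close> eventually lies below \<open>n\<close>.\<close>

definition n_minus_Theta_sqrt :: "(nat \<Rightarrow> nat) \<Rightarrow> bool" where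
  "n_minus_Theta_sqrt f \<longleftrightarrow>
     (\<lambda>n. real n - real (f n)) \<in> \<Theta>(\<lambda>n. sqrt (real n)) \<and> (\<forall>\<^sub>F n in sequentially. f n \<le> n)"

lemma equiv_ltree_iso: "equiv {T. binary_ltree X T} (ltree_iso X)"
proof (rule equivI)
  show "ltree_iso X \<subseteq> {T. binary_ltree X T} \<times> {T. binary_ltree X T}"
    by (auto simp: ltree_iso_def)
  show "refl_on {T. binary_ltree X T} (ltree_iso X)"
    by (auto simp: refl_on_def ltree_iso_def intro!: exI[of _ id])
  show "sym (ltree_iso X)"
  proof (rule symI)
    fix S T assume "(S, T) \<in> ltree_iso X"
    then obtain f where b: "binary_ltree X S" "binary_ltree X T"
      and f: "bij_betw f (verts (shape S)) (verts (shape T))"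
      and e: "edges (shape T) = (\<lambda>e. f ` e) ` edges (shape S)"
      and l: "\<forall>x\<in>X. f (leaf S x) = leaf T x" by (auto simp: ltree_iso_def)
    let ?g = "inv_into (verts (shape S)) f"
    have inj: "inj_on f (verts (shape S))" using f by (simp add: bij_betw_def)
    have sub: "e \<subseteq> verts (shape S)" if "e \<in> edges (shape S)" for e
      using b(1) that by (auto simp: binary_ltree_def is_tree_def ugraph_wf_def)
    have "leaf S x \<in> verts (shape S)" if "x \<in> X" for x
      using b(1) that by (auto simp: binary_ltree_def bij_betw_def split: if_splits)
    then have "?g (leaf T x) = leaf S x" if "x \<in> X" for x
      using l inj that by (metis inv_into_f_f)
    moreover have "?g ` (f ` e) = e" if "e \<in> edges (shape S)" for e
      using inv_into_image_cancel[OF inj sub[OF that]] .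
    then have "edges (shape S) = (\<lambda>e. ?g ` e) ` edges (shape T)"
      unfolding e image_image by simp
    ultimately show "(T, S) \<in> ltree_iso X"
      using b bij_betw_inv_into[OF f] by (auto simp: ltree_iso_def)
  qed
  show "trans (ltree_iso X)"
  proof (rule transI)
    fix S T U assume "(S, T) \<in> ltree_iso X" "(T, U) \<in> ltree_iso X"
    then obtain f g where
      b: "binary_ltree X S" "binary_ltree X U"
      and fg: "bij_betw f (verts (shape S)) (verts (shape T))"
        "bij_betw g (verts (shape T)) (verts (shape U))"
      and e: "edges (shape T) = (\<lambda>e. f ` e) ` edges (shape S)"
        "edges (shape U) = (\<lambda>e. g ` e) ` edges (shape T)"
      and l: "\<forall>x\<in>X. f (leaf S x) = leaf T x" "\<forall>x\<in>X. g (leaf T x) = leaf U x"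
      by (auto simp: ltree_iso_def)
    show "(S, U) \<in> ltree_iso X"
      using b bij_betw_trans[OF fg] e l
      by (auto simp: ltree_iso_def image_image image_comp intro!: exI[of _ "g \<circ> f"])
  qed
qed

end

theory Submission
  imports Defs
begin

text \<open>Rooting a tree at the leaf 0 turns it into a binary tree with leaves \<open>1, \<dots>, n\<close>. Such a tree
  splits into \<open>O(sqrt n)\<close> edge-disjoint connected blocks of \<open>O(sqrt n)\<close> leaves.

  Upper bound. The blocks of two trees number so few pairs that a maximum matching between blocks
  with two common leaves has size \<open>\<Omega>(sqrt n)\<close>. This gives \<open>s = \<Omega>(sqrt n)\<close> pairs of leaves whose
  connecting paths are edge-disjoint in both trees. Together with the other leaves as singletons they
  are \<open>n - s\<close> components, and one rSPR move per component, taken from the top of the target tree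
  downwards, transforms the first tree into the second.

  Lower bound. The parsimony score of a leaf colouring (the least number of bichromatic edges over
  all extensions to the inner vertices) grows by at most one in a TBR or SPR move. For a given tree,
  colour the leaves with \<open>O(sqrt n)\<close> colours so that no colour repeats within a block; the score is
  \<open>n - O(sqrt n)\<close>. A tree in which the colour classes form subtrees has score \<open>O(sqrt n)\<close>.\<close>

section \<open>Planted binary trees\<close>

datatype btree = Tip nat | Fork btree btree

text \<open>The same with a name for every vertex; the label of a leaf is its vertex name.\<close>

datatype itree = ITip nat | IFork nat itree itree

fun tips :: "btree \<Rightarrow> nat list" where
  "tips (Tip v) = [v]"
| "tips (Fork l r) = tips l @ tips r"

fun erase :: "itree \<Rightarrow> btree" where
  "erase (ITip v) = Tip v"
| "erase (IFork x l r) = Fork (erase l) (erase r)"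

fun nodes :: "itree \<Rightarrow> nat list" where
  "nodes (ITip v) = [v]"
| "nodes (IFork x l r) = x # nodes l @ nodes r"

fun top_node :: "itree \<Rightarrow> nat" where
  "top_node (ITip v) = v"
| "top_node (IFork x l r) = x"

fun planted_edges :: "nat \<Rightarrow> itree \<Rightarrow> nat set set" where
  "planted_edges p (ITip v) = {{p, v}}"
| "planted_edges p (IFork x l r) = insert {p, x} (planted_edges x l \<union> planted_edges x r)"

definition planted :: "nat \<Rightarrow> itree \<Rightarrow> ugraph" where
  "planted p t = \<lparr>verts = insert p (set (nodes t)), edges = planted_edges p t\<rparr>"

definition ltree_of :: "itree \<Rightarrow> ltree" where
  "ltree_of t = \<lparr>shape = planted 0 t, leaf = (\<lambda>x. x)\<rparr>"

definition itree_on :: "nat \<Rightarrow> itree \<Rightarrow> bool" where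
  "itree_on n t \<longleftrightarrow> distinct (0 # nodes t) \<and> set (tips (erase t)) = {1..n}"

lemma tips_nonempty [simp]: "tips t \<noteq> []"
  by (induction t) auto

lemma top_node_in_nodes [simp]: "top_node t \<in> set (nodes t)"
  by (cases t) auto

lemma tips_erase_subset_nodes: "set (tips (erase t)) \<subseteq> set (nodes t)"
  by (induction t) auto

lemma distinct_tips_erase: "distinct (nodes t) \<Longrightarrow> distinct (tips (erase t))"
  by (induction t) (use tips_erase_subset_nodes in fastforce)+

lemma planted_edges_subset: "e \<in> planted_edges p t \<Longrightarrow> e \<subseteq> insert p (set (nodes t))"
  by (induction t arbitrary: p) auto

lemma top_edge_planted [simp]: "{p, top_node t} \<in> planted_edges p t"
  by (cases t) auto

lemma finite_planted_edges [simp]: "finite (planted_edges p t)"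
  by (induction t arbitrary: p) auto

lemma is_tree_single: "is_tree \<lparr>verts = {v}, edges = {}\<rparr>"
proof -
  have "is_path \<lparr>verts = {v}, edges = {}\<rparr> v [v] v"
    by (simp add: is_path_def)
  moreover have "\<not> is_cycle \<lparr>verts = {v}, edges = {}\<rparr> p" for p
    by (simp add: is_cycle_def)
  ultimately show ?thesis
    by (auto simp: is_tree_def ugraph_wf_def)
qed

lemma cycle_two_neighbours:
  assumes "is_cycle G p" "v \<in> set p"
  obtains x y where "x \<noteq> y" "{x, v} \<in> edges G" "{y, v} \<in> edges G"
proof -
  obtain xs ys where p: "p = xs @ v # ys" using assms(2) by (meson split_list)
  have c: "length p \<ge> 3" "distinct p" "successively (\<lambda>x y. {x, y} \<in> edges G) p"
    "{last p, hd p} \<in> edges G"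
    using assms(1) by (auto simp: is_cycle_def)
  consider "xs = []" | "ys = []" "xs \<noteq> []" | "xs \<noteq> []" "ys \<noteq> []" by blast
  then show ?thesis
  proof cases
    case 1
    then obtain a zs where ys: "ys = a # zs" "zs \<noteq> []"
      using c(1) p by (cases ys) (auto simp: Suc_le_eq)
    then have "{a, v} \<in> edges G" "{last zs, v} \<in> edges G" "a \<noteq> last zs"
      using c p 1 by (auto simp: insert_commute)
    then show ?thesis using that by blast
  next
    case 2
    then obtain a zs where xs: "xs = a # zs" "zs \<noteq> []"
      using c(1) p by (cases xs) (auto simp: Suc_le_eq)
    have "successively (\<lambda>x y. {x, y} \<in> edges G) ((a # zs) @ [v])" using c(3) p 2 xs by simp
    then have "{last zs, v} \<in> edges G" unfolding successively_append_iff using xs by simp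
    moreover have "{a, v} \<in> edges G" "a \<noteq> last zs"
      using c p 2 xs by (auto simp: insert_commute)
    ultimately show ?thesis using that by blast
  next
    case 3
    have "{last xs, v} \<in> edges G" "{hd ys, v} \<in> edges G"
      using c(3) p 3 by (auto simp: successively_append_iff successively_Cons insert_commute)
    moreover have "last xs \<in> set xs" "hd ys \<in> set ys" using 3 by auto
    then have "last xs \<noteq> hd ys" using c(2) p by auto
    ultimately show ?thesis using that by blast
  qed
qed

lemma is_tree_add_leaf:
  assumes G: "is_tree G" and u: "u \<in> verts G" and v: "v \<notin> verts G"
  shows "is_tree \<lparr>verts = insert v (verts G), edges = insert {u, v} (edges G)\<rparr>" (is "is_tree ?H")
proof -
  have wf: "ugraph_wf G" and conn: "\<And>a b. a \<in> verts G \<Longrightarrow> b \<in> verts G \<Longrightarrow> \<exists>p. is_path G a p b"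
    and acyc: "\<And>p. \<not> is_cycle G p"
    using G by (auto simp: is_tree_def)
  have in_verts: "e \<subseteq> verts G" if "e \<in> edges G" for e
    using wf that by (auto simp: ugraph_wf_def)
  have "finite (insert v (verts G))" using wf by (simp add: ugraph_wf_def)
  moreover have "\<exists>a b. a \<in> insert v (verts G) \<and> b \<in> insert v (verts G) \<and> a \<noteq> b \<and> e = {a, b}"
    if "e \<in> insert {u, v} (edges G)" for e
  proof (cases "e = {u, v}")
    case True
    then show ?thesis using u v by blast
  next
    case False
    then show ?thesis using wf that unfolding ugraph_wf_def by (metis insert_iff)
  qed
  ultimately have "ugraph_wf ?H"
    unfolding ugraph_wf_def by (metis ugraph.select_convs)
  moreover have "\<exists>p. is_path ?H a p b" if ab: "a \<in> insert v (verts G)" "b \<in> insert v (verts G)" for a b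
  proof -
    have mono: "successively (\<lambda>x y. {x, y} \<in> edges ?H) p"
      if "successively (\<lambda>x y. {x, y} \<in> edges G) p" for p
      by (rule successively_mono[OF that]) auto
    consider "a = v" "b = v" | "a \<in> verts G" "b = v" | "a = v" "b \<in> verts G"
      | "a \<in> verts G" "b \<in> verts G" using ab by blast
    then show ?thesis
    proof cases
      case 1
      then show ?thesis by (auto intro!: exI[of _ "[v]"] simp: is_path_def)
    next
      case 2
      obtain p where p: "is_path G a p u" using conn 2 u by blast
      then have "is_path ?H a (p @ [v]) b"
        using 2 v mono[of p] by (auto simp: is_path_def successively_append_iff)
      then show ?thesis by blast
    next
      case 3
      obtain p where p: "is_path G u p b" using conn 3 u by blast
      then have "is_path ?H a (v # p) b"
        using 3 v mono[of p] by (auto simp: is_path_def successively_Cons insert_commute)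
      then show ?thesis by blast
    next
      case 4
      then obtain p where "is_path G a p b" using conn by blast
      then have "is_path ?H a p b" using mono[of p] by (auto simp: is_path_def)
      then show ?thesis by blast
    qed
  qed
  moreover have "\<not> is_cycle ?H p" for p
  proof
    assume p: "is_cycle ?H p"
    show False
    proof (cases "v \<in> set p")
      case True
      then obtain x y where xy: "x \<noteq> y" "{x, v} \<in> edges ?H" "{y, v} \<in> edges ?H"
        using cycle_two_neighbours[OF p] by metis
      then have "{x, v} = {u, v}" "{y, v} = {u, v}" using in_verts v by auto
      then show False using xy(1) by (metis doubleton_eq_iff)
    next
      case False
      have "successively (\<lambda>x y. {x, y} \<in> edges G) p"
      proof (rule successively_mono)
        show "successively (\<lambda>x y. {x, y} \<in> edges ?H) p" using p by (simp add: is_cycle_def)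
        show "{x, y} \<in> edges G" if "x \<in> set p" "y \<in> set p" "{x, y} \<in> edges ?H" for x y
          using that False by (auto simp: doubleton_eq_iff)
      qed
      moreover have "p \<noteq> []" "{last p, hd p} \<in> edges ?H"
        using p by (auto simp: is_cycle_def)
      then have "last p \<in> set p" "hd p \<in> set p" "{last p, hd p} \<in> edges ?H" by auto
      then have "{last p, hd p} \<in> edges G" using False by (auto simp: doubleton_eq_iff)
      ultimately have "is_cycle G p" using p by (auto simp: is_cycle_def)
      then show False using acyc by blast
    qed
  qed
  ultimately show ?thesis by (simp add: is_tree_def)
qed

lemma is_tree_graft:
  assumes "is_tree G" "p \<in> verts G" "distinct (nodes t)" "set (nodes t) \<inter> verts G = {}"
  shows "is_tree \<lparr>verts = verts G \<union> set (nodes t), edges = edges G \<union> planted_edges p t\<rparr>"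
  using assms
proof (induction t arbitrary: G p)
  case (ITip v)
  then show ?case using is_tree_add_leaf[of G p v] by simp
next
  case (IFork x l r)
  let ?G1 = "\<lparr>verts = insert x (verts G), edges = insert {p, x} (edges G)\<rparr>"
  let ?G2 = "\<lparr>verts = verts ?G1 \<union> set (nodes l), edges = edges ?G1 \<union> planted_edges x l\<rparr>"
  have 1: "is_tree ?G1" using is_tree_add_leaf[of G p x] IFork.prems by simp
  have 2: "is_tree ?G2" by (rule IFork.IH(1)[OF 1]) (use IFork.prems in auto)
  have "is_tree \<lparr>verts = verts ?G2 \<union> set (nodes r), edges = edges ?G2 \<union> planted_edges x r\<rparr>"
    by (rule IFork.IH(2)[OF 2]) (use IFork.prems in auto)
  then show ?case by (simp add: Un_ac)
qed

lemma is_tree_planted: "distinct (p # nodes t) \<Longrightarrow> is_tree (planted p t)"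
  using is_tree_graft[OF is_tree_single, of p p t] by (simp add: planted_def)

definition incident :: "nat set set \<Rightarrow> nat \<Rightarrow> nat set set" where
  "incident E v = {e \<in> E. v \<in> e}"

lemma vdegree_incident: "vdegree G v = card (incident (edges G) v)"
  by (simp add: vdegree_def incident_def)

lemma incident_Un: "incident (A \<union> B) v = incident A v \<union> incident B v"
  and incident_insert: "incident (insert e A) v = (if v \<in> e then insert e (incident A v) else incident A v)"
  and incident_empty: "incident {} v = {}"
  by (auto simp: incident_def)

lemma incident_planted_outside:
  "v \<notin> insert p (set (nodes t)) \<Longrightarrow> incident (planted_edges p t) v = {}"
  using planted_edges_subset by (auto simp: incident_def)

lemma incident_planted_base:
  assumes "p \<notin> set (nodes t)"
  shows "incident (planted_edges p t) p = {{p, top_node t}}"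
  using assms incident_planted_outside[of p]
  by (cases t) (auto simp: incident_insert incident_Un incident_empty)

lemma card_incident_planted:
  assumes "distinct (p # nodes t)" "v \<in> set (nodes t)"
  shows "card (incident (planted_edges p t) v) = (if v \<in> set (tips (erase t)) then 1 else 3)"
  using assms
proof (induction t arbitrary: p)
  case (ITip v)
  then show ?case by (simp add: incident_insert incident_empty)
next
  case (IFork x l r)
  have tl: "set (tips (erase l)) \<subseteq> set (nodes l)" "set (tips (erase r)) \<subseteq> set (nodes r)"
    by (rule tips_erase_subset_nodes)+
  have rl: "top_node l \<in> set (nodes l)" "top_node r \<in> set (nodes r)" by auto
  consider "v = x" | "v \<in> set (nodes l)" | "v \<in> set (nodes r)" using IFork.prems by auto
  then show ?case
  proof cases
    case 1
    have "incident (planted_edges p (IFork x l r)) v = {{p, x}, {x, top_node l}, {x, top_node r}}"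
      using 1 IFork.prems
        incident_planted_base[of x l] incident_planted_base[of x r]
      by (simp add: incident_insert incident_Un insert_commute)
    moreover have "set (nodes l) \<inter> set (nodes r) = {}" using IFork.prems by simp
    then have "top_node l \<noteq> top_node r" using rl by (metis disjoint_iff)
    then have "p \<noteq> top_node l" "p \<noteq> top_node r" "top_node l \<noteq> top_node r" "x \<noteq> top_node l" "x \<noteq> top_node r" "p \<noteq> x"
      using IFork.prems rl by auto
    then have "card {{p, x}, {x, top_node l}, {x, top_node r}} = 3"
      by (auto simp: doubleton_eq_iff card_insert_if)
    moreover have "x \<notin> set (tips (erase (IFork x l r)))" using IFork.prems tl by auto
    ultimately show ?thesis using 1 by simp
  next
    case 2
    then have "incident (planted_edges p (IFork x l r)) v = incident (planted_edges x l) v"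
      using IFork.prems incident_planted_outside[of v x r]
      by (auto simp: incident_insert incident_Un)
    then show ?thesis using IFork 2 tl by auto
  next
    case 3
    then have "incident (planted_edges p (IFork x l r)) v = incident (planted_edges x r) v"
      using IFork.prems incident_planted_outside[of v x l]
      by (auto simp: incident_insert incident_Un)
    then show ?thesis using IFork 3 tl by auto
  qed
qed

lemma vdegree_planted:
  assumes "distinct (p # nodes t)" "v \<in> verts (planted p t)"
  shows "vdegree (planted p t) v = (if v = p \<or> v \<in> set (tips (erase t)) then 1 else 3)"
proof (cases "v = p")
  case True
  then show ?thesis using assms incident_planted_base[of p t]
    by (simp add: vdegree_incident planted_def)
next
  case False
  then show ?thesis using assms card_incident_planted[of p t v]
    by (simp add: vdegree_incident planted_def)
qed

lemma itree_on_pos: "itree_on n t \<Longrightarrow> n \<ge> 1"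
  using tips_nonempty[of "erase t"] by (cases n) (auto simp: itree_on_def)

lemma binary_ltree_of:
  assumes "itree_on n t"
  shows "binary_ltree {0..n} (ltree_of t)"
proof -
  have n: "n \<ge> 1" using itree_on_pos[OF assms] .
  have d: "distinct (0 # nodes t)" and tips: "set (tips (erase t)) = {1..n}"
    using assms by (auto simp: itree_on_def)
  note deg = vdegree_planted[OF d]
  have "{v \<in> verts (planted 0 t). vdegree (planted 0 t) v = 1} = {0..n}"
  proof -
    have "{v \<in> verts (planted 0 t). vdegree (planted 0 t) v = 1}
        = {v \<in> verts (planted 0 t). v = 0 \<or> v \<in> set (tips (erase t))}"
      using deg by (intro Collect_cong) (simp cong: conj_cong)
    also have "\<dots> = insert 0 {1..n}"
      using tips tips_erase_subset_nodes[of t] by (auto simp: planted_def)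
    also have "\<dots> = {0..n}" by auto
    finally show ?thesis .
  qed
  then show ?thesis
    using n is_tree_planted[OF d] deg
    by (auto simp: binary_ltree_def ltree_of_def bij_betw_def inj_on_def)
qed

section \<open>Every leaf-labelled tree is planted\<close>

lemma expand_tip:
  assumes "distinct (p # nodes t)" "v \<in> set (tips (erase t))"
    "a \<notin> insert p (set (nodes t))" "b \<notin> insert p (set (nodes t))" "a \<noteq> b"
  shows "\<exists>t'. distinct (p # nodes t') \<and> set (nodes t') = set (nodes t) \<union> {a, b} \<and>
    planted_edges p t' = planted_edges p t \<union> {{v, a}, {v, b}}"
  using assms
proof (induction t arbitrary: p)
  case (ITip x)
  then show ?case by (intro exI[of _ "IFork x (ITip a) (ITip b)"]) auto
next
  case (IFork x l r)
  from IFork.prems(2) consider "v \<in> set (tips (erase l))" | "v \<in> set (tips (erase r))" by auto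
  then show ?case
  proof cases
    case 1
    then obtain l' where "distinct (x # nodes l')" "set (nodes l') = set (nodes l) \<union> {a, b}"
      "planted_edges x l' = planted_edges x l \<union> {{v, a}, {v, b}}"
      using IFork.IH(1)[of x] IFork.prems by auto
    then show ?thesis using IFork.prems by (intro exI[of _ "IFork x l' r"]) auto
  next
    case 2
    then obtain r' where "distinct (x # nodes r')" "set (nodes r') = set (nodes r) \<union> {a, b}"
      "planted_edges x r' = planted_edges x r \<union> {{v, a}, {v, b}}"
      using IFork.IH(2)[of x] IFork.prems by auto
    then show ?thesis using IFork.prems by (intro exI[of _ "IFork x l r'"]) auto
  qed
qed

lemma path_prefix_cycle:
  assumes "successively (\<lambda>x y. {x, y} \<in> E) (a # b # q)" "distinct (a # b # q)"
    "x \<in> set q" "{x, a} \<in> E"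
  shows "\<exists>c. is_cycle \<lparr>verts = V, edges = E\<rparr> c"
proof -
  obtain q1 q2 where q: "q = q1 @ x # q2" using assms(3) by (meson split_list)
  have "a # b # q = (a # b # q1 @ [x]) @ q2" using q by simp
  then have "successively (\<lambda>x y. {x, y} \<in> E) (a # b # q1 @ [x])"
    using assms(1) by (metis successively_append_iff)
  then have "is_cycle \<lparr>verts = V, edges = E\<rparr> (a # b # q1 @ [x])"
    using assms q by (auto simp: is_cycle_def)
  then show ?thesis by blast
qed

text \<open>A longest path from the base vertex \<open>p\<close> ends in a cherry, which is cut off to recurse.\<close>

lemma planted_tree_exists:
  assumes "finite V"
    and "\<And>e. e \<in> E \<Longrightarrow> \<exists>u v. u \<in> V \<and> v \<in> V \<and> u \<noteq> v \<and> e = {u, v}"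
    and "\<And>c. \<not> is_cycle \<lparr>verts = V, edges = E\<rparr> c"
    and "\<And>v. v \<in> V \<Longrightarrow> card (incident E v) \<in> {1, 3}"
    and "p \<in> V" "card (incident E p) = 1"
    and "\<And>W. \<lbrakk>W \<subseteq> V; p \<in> W; \<And>u v. u \<in> W \<Longrightarrow> {u, v} \<in> E \<Longrightarrow> v \<in> W\<rbrakk> \<Longrightarrow> W = V"
  shows "\<exists>t. distinct (p # nodes t) \<and> V = insert p (set (nodes t)) \<and> E = planted_edges p t"
  using assms
proof (induction "card V" arbitrary: V E rule: less_induct)
  case less
  note fin = less.prems(1) and wf = less.prems(2) and acyc = less.prems(3)
    and deg = less.prems(4) and p = less.prems(5,6) and conn = less.prems(7)
  have no_loop: "u \<noteq> v" and in_V: "u \<in> V" "v \<in> V" if "{u, v} \<in> E" for u v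
    using wf[OF that] by (auto simp: doubleton_eq_iff)
  define path where "path q \<longleftrightarrow> q \<noteq> [] \<and> last q = p \<and> distinct q \<and> set q \<subseteq> V \<and>
    successively (\<lambda>x y. {x, y} \<in> E) q" for q
  have "path [p]" using p by (simp add: path_def)
  moreover have "\<forall>q. path q \<longrightarrow> length q < Suc (card V)"
    using fin by (auto simp: path_def less_Suc_eq_le card_mono distinct_card[symmetric])
  ultimately obtain q where q: "path q" and q_max: "\<And>q'. path q' \<Longrightarrow> length q' \<le> length q"
    using ex_has_greatest_nat[of path "[p]" length "Suc (card V)"] by blast
  obtain e where e: "incident E p = {e}" using p(2) by (auto simp: card_1_singleton_iff)
  then have "e \<in> E" "p \<in> e" by (auto simp: incident_def)
  then obtain p' where p': "e = {p', p}" "p' \<noteq> p" "p' \<in> V" using wf by blast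
  then have "path [p', p]" using p \<open>e \<in> E\<close> by (auto simp: path_def)
  then have "length q \<ge> 2" using q_max by fastforce
  have end_deg: "incident E w = {{v, w}}"
    if wvr: "path (w # v # rest)" "length (w # v # rest) = length q" for w v rest
  proof -
    have adj: "{w, v} \<in> E" using wvr by (simp add: path_def)
    have "x = v" if x: "{w, x} \<in> E" for x
    proof (rule ccontr)
      assume "x \<noteq> v"
      show False
      proof (cases "x \<in> set (w # v # rest)")
        case True
        then have "x \<in> set rest" using x no_loop \<open>x \<noteq> v\<close> by auto
        then show False using path_prefix_cycle[of E w v rest x V] acyc x wvr
          by (auto simp: path_def insert_commute)
      next
        case False
        then have "path (x # w # v # rest)"
          using wvr x in_V[OF x] by (auto simp: path_def insert_commute)
        then show False using q_max wvr by fastforce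
      qed
    qed
    then have "e = {v, w}" if "e \<in> incident E w" for e
    proof -
      have "e \<in> E" "w \<in> e" using that by (auto simp: incident_def)
      then obtain y where "e = {w, y}" using wf by blast
      then show ?thesis using \<open>e \<in> E\<close> \<open>\<And>x. {w, x} \<in> E \<Longrightarrow> x = v\<close> by (metis insert_commute)
    qed
    then show ?thesis using adj by (auto simp: incident_def insert_commute)
  qed
  obtain w v rest where qe: "q = w # v # rest"
    using \<open>length q \<ge> 2\<close> by (metis Suc_le_length_iff numeral_2_eq_2)
  have w_deg: "incident E w = {{v, w}}" using end_deg q qe by blast
  have wv: "{w, v} \<in> E" "w \<in> V" "v \<in> V" "w \<noteq> v" using q by (auto simp: qe path_def)
  show ?case
  proof (cases rest)
    case Nil
    then have v: "v = p" using q by (simp add: qe path_def)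
    have p_deg: "incident E p = {{p, w}}"
    proof -
      have "{p, w} \<in> incident E p" using wv(1) v by (simp add: incident_def insert_commute)
      then show ?thesis using e by simp
    qed
    have V: "{p, w} = V"
    proof (rule conn)
      show "b \<in> {p, w}" if "a \<in> {p, w}" "{a, b} \<in> E" for a b
      proof -
        have "{a, b} \<in> incident E a" using that by (simp add: incident_def)
        then have "{a, b} = {p, w}" using that(1) p_deg w_deg v by auto
        then show ?thesis by blast
      qed
    qed (use p wv in auto)
    have "E = {{p, w}}"
    proof
      show "E \<subseteq> {{p, w}}"
      proof
        fix e assume "e \<in> E"
        then obtain a b where "a \<in> V" "b \<in> V" "a \<noteq> b" "e = {a, b}" using wf by blast
        then show "e \<in> {{p, w}}" using V by auto
      qed
    qed (use wv v in \<open>auto simp: insert_commute\<close>)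
    then show ?thesis using V wv v by (intro exI[of _ "ITip w"]) auto
  next
    case (Cons u rest')
    then have vu: "{v, u} \<in> E" "w \<noteq> u" "v \<noteq> u" "u \<in> V" and vp: "v \<noteq> p" and wp: "w \<noteq> p"
      using q by (auto simp: qe path_def split: if_splits)
    have sub: "{{v, w}, {v, u}} \<subseteq> incident E v"
      using wv vu by (auto simp: incident_def insert_commute)
    have two: "card {{v, w}, {v, u}} = 2" using vu(2) by (auto simp: doubleton_eq_iff)
    have v3: "card (incident E v) = 3"
    proof -
      have "card (incident E v) \<noteq> 1" using sub two
        by (metis card_1_singletonE card_mono finite.emptyI finite_insert numeral_le_one_iff semiring_norm(69))
      then show ?thesis using deg[OF wv(3)] by auto
    qed
    have "card (incident E v - {{v, w}, {v, u}}) = 1"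
      using card_Diff_subset[OF _ sub] v3 two by auto
    then obtain e3 where "incident E v - {{v, w}, {v, u}} = {e3}" by (auto simp: card_1_singleton_iff)
    then have e3: "incident E v = {{v, w}, {v, u}, e3}" "e3 \<notin> {{v, w}, {v, u}}"
      using sub by blast+
    then have "e3 \<in> E" "v \<in> e3" by (auto simp: incident_def)
    then obtain w' where w': "e3 = {v, w'}" "w' \<noteq> v" "w' \<in> V" using wf by blast
    then have ww: "w' \<noteq> w" "w' \<noteq> u" using e3(2) by auto
    have vw': "{v, w'} \<in> E" using w' \<open>e3 \<in> E\<close> by simp
    have "w' \<notin> set rest'"
    proof
      assume "w' \<in> set rest'"
      then show False
        using path_prefix_cycle[of E v u rest' w' V] q acyc vw' Cons
        by (auto simp: qe path_def insert_commute)
    qed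
    then have w'_new: "w' \<notin> set q" using ww w' Cons qe by auto
    then have "path (w' # v # rest)"
      using q vw' w'(3) by (auto simp: qe path_def insert_commute)
    then have w'_deg: "incident E w' = {{v, w'}}" using end_deg qe by simp
    have "p \<in> set q" using q by (auto simp: path_def)
    then have w'p: "w' \<noteq> p" using w'_new by auto
    define V' E' where "V' = V - {w, w'}" and "E' = E - {{v, w}, {v, w'}}"
    have inc_v: "incident E' v = {{v, u}}"
    proof -
      have "incident E' v = incident E v - {{v, w}, {v, w'}}" by (auto simp: incident_def E'_def)
      moreover have "{v, u} \<noteq> {v, w}" "{v, u} \<noteq> {v, w'}" using vu ww by (auto simp: doubleton_eq_iff)
      ultimately show ?thesis using e3(1) w'(1) by auto
    qed
    have inc: "incident E' x = incident E x" if "x \<in> V'" "x \<noteq> v" for x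
      using that by (auto simp: incident_def E'_def V'_def)
    have "\<exists>t. distinct (p # nodes t) \<and> V' = insert p (set (nodes t)) \<and> E' = planted_edges p t"
    proof (rule less.hyps)
      show "card V' < card V"
        unfolding V'_def using wv fin by (intro psubset_card_mono) auto
      show "finite V'" using fin by (simp add: V'_def)
      show "\<exists>a b. a \<in> V' \<and> b \<in> V' \<and> a \<noteq> b \<and> e = {a, b}" if "e \<in> E'" for e
      proof -
        obtain a b where ab: "a \<in> V" "b \<in> V" "a \<noteq> b" "e = {a, b}"
          using wf \<open>e \<in> E'\<close> unfolding E'_def by blast
        have "w \<notin> e" "w' \<notin> e" using that w_deg w'_deg unfolding E'_def incident_def by blast+
        then show ?thesis using ab unfolding V'_def by blast
      qed
      show "\<not> is_cycle \<lparr>verts = V', edges = E'\<rparr> c" for c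
      proof
        assume c: "is_cycle \<lparr>verts = V', edges = E'\<rparr> c"
        have "successively (\<lambda>x y. {x, y} \<in> E) c"
          by (rule successively_mono[of "\<lambda>x y. {x, y} \<in> E'"]) (use c in \<open>auto simp: is_cycle_def E'_def\<close>)
        then have "is_cycle \<lparr>verts = V, edges = E\<rparr> c" using c by (auto simp: is_cycle_def E'_def)
        then show False using acyc by blast
      qed
      show "card (incident E' x) \<in> {1, 3}" if "x \<in> V'" for x
        using inc_v inc that deg unfolding V'_def by (cases "x = v") auto
      show pV: "p \<in> V'" using p wp w'p by (simp add: V'_def)
      show "card (incident E' p) = 1" using inc[OF pV] vp p by simp
      show "W = V'" if W: "W \<subseteq> V'" "p \<in> W" "\<And>a b. a \<in> W \<Longrightarrow> {a, b} \<in> E' \<Longrightarrow> b \<in> W" for W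
      proof -
        define W2 where "W2 = (if v \<in> W then W \<union> {w, w'} else W)"
        have "W2 = V"
        proof (rule conn)
          show "W2 \<subseteq> V" using W(1) wv w' by (auto simp: W2_def V'_def)
          show "p \<in> W2" using W by (auto simp: W2_def)
          fix a b assume ab: "a \<in> W2" "{a, b} \<in> E"
          show "b \<in> W2"
          proof (cases "a \<in> W")
            case True
            show ?thesis
            proof (cases "{a, b} \<in> E'")
              case True
              then show ?thesis using W(3) \<open>a \<in> W\<close> by (auto simp: W2_def)
            next
              case False
              then have "{a, b} = {v, w} \<or> {a, b} = {v, w'}" using ab by (auto simp: E'_def)
              moreover have "a \<noteq> w" "a \<noteq> w'" using True W(1) by (auto simp: V'_def)
              ultimately show ?thesis using \<open>a \<in> W\<close> by (auto simp: doubleton_eq_iff W2_def)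
            qed
          next
            case False
            then have a: "v \<in> W" "a = w \<or> a = w'" using ab by (auto simp: W2_def split: if_splits)
            have "{a, b} \<in> incident E a" using ab by (simp add: incident_def)
            then have "{a, b} = {v, a}" using a(2) w_deg w'_deg by auto
            then have "b = v" using no_loop[OF ab(2)] by (auto simp: doubleton_eq_iff)
            then show ?thesis using a by (simp add: W2_def)
          qed
        qed
        then have "v \<in> W" "W \<union> {w, w'} = V"
          using wv W(1) by (auto simp: W2_def V'_def split: if_splits)
        then show ?thesis using W(1) by (auto simp: V'_def)
      qed
    qed
    then obtain t where t: "distinct (p # nodes t)" "V' = insert p (set (nodes t))"
      "E' = planted_edges p t" by blast
    have "v \<in> V'" using wv w' by (auto simp: V'_def)
    then have "v \<in> set (nodes t)" using t vp by auto
    then have "v \<in> set (tips (erase t))"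
      using card_incident_planted[OF t(1), of v] inc_v t(3) by (auto split: if_splits)
    then obtain t' where t': "distinct (p # nodes t')" "set (nodes t') = set (nodes t) \<union> {w, w'}"
      "planted_edges p t' = planted_edges p t \<union> {{v, w}, {v, w'}}"
      using expand_tip[OF t(1), of v w w'] t(2) ww by (auto simp: V'_def)
    moreover have "V = V' \<union> {w, w'}" using wv w' by (auto simp: V'_def)
    moreover have "E = E' \<union> {{v, w}, {v, w'}}"
      using wv vw' by (auto simp: E'_def insert_commute)
    ultimately show ?thesis using t by (intro exI[of _ t']) auto
  qed
qed

fun rename :: "(nat \<Rightarrow> nat) \<Rightarrow> itree \<Rightarrow> itree" where
  "rename f (ITip v) = ITip (f v)"
| "rename f (IFork x l r) = IFork (f x) (rename f l) (rename f r)"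

lemma nodes_rename: "nodes (rename f t) = map f (nodes t)"
  by (induction t) auto

lemma tips_rename: "tips (erase (rename f t)) = map f (tips (erase t))"
  by (induction t) auto

lemma planted_edges_rename:
  "planted_edges (f p) (rename f t) = (\<lambda>e. f ` e) ` planted_edges p t"
  by (induction t arbitrary: p) (auto simp: image_Un)

lemma rename_cong: "(\<And>v. v \<in> set (nodes t) \<Longrightarrow> f v = g v) \<Longrightarrow> rename f t = rename g t"
  by (induction t) auto

lemma rename_iso:
  assumes "binary_ltree {0..n} S" "shape S = planted p t" "inj_on f (insert p (set (nodes t)))"
    "f p = 0" "\<And>x. x \<le> n \<Longrightarrow> f (leaf S x) = x" "itree_on n (rename f t)"
  shows "(S, ltree_of (rename f t)) \<in> ltree_iso {0..n}"
proof -
  have "bij_betw f (verts (shape S)) (verts (shape (ltree_of (rename f t))))"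
    using assms by (simp add: bij_betw_def planted_def ltree_of_def nodes_rename)
  moreover have "edges (shape (ltree_of (rename f t))) = (\<lambda>e. f ` e) ` edges (shape S)"
    using planted_edges_rename[of f p t] assms by (simp add: planted_def ltree_of_def)
  moreover have "\<forall>x\<in>{0..n}. f (leaf S x) = leaf (ltree_of (rename f t)) x"
    using assms by (simp add: ltree_of_def)
  ultimately show ?thesis
    using assms(1) binary_ltree_of[OF assms(6)] unfolding ltree_iso_def by blast
qed

lemma closed_set_contains_path:
  assumes "successively (\<lambda>x y. {x, y} \<in> E) q" "q \<noteq> []" "hd q \<in> W"
    "\<And>u v. u \<in> W \<Longrightarrow> {u, v} \<in> E \<Longrightarrow> v \<in> W"
  shows "set q \<subseteq> W"
  using assms
proof (induction q)
  case (Cons a q)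
  then show ?case by (cases q) auto
qed simp

lemma binary_ltree_iso_ltree_of:
  assumes "binary_ltree {0..n} S" "n \<ge> 1"
  shows "\<exists>t. itree_on n t \<and> (S, ltree_of t) \<in> ltree_iso {0..n}"
proof -
  let ?V = "verts (shape S)" and ?E = "edges (shape S)" and ?p = "leaf S 0"
  have tree: "is_tree (shape S)" and deg: "\<And>v. v \<in> ?V \<Longrightarrow> vdegree (shape S) v \<in> {1, 3}"
    and bij: "bij_betw (leaf S) {0..n} {v \<in> ?V. vdegree (shape S) v = 1}"
    using assms by (auto simp: binary_ltree_def)
  have wf: "ugraph_wf (shape S)" using tree by (simp add: is_tree_def)
  have p: "?p \<in> ?V" "vdegree (shape S) ?p = 1" using bij by (auto simp: bij_betw_def)
  have "\<exists>t. distinct (?p # nodes t) \<and> ?V = insert ?p (set (nodes t)) \<and> ?E = planted_edges ?p t"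
  proof (rule planted_tree_exists)
    show "finite ?V" using wf by (simp add: ugraph_wf_def)
    show "\<exists>u v. u \<in> ?V \<and> v \<in> ?V \<and> u \<noteq> v \<and> e = {u, v}" if "e \<in> ?E" for e
      using wf that unfolding ugraph_wf_def by blast
    show "\<not> is_cycle \<lparr>verts = ?V, edges = ?E\<rparr> c" for c
      using tree by (simp add: is_tree_def is_cycle_def)
    show "card (incident ?E v) \<in> {1, 3}" if "v \<in> ?V" for v
      using deg[OF that] by (simp add: vdegree_incident)
    show "?p \<in> ?V" by (rule p)
    show "card (incident ?E ?p) = 1" using p by (simp add: vdegree_incident)
    show "W = ?V" if W: "W \<subseteq> ?V" "?p \<in> W" "\<And>u v. u \<in> W \<Longrightarrow> {u, v} \<in> ?E \<Longrightarrow> v \<in> W" for W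
    proof
      show "?V \<subseteq> W"
      proof
        fix v assume "v \<in> ?V"
        then obtain q where "is_path (shape S) ?p q v" using tree p(1) unfolding is_tree_def by blast
        then show "v \<in> W" using closed_set_contains_path[of ?E q W] W
          unfolding is_path_def by (metis last_in_set subsetD)
      qed
    qed (rule W(1))
  qed
  then obtain t where d: "distinct (?p # nodes t)" and V: "?V = insert ?p (set (nodes t))"
    and E: "?E = planted_edges ?p t" by blast
  have sh: "shape S = planted ?p t" using V E by (simp add: planted_def)
  define f where
    "f v = (if v \<in> leaf S ` {0..n} then inv_into {0..n} (leaf S) v else n + 1 + v)" for v
  have inj: "inj_on (leaf S) {0..n}" using bij by (simp add: bij_betw_def)
  have fl: "f (leaf S x) = x" if "x \<le> n" for x
    using that inj by (simp add: f_def)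
  have f_le: "f v \<le> n" if "v \<in> leaf S ` {0..n}" for v using that fl by auto
  have f_gt: "f v = n + 1 + v" if "v \<notin> leaf S ` {0..n}" for v using that by (simp add: f_def)
  have f_inj: "inj f"
  proof (rule injI)
    fix u v assume uv: "f u = f v"
    show "u = v"
    proof (cases "u \<in> leaf S ` {0..n}")
      case True
      then have "v \<in> leaf S ` {0..n}" using uv f_le[of u] f_gt[of v] by linarith
      then show ?thesis using True uv fl by auto
    next
      case False
      then have "v \<notin> leaf S ` {0..n}" using uv f_le[of v] f_gt[of u] by linarith
      then show ?thesis using False uv f_gt by simp
    qed
  qed
  have "set (tips (erase t)) = leaf S ` {1..n}"
  proof -
    have "{v \<in> ?V. vdegree (shape S) v = 1} = insert ?p (set (tips (erase t)))"
    proof -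
      have "{v \<in> ?V. vdegree (shape S) v = 1} = {v \<in> ?V. v = ?p \<or> v \<in> set (tips (erase t))}"
        using vdegree_planted[OF d] unfolding sh by (intro Collect_cong) (simp cong: conj_cong)
      then show ?thesis using V tips_erase_subset_nodes[of t] by auto
    qed
    moreover have "{v \<in> ?V. vdegree (shape S) v = 1} = leaf S ` insert 0 {1..n}"
    proof -
      have "insert 0 {1..n} = {0..n}" by auto
      then show ?thesis using bij by (simp add: bij_betw_def)
    qed
    moreover have "?p \<notin> set (tips (erase t))" using d tips_erase_subset_nodes[of t] by auto
    moreover have "?p \<notin> leaf S ` {1..n}"
    proof
      assume "?p \<in> leaf S ` {1..n}"
      then obtain x where "x \<in> {1..n}" "leaf S 0 = leaf S x" by blast
      then show False using inj_onD[OF inj, of 0 x] by simp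
    qed
    ultimately show ?thesis by (metis image_insert insert_ident)
  qed
  then have "set (tips (erase (rename f t))) = {1..n}"
    unfolding tips_rename set_map using fl by (auto simp: image_image)
  moreover have "distinct (map f (?p # nodes t))"
    using d f_inj by (metis distinct_map inj_on_subset subset_UNIV)
  then have "distinct (0 # nodes (rename f t))" using fl[of 0] by (simp add: nodes_rename)
  ultimately have on: "itree_on n (rename f t)" by (simp add: itree_on_def)
  have "(S, ltree_of (rename f t)) \<in> ltree_iso {0..n}"
    using rename_iso[OF assms(1) sh inj_on_subset[OF f_inj subset_UNIV]] fl on by simp
  then show ?thesis using on by blast
qed

lemma erase_eq_imp_rename:
  assumes "erase t = erase t'" "distinct (nodes t)"
  shows "\<exists>f. rename f t = t' \<and> (\<forall>v\<in>set (tips (erase t)). f v = v)"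
  using assms
proof (induction t arbitrary: t')
  case (ITip v)
  then show ?case by (cases t') (auto intro: exI[of _ "\<lambda>x. x"])
next
  case (IFork x l r)
  then obtain x' l' r' where t': "t' = IFork x' l' r'" "erase l = erase l'" "erase r = erase r'"
    by (cases t') auto
  obtain f g where f: "rename f l = l'" "\<forall>v\<in>set (tips (erase l)). f v = v"
    and g: "rename g r = r'" "\<forall>v\<in>set (tips (erase r)). g v = v"
    using IFork t' by fastforce
  define h where "h v = (if v = x then x' else if v \<in> set (nodes l) then f v else g v)" for v
  have "rename h l = rename f l" "rename h r = rename g r"
    by (rule rename_cong; use IFork.prems in \<open>auto simp: h_def\<close>)+
  moreover have "h v = v" if "v \<in> set (tips (erase l)) \<union> set (tips (erase r))" for v
    using that f g IFork.prems tips_erase_subset_nodes[of l] tips_erase_subset_nodes[of r]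
    by (auto simp: h_def)
  moreover have "h x = x'" by (simp add: h_def)
  ultimately show ?case using f g t' by (intro exI[of _ h]) auto
qed

lemma erase_eq_iso:
  assumes "itree_on n t" "itree_on n t'" "erase t = erase t'"
  shows "(ltree_of t, ltree_of t') \<in> ltree_iso {0..n}"
proof -
  obtain f where f: "rename f t = t'" "\<forall>v\<in>set (tips (erase t)). f v = v"
    using erase_eq_imp_rename[OF assms(3)] assms(1) by (auto simp: itree_on_def)
  define g where "g = f(0 := 0)"
  have d: "distinct (0 # nodes t)" "distinct (0 # nodes t')" "set (tips (erase t)) = {1..n}"
    using assms by (auto simp: itree_on_def)
  have r: "rename g t = t'"
    unfolding f(1)[symmetric] by (rule rename_cong) (use d in \<open>auto simp: g_def\<close>)
  have "map g (0 # nodes t) = 0 # nodes t'" unfolding r[symmetric] by (simp add: nodes_rename g_def)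
  then have "distinct (map g (0 # nodes t))" using d(2) by (metis)
  then have "inj_on g (set (0 # nodes t))" unfolding distinct_map by blast
  then have "(ltree_of t, ltree_of (rename g t)) \<in> ltree_iso {0..n}"
    by (intro rename_iso[where p = 0] binary_ltree_of assms)
      (use f d r assms in \<open>auto simp: ltree_of_def g_def\<close>)
  then show ?thesis by (simp add: r)
qed

section \<open>Grafting\<close>

fun inner_edges :: "itree \<Rightarrow> nat set set" where
  "inner_edges (ITip v) = {}"
| "inner_edges (IFork x l r) = planted_edges x l \<union> planted_edges x r"

lemma planted_edges_inner: "planted_edges p t = insert {p, top_node t} (inner_edges t)"
  by (cases t) auto

lemma inner_edges_subset: "e \<in> inner_edges t \<Longrightarrow> e \<subseteq> set (nodes t)"
  by (cases t) (auto dest!: planted_edges_subset)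

inductive graft :: "btree \<Rightarrow> btree \<Rightarrow> btree \<Rightarrow> bool" for s where
  graft_left: "graft s t (Fork s t)"
| graft_right: "graft s t (Fork t s)"
| graft_in_left: "graft s l l' \<Longrightarrow> graft s (Fork l r) (Fork l' r)"
| graft_in_right: "graft s r r' \<Longrightarrow> graft s (Fork l r) (Fork l r')"

inductive igraft :: "nat \<Rightarrow> itree \<Rightarrow> itree \<Rightarrow> itree \<Rightarrow> bool" for x s where
  igraft_left: "igraft x s t (IFork x s t)"
| igraft_right: "igraft x s t (IFork x t s)"
| igraft_in_left: "igraft x s l l' \<Longrightarrow> igraft x s (IFork y l r) (IFork y l' r)"
| igraft_in_right: "igraft x s r r' \<Longrightarrow> igraft x s (IFork y l r) (IFork y l r')"

lemma graft_imp_igraft: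
  assumes "graft (erase s) u u'" "erase t = u"
  shows "\<exists>t'. igraft x s t t' \<and> erase t' = u'"
  using assms
proof (induction arbitrary: t rule: graft.induct)
  case (graft_left u)
  then show ?case by (intro exI[of _ "IFork x s t"]) (auto intro: igraft.intros)
next
  case (graft_right u)
  then show ?case by (intro exI[of _ "IFork x t s"]) (auto intro: igraft.intros)
next
  case (graft_in_left l l' r)
  then obtain y tl tr where t: "t = IFork y tl tr" "erase tl = l" "erase tr = r"
    by (cases t) auto
  then obtain t' where "igraft x s tl t'" "erase t' = l'" using graft_in_left by blast
  then show ?case using t by (intro exI[of _ "IFork y t' tr"]) (auto intro: igraft.intros)
next
  case (graft_in_right r r' l)
  then obtain y tl tr where t: "t = IFork y tl tr" "erase tl = l" "erase tr = r"
    by (cases t) auto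
  then obtain t' where "igraft x s tr t'" "erase t' = r'" using graft_in_right by blast
  then show ?case using t by (intro exI[of _ "IFork y tl t'"]) (auto intro: igraft.intros)
qed

lemma graft_tips:
  assumes "graft s t t'"
  shows "set (tips t') = set (tips s) \<union> set (tips t)"
    and "distinct (tips t') \<longleftrightarrow> distinct (tips s @ tips t)"
proof -
  show 1: "set (tips t') = set (tips s) \<union> set (tips t)"
    using assms by (induction rule: graft.induct) auto
  have st: "set (tips t') = set (tips s) \<union> set (tips t)" if "graft s t t'" for t t'
    using that by (induction rule: graft.induct) auto
  show "distinct (tips t') \<longleftrightarrow> distinct (tips s @ tips t)"
    using assms by (induction rule: graft.induct) (auto dest!: st)
qed

lemma igraft_nodes:
  assumes "igraft x s t t'"
  shows "set (nodes t') = insert x (set (nodes s) \<union> set (nodes t))"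
    and "distinct (x # nodes s @ nodes t) \<Longrightarrow> distinct (nodes t')"
proof -
  have st: "set (nodes t') = insert x (set (nodes s) \<union> set (nodes t))" if "igraft x s t t'" for t t'
    using that by (induction rule: igraft.induct) auto
  then show "set (nodes t') = insert x (set (nodes s) \<union> set (nodes t))" using assms by blast
  show "distinct (x # nodes s @ nodes t) \<Longrightarrow> distinct (nodes t')"
    using assms by (induction rule: igraft.induct) (auto dest!: st)
qed

lemma igraft_edges:
  assumes "igraft x s t t'" "distinct (p # x # nodes s @ nodes t)"
  shows "\<exists>a b. a \<noteq> b \<and> {a, b} \<in> planted_edges p t \<and>
    planted_edges p t' = planted_edges p t - {{a, b}} \<union> {{a, x}, {x, b}} \<union> planted_edges x s"
  using assms
proof (induction arbitrary: p rule: igraft.induct)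
  case (igraft_left t)
  have "{p, top_node t} \<notin> inner_edges t" using inner_edges_subset[of _ t] igraft_left by auto
  then have "planted_edges p (IFork x s t) =
    planted_edges p t - {{p, top_node t}} \<union> {{p, x}, {x, top_node t}} \<union> planted_edges x s"
    unfolding planted_edges.simps planted_edges_inner[of p t] planted_edges_inner[of x t] by auto
  moreover have "p \<noteq> top_node t" using igraft_left by auto
  ultimately show ?case using top_edge_planted by blast
next
  case (igraft_right t)
  have "{p, top_node t} \<notin> inner_edges t" using inner_edges_subset[of _ t] igraft_right by auto
  then have "planted_edges p (IFork x t s) =
    planted_edges p t - {{p, top_node t}} \<union> {{p, x}, {x, top_node t}} \<union> planted_edges x s"
    unfolding planted_edges.simps planted_edges_inner[of p t] planted_edges_inner[of x t] by auto
  moreover have "p \<noteq> top_node t" using igraft_right by auto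
  ultimately show ?case using top_edge_planted by blast
next
  case (igraft_in_left l l' y r)
  have "distinct (y # x # nodes s @ nodes l)" using igraft_in_left.prems by auto
  then obtain a b where ab: "a \<noteq> b" "{a, b} \<in> planted_edges y l"
    "planted_edges y l' = planted_edges y l - {{a, b}} \<union> {{a, x}, {x, b}} \<union> planted_edges x s"
    using igraft_in_left.IH by blast
  have sub: "{a, b} \<subseteq> insert y (set (nodes l))" using planted_edges_subset ab(2) by blast
  have "{a, b} \<noteq> {p, y}" using sub ab(1) igraft_in_left.prems by (auto simp: doubleton_eq_iff)
  moreover have "{a, b} \<notin> planted_edges y r"
  proof
    assume "{a, b} \<in> planted_edges y r"
    then have "{a, b} \<subseteq> insert y (set (nodes r))" by (rule planted_edges_subset)
    then have "a = y" "b = y" using sub igraft_in_left.prems by auto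
    then show False using ab(1) by simp
  qed
  ultimately have "planted_edges p (IFork y l' r) = planted_edges p (IFork y l r) - {{a, b}} \<union>
    {{a, x}, {x, b}} \<union> planted_edges x s"
    unfolding planted_edges.simps ab(3) by auto
  moreover have "{a, b} \<in> planted_edges p (IFork y l r)" using ab(2) by simp
  ultimately show ?case using ab(1) by blast
next
  case (igraft_in_right r r' y l)
  have "distinct (y # x # nodes s @ nodes r)" using igraft_in_right.prems by auto
  then obtain a b where ab: "a \<noteq> b" "{a, b} \<in> planted_edges y r"
    "planted_edges y r' = planted_edges y r - {{a, b}} \<union> {{a, x}, {x, b}} \<union> planted_edges x s"
    using igraft_in_right.IH by blast
  have sub: "{a, b} \<subseteq> insert y (set (nodes r))" using planted_edges_subset ab(2) by blast
  have "{a, b} \<noteq> {p, y}" using sub ab(1) igraft_in_right.prems by (auto simp: doubleton_eq_iff)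
  moreover have "{a, b} \<notin> planted_edges y l"
  proof
    assume "{a, b} \<in> planted_edges y l"
    then have "{a, b} \<subseteq> insert y (set (nodes l))" by (rule planted_edges_subset)
    then have "a = y" "b = y" using sub igraft_in_right.prems by auto
    then show False using ab(1) by simp
  qed
  ultimately have "planted_edges p (IFork y l r') = planted_edges p (IFork y l r) - {{a, b}} \<union>
    {{a, x}, {x, b}} \<union> planted_edges x s"
    unfolding planted_edges.simps ab(3) by auto
  moreover have "{a, b} \<in> planted_edges p (IFork y l r)" using ab(2) by simp
  ultimately show ?case using ab(1) by blast
qed

lemma crossing_path_contains:
  assumes "successively (\<lambda>x y. {x, y} \<in> E) q" "q \<noteq> []" "hd q \<notin> S" "last q \<in> S"
    "\<And>w z. {w, z} \<in> E \<Longrightarrow> w \<notin> S \<Longrightarrow> z \<in> S \<Longrightarrow> w = x"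
  shows "x \<in> set q"
  using assms
proof (induction q)
  case (Cons a q)
  then show ?case by (cases "q = []") (auto simp: successively_Cons)
qed simp

lemma on_path_crossing:
  assumes "is_tree G" "u \<in> verts G" "v \<in> verts G" "u \<notin> S" "v \<in> S"
    "\<And>w z. {w, z} \<in> edges G \<Longrightarrow> w \<notin> S \<Longrightarrow> z \<in> S \<Longrightarrow> w = x"
  shows "on_path G u v x"
proof -
  obtain q where q: "is_path G u q v" using assms(1-3) unfolding is_tree_def by blast
  then have "x \<in> set q"
    using crossing_path_contains[of "edges G" q S x] assms(4-6) by (auto simp: is_path_def)
  then show ?thesis using q by (auto simp: on_path_def)
qed

lemma is_tree_inner:
  assumes "distinct (nodes t)"
  shows "is_tree \<lparr>verts = set (nodes t), edges = inner_edges t\<rparr>"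
proof (cases t)
  case (ITip v)
  then show ?thesis by (simp add: is_tree_single)
next
  case (IFork x l r)
  let ?G = "\<lparr>verts = insert x (set (nodes l)), edges = planted_edges x l\<rparr>"
  have "is_tree ?G" using is_tree_planted[of x l] assms IFork by (simp add: planted_def)
  then have "is_tree \<lparr>verts = verts ?G \<union> set (nodes r), edges = edges ?G \<union> planted_edges x r\<rparr>"
    by (rule is_tree_graft) (use assms IFork in auto)
  then show ?thesis using IFork by simp
qed

lemma card_incident_inner:
  assumes "distinct (nodes t)" "v \<in> set (nodes t)" "v \<noteq> top_node t"
  shows "card (incident (inner_edges t) v) \<in> {1, 3}"
proof -
  obtain p where p: "p \<notin> set (nodes t)" using infinite_UNIV_nat
    by (metis ex_new_if_finite finite_set)
  then have "incident (planted_edges p t) v = incident (inner_edges t) v"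
    using assms by (auto simp: planted_edges_inner incident_insert)
  then show ?thesis using card_incident_planted[of p t v] p assms by auto
qed

lemma card_incident_inner_top:
  assumes "distinct (nodes t)"
  shows "card (incident (inner_edges t) (top_node t)) \<in> {0, 2}"
proof (cases t)
  case (IFork x l r)
  have "incident (inner_edges t) x = {{x, top_node l}, {x, top_node r}}"
    using assms IFork by (auto simp: incident_Un incident_planted_base)
  moreover have "set (nodes l) \<inter> set (nodes r) = {}" using assms IFork by simp
  then have "top_node l \<noteq> top_node r" by (metis disjoint_iff top_node_in_nodes)
  ultimately show ?thesis using IFork by (auto simp: doubleton_eq_iff)
qed (simp add: incident_empty)

text \<open>The half of a TBR move that concerns the pruned subtree: its top node has become a vertex of
  degree two and is suppressed, and subdividing the resulting edge restores it.\<close>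

lemma suppress_top_node:
  assumes d: "distinct (nodes s)" and V: "V \<inter> set (nodes s) = {}" and E: "\<And>e. e \<in> E \<Longrightarrow> e \<subseteq> V"
  obtains T where "is_tree T" "verts T \<subseteq> set (nodes s)" "\<And>e. e \<in> edges T \<Longrightarrow> e \<subseteq> verts T"
    "\<And>v. v \<in> verts T \<Longrightarrow> vdegree T v \<noteq> 2"
    "attach T (top_node s) \<lparr>verts = set (nodes s), edges = inner_edges s\<rparr>"
    "suppress_step\<^sup>*\<^sup>* \<lparr>verts = V \<union> set (nodes s), edges = E \<union> inner_edges s\<rparr>
       \<lparr>verts = V \<union> verts T, edges = E \<union> edges T\<rparr>"
proof (cases s)
  case (ITip y)
  show ?thesis
    by (rule that[of "\<lparr>verts = {y}, edges = {}\<rparr>"])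
      (auto simp: ITip is_tree_single vdegree_def attach_def)
next
  case (IFork y l r)
  define a b where "a = top_node l" and "b = top_node r"
  have ab: "a \<in> set (nodes l)" "b \<in> set (nodes r)" by (auto simp: a_def b_def)
  have lr: "set (nodes l) \<inter> set (nodes r) = {}" "y \<notin> set (nodes l)" "y \<notin> set (nodes r)"
    "distinct (nodes l)" "distinct (nodes r)"
    using d IFork by auto
  have neq: "a \<noteq> b" using ab lr by auto
  let ?L = "\<lparr>verts = set (nodes l), edges = inner_edges l\<rparr>"
  define T where "T = \<lparr>verts = set (nodes l) \<union> set (nodes r),
    edges = inner_edges l \<union> planted_edges a r\<rparr>"
  have T_edges: "edges T = insert {a, b} (inner_edges l \<union> inner_edges r)"
    unfolding T_def by (simp add: planted_edges_inner b_def)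
  have inner: "e \<in> inner_edges l \<Longrightarrow> e \<subseteq> set (nodes l)" "e \<in> inner_edges r \<Longrightarrow> e \<subseteq> set (nodes r)" for e
    by (auto dest: inner_edges_subset)
  have ab_new: "{a, b} \<notin> inner_edges l" "{a, b} \<notin> inner_edges r"
    using inner ab lr by blast+
  have s_edges: "inner_edges s = {{y, a}, {y, b}} \<union> inner_edges l \<union> inner_edges r"
    by (simp add: IFork planted_edges_inner a_def b_def insert_commute)
  have y_not: "e \<in> inner_edges l \<Longrightarrow> y \<notin> e" "e \<in> inner_edges r \<Longrightarrow> y \<notin> e" for e
    using inner lr by blast+
  have nodes_s: "set (nodes s) = insert y (set (nodes l) \<union> set (nodes r))" by (simp add: IFork)
  show ?thesis
  proof (rule that[of T])
    show "is_tree T"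
      using is_tree_graft[OF is_tree_inner[OF lr(4)], of a r] ab lr unfolding T_def by auto
    show "verts T \<subseteq> set (nodes s)" by (auto simp: T_def IFork)
    show "e \<subseteq> verts T" if "e \<in> edges T" for e
      using that ab inner unfolding T_edges by (auto simp: T_def)
    show "vdegree T v \<noteq> 2" if v: "v \<in> verts T" for v
    proof -
      have i: "incident (edges T) v = incident (inner_edges l) v \<union> incident (planted_edges a r) v"
        by (simp add: T_def incident_Un)
      have da: "distinct (a # nodes r)" using ab lr by auto
      consider "v \<in> set (nodes r)" | "v = a" | "v \<in> set (nodes l)" "v \<noteq> a"
        using v by (auto simp: T_def)
      then show ?thesis
      proof cases
        case 1
        then have "incident (inner_edges l) v = {}" using inner lr by (auto simp: incident_def)
        then show ?thesis using card_incident_planted[OF da 1] i by (simp add: vdegree_incident)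
      next
        case 2
        have "incident (planted_edges a r) v = {{a, b}}"
          using incident_planted_base[of a r] da 2 by (simp add: b_def)
        moreover have "finite (incident (inner_edges l) v)"
          by (cases l) (auto simp: incident_def)
        moreover have "{a, b} \<notin> incident (inner_edges l) v" using ab_new by (simp add: incident_def)
        ultimately have "vdegree T v = Suc (card (incident (inner_edges l) v))"
          using i by (simp add: vdegree_incident)
        then show ?thesis using card_incident_inner_top[OF lr(4)] 2 by (auto simp: a_def)
      next
        case 3
        then have "incident (planted_edges a r) v = {}"
          using lr by (intro incident_planted_outside) auto
        then show ?thesis using i card_incident_inner[OF lr(4) 3(1)] 3(2)
          by (auto simp: vdegree_incident a_def)
      qed
    qed
    show "attach T (top_node s) \<lparr>verts = set (nodes s), edges = inner_edges s\<rparr>"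
      unfolding attach_def
    proof (intro disjI2 exI conjI)
      show "{a, b} \<in> edges T" by (simp add: T_edges)
      show "top_node s \<notin> verts T" using lr by (simp add: T_def IFork)
      have "inner_edges s = edges T - {{a, b}} \<union> {{a, y}, {y, b}}"
        unfolding T_edges s_edges using ab_new by (auto simp: insert_commute)
      then show "\<lparr>verts = set (nodes s), edges = inner_edges s\<rparr> =
        \<lparr>verts = insert (top_node s) (verts T),
         edges = edges T - {{a, b}} \<union> {{a, top_node s}, {top_node s, b}}\<rparr>"
        by (simp add: nodes_s T_def IFork)
    qed
    have "suppress_step \<lparr>verts = V \<union> set (nodes s), edges = E \<union> inner_edges s\<rparr>
       \<lparr>verts = V \<union> verts T, edges = E \<union> edges T\<rparr>"
      unfolding suppress_step_def
    proof (intro exI conjI)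
      have yV: "y \<notin> V" using V nodes_s by auto
      have yE: "y \<notin> e" if "e \<in> E" for e using E[OF that] yV by auto
      show "y \<in> verts \<lparr>verts = V \<union> set (nodes s), edges = E \<union> inner_edges s\<rparr>" by (simp add: nodes_s)
      show "a \<noteq> b" by (rule neq)
      have "{e \<in> E \<union> inner_edges s. y \<in> e} = {{a, y}, {y, b}}"
        unfolding s_edges using y_not yE by (auto simp: insert_commute)
      then show "{e \<in> edges \<lparr>verts = V \<union> set (nodes s), edges = E \<union> inner_edges s\<rparr>. y \<in> e} = {{a, y}, {y, b}}"
        by simp
      have "E \<union> inner_edges s - {{a, y}, {y, b}} = E \<union> (inner_edges l \<union> inner_edges r)"
        unfolding s_edges using y_not yE by (auto simp: insert_commute)
      then have "E \<union> edges T = (E \<union> inner_edges s - {{a, y}, {y, b}}) \<union> {{a, b}}"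
        by (auto simp: T_edges)
      moreover have "V \<union> verts T = V \<union> set (nodes s) - {y}" using yV lr nodes_s by (auto simp: T_def)
      ultimately show "\<lparr>verts = V \<union> verts T, edges = E \<union> edges T\<rparr> =
        \<lparr>verts = verts \<lparr>verts = V \<union> set (nodes s), edges = E \<union> inner_edges s\<rparr> - {y},
         edges = edges \<lparr>verts = V \<union> set (nodes s), edges = E \<union> inner_edges s\<rparr> - {{a, y}, {y, b}} \<union> {{a, b}}\<rparr>"
        by simp
    qed
    then show "suppress_step\<^sup>*\<^sup>* \<lparr>verts = V \<union> set (nodes s), edges = E \<union> inner_edges s\<rparr>
       \<lparr>verts = V \<union> verts T, edges = E \<union> edges T\<rparr>" by blast
  qed
qed

lemma regraft_spr:
  assumes d: "distinct (0 # x # nodes s @ nodes t)"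
    and g1: "igraft x s t t1" and g2: "igraft x s' t t2"
    and s': "planted_edges x s' = planted_edges x s" "set (nodes s') = set (nodes s)" "distinct (nodes s')"
    and ab: "a \<noteq> b" "{a, b} \<in> planted_edges 0 t"
      "planted_edges 0 t1 = planted_edges 0 t - {{a, b}} \<union> {{a, x}, {x, b}} \<union> planted_edges x s"
    and cd: "c \<noteq> d" "{c, d} \<in> planted_edges 0 t"
      "planted_edges 0 t2 = planted_edges 0 t - {{c, d}} \<union> {{c, x}, {x, d}} \<union> planted_edges x s"
    and neq: "{a, b} \<noteq> {c, d}"
  shows "spr_graph x (top_node s) a b c d (planted 0 t1) (planted 0 t2)"
    and "on_path (planted 0 t1) 0 (top_node s) x"
proof -
  let ?E = "planted_edges 0 t" and ?F = "planted_edges x s" and ?y = "top_node s"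
  have n1: "set (nodes t1) = insert x (set (nodes s) \<union> set (nodes t))" and d1: "distinct (nodes t1)"
    using igraft_nodes[OF g1] d by auto
  have n2: "set (nodes t2) = insert x (set (nodes s) \<union> set (nodes t))"
    using igraft_nodes(1)[OF g2] s' by auto
  have y: "?y \<in> set (nodes s)" by simp
  have abt: "a \<in> insert 0 (set (nodes t))" "b \<in> insert 0 (set (nodes t))"
    using planted_edges_subset[OF ab(2)] by auto
  have cdt: "c \<in> insert 0 (set (nodes t))" "d \<in> insert 0 (set (nodes t))"
    using planted_edges_subset[OF cd(2)] by auto
  have disj: "x \<notin> insert 0 (set (nodes t))" "x \<notin> set (nodes s)"
    "insert 0 (set (nodes t)) \<inter> set (nodes s) = {}" using d by auto
  have out: "a \<notin> insert x (set (nodes s))" "b \<notin> insert x (set (nodes s))"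
    "c \<notin> insert x (set (nodes s))" "d \<notin> insert x (set (nodes s))"
    using abt cdt disj by blast+
  have E: "e \<subseteq> insert 0 (set (nodes t))" if "e \<in> ?E" for e using planted_edges_subset that by blast
  have F: "e \<subseteq> insert x (set (nodes s))" if "e \<in> ?F" for e using planted_edges_subset that by blast
  have xE: "{v, x} \<notin> ?E" "{x, v} \<notin> ?E" for v using E disj by blast+
  have vF: "{v, w} \<notin> ?F" "{w, v} \<notin> ?F" if "v \<notin> insert x (set (nodes s))" for v w using F that by blast+
  have tree: "is_tree (planted 0 t1)" using is_tree_planted[of 0 t1] d d1 n1 by auto
  have cross: "w = x" if "{w, z} \<in> planted_edges 0 t1" "w \<notin> set (nodes s)" "z \<in> set (nodes s)" for w z
  proof -
    have "{w, z} \<notin> ?E" using E disj that(3) by blast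
    moreover have "{w, z} \<noteq> {a, x}" "{w, z} \<noteq> {x, b}" using that(3) out disj
      by (auto simp: doubleton_eq_iff)
    ultimately have "{w, z} \<in> ?F" using that(1) ab(3) by auto
    then show ?thesis using F that(2) by blast
  qed
  have path: "on_path (planted 0 t1) u ?y x" if "u \<in> insert 0 (set (nodes t))" for u
  proof (rule on_path_crossing[OF tree, where S = "set (nodes s)"])
    show "u \<in> verts (planted 0 t1)" using that n1 by (auto simp: planted_def)
    show "?y \<in> verts (planted 0 t1)" using y n1 by (auto simp: planted_def)
    show "u \<notin> set (nodes s)" using that disj by blast
  qed (use y cross in \<open>auto simp: planted_def\<close>)
  then show "on_path (planted 0 t1) 0 ?y x" by simp
  have "{x, ?y} \<in> planted_edges 0 t1" "{c, d} \<in> planted_edges 0 t1"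
    unfolding ab(3) using cd(2) neq by auto
  moreover have "distinct [{x, ?y}, {a, x}, {x, b}, {c, d}]"
    using y out ab(1) cdt disj by (auto simp: doubleton_eq_iff)
  moreover have "planted 0 t2 = \<lparr>verts = verts (planted 0 t1), edges =
    (((edges (planted 0 t1) - {{a, x}, {x, b}}) \<union> {{a, b}}) - {{c, d}}) \<union> {{c, x}, {x, d}}\<rparr>"
  proof -
    have "planted_edges 0 t1 - {{a, x}, {x, b}} = (?E - {{a, b}}) \<union> ?F"
      unfolding ab(3) using xE vF out by auto
    then have "(planted_edges 0 t1 - {{a, x}, {x, b}}) \<union> {{a, b}} = ?E \<union> ?F" using ab(2) by auto
    moreover have "{c, d} \<notin> ?F" using vF out by blast
    ultimately have "planted_edges 0 t2 =
      (((planted_edges 0 t1 - {{a, x}, {x, b}}) \<union> {{a, b}}) - {{c, d}}) \<union> {{c, x}, {x, d}}"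
      unfolding cd(3) by auto
    then show ?thesis by (simp add: planted_def n1 n2)
  qed
  ultimately show "spr_graph x ?y a b c d (planted 0 t1) (planted 0 t2)"
    unfolding spr_graph_def using path[OF cdt(1)] ab(3) by (auto simp: planted_def)
qed

lemma tbr_graphI:
  assumes "e \<in> edges G"
    "suppress_all (delete_edge e G) \<lparr>verts = verts T1 \<union> verts T2, edges = edges T1 \<union> edges T2\<rparr>"
    "is_tree T1" "is_tree T2" "verts T1 \<inter> verts T2 = {}"
    "attach T1 p H1" "attach T2 q H2" "verts H1 \<inter> verts H2 = {}"
    "G' = \<lparr>verts = verts H1 \<union> verts H2, edges = edges H1 \<union> edges H2 \<union> {{p, q}}\<rparr>"
  shows "tbr_graph G G'"
  unfolding tbr_graph_def by (intro exI conjI) (rule assms refl)+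

lemma regraft_tbr:
  assumes d: "distinct (0 # x # nodes s @ nodes t)"
    and g1: "igraft x s t t1" and g2: "igraft x s' t t2"
    and s': "planted_edges x s' = planted_edges x s" "set (nodes s') = set (nodes s)"
    and ab: "a \<noteq> b" "{a, b} \<in> planted_edges 0 t"
      "planted_edges 0 t1 = planted_edges 0 t - {{a, b}} \<union> {{a, x}, {x, b}} \<union> planted_edges x s"
    and cd: "{c, d} \<in> planted_edges 0 t"
      "planted_edges 0 t2 = planted_edges 0 t - {{c, d}} \<union> {{c, x}, {x, d}} \<union> planted_edges x s"
  shows "tbr_graph (planted 0 t1) (planted 0 t2)"
proof -
  let ?E = "planted_edges 0 t" and ?F = "planted_edges x s" and ?y = "top_node s"
    and ?V = "insert 0 (set (nodes t))" and ?I = "inner_edges s"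
  have n1: "set (nodes t1) = insert x (set (nodes s) \<union> set (nodes t))"
    using igraft_nodes[OF g1] by auto
  have n2: "set (nodes t2) = insert x (set (nodes s) \<union> set (nodes t))"
    using igraft_nodes(1)[OF g2] s' by auto
  have abt: "a \<in> ?V" "b \<in> ?V" using planted_edges_subset[OF ab(2)] by auto
  have disj: "x \<notin> ?V" "x \<notin> set (nodes s)" "?V \<inter> set (nodes s) = {}" using d by auto
  have y: "?y \<in> set (nodes s)" "?y \<noteq> x" using disj by (auto simp del: insert_iff)
  have E: "e \<subseteq> ?V" if "e \<in> ?E" for e using planted_edges_subset that by blast
  have I: "e \<subseteq> set (nodes s)" if "e \<in> ?I" for e using inner_edges_subset that by blast
  have F: "?F = insert {x, ?y} ?I" by (rule planted_edges_inner)
  have xE: "x \<notin> e" if "e \<in> ?E" for e using E[OF that] disj by blast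
  have xI: "x \<notin> e" if "e \<in> ?I" for e using I[OF that] disj by blast
  obtain T where T: "is_tree T" "verts T \<subseteq> set (nodes s)" "\<And>e. e \<in> edges T \<Longrightarrow> e \<subseteq> verts T"
    "\<And>v. v \<in> verts T \<Longrightarrow> vdegree T v \<noteq> 2"
    "attach T ?y \<lparr>verts = set (nodes s), edges = ?I\<rparr>"
    "suppress_step\<^sup>*\<^sup>* \<lparr>verts = ?V \<union> set (nodes s), edges = ?E \<union> ?I\<rparr>
       \<lparr>verts = ?V \<union> verts T, edges = ?E \<union> edges T\<rparr>"
    using suppress_top_node[of s ?V ?E] d disj(3) E by auto
  let ?H = "\<lparr>verts = ?V \<union> verts T, edges = ?E \<union> edges T\<rparr>"
  have dt: "distinct (0 # nodes t)" using d by auto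
  have e: "{x, ?y} \<in> edges (planted 0 t1)" by (simp add: planted_def ab(3) F)
  have "suppress_all (delete_edge {x, ?y} (planted 0 t1)) ?H"
    unfolding suppress_all_def
  proof
    let ?D = "delete_edge {x, ?y} (planted 0 t1)"
    have De: "edges ?D = ?E - {{a, b}} \<union> {{a, x}, {x, b}} \<union> ?I"
    proof -
      have "{x, ?y} \<notin> ?E" "{x, ?y} \<notin> ?I" using xE xI by blast+
      moreover have "{a, x} \<noteq> {x, ?y}" "{x, b} \<noteq> {x, ?y}"
      proof -
        have "a \<noteq> ?y" "b \<noteq> ?y" using abt y(1) disj(3) by blast+
        then show "{a, x} \<noteq> {x, ?y}" "{x, b} \<noteq> {x, ?y}" using y(2) by (auto simp: doubleton_eq_iff)
      qed
      ultimately show ?thesis by (auto simp: delete_edge_def planted_def ab(3) F)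
    qed
    have Dv: "verts ?D = insert x (?V \<union> set (nodes s))"
      by (auto simp: delete_edge_def planted_def n1)
    have "suppress_step ?D \<lparr>verts = ?V \<union> set (nodes s), edges = ?E \<union> ?I\<rparr>"
      unfolding suppress_step_def
    proof (intro exI conjI)
      show "x \<in> verts ?D" by (simp add: Dv)
      show "a \<noteq> b" by (rule ab(1))
      show "{e \<in> edges ?D. x \<in> e} = {{a, x}, {x, b}}" unfolding De using xE xI by auto
      have "verts ?D - {x} = ?V \<union> set (nodes s)" using disj Dv by auto
      moreover have "edges ?D - {{a, x}, {x, b}} \<union> {{a, b}} = ?E \<union> ?I"
      proof -
        have "{a, x} \<notin> ?E \<union> ?I" "{x, b} \<notin> ?E \<union> ?I" using xE xI by blast+
        then have "edges ?D - {{a, x}, {x, b}} = (?E - {{a, b}}) \<union> ?I" unfolding De by auto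
        then show ?thesis using ab(2) by auto
      qed
      ultimately show "\<lparr>verts = ?V \<union> set (nodes s), edges = ?E \<union> ?I\<rparr> =
        \<lparr>verts = verts ?D - {x}, edges = edges ?D - {{a, x}, {x, b}} \<union> {{a, b}}\<rparr>" by simp
    qed
    then show "suppress_step\<^sup>*\<^sup>* ?D ?H" using T(6) by (rule converse_rtranclp_into_rtranclp)
    show "\<forall>v\<in>verts ?H. vdegree ?H v \<noteq> 2"
    proof
      fix v assume "v \<in> verts ?H"
      then consider "v \<in> ?V" "v \<notin> verts T" | "v \<in> verts T" "v \<notin> ?V"
        using disj(3) T(2) unfolding ugraph.simps by blast
      then show "vdegree ?H v \<noteq> 2"
      proof cases
        case 1
        then have "incident (edges T) v = {}" using T(3) by (auto simp: incident_def)
        then have "vdegree ?H v = vdegree (planted 0 t) v"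
          by (simp add: vdegree_incident incident_Un planted_def)
        then show ?thesis using vdegree_planted[OF dt, of v] 1 by (auto simp: planted_def)
      next
        case 2
        then have "incident ?E v = {}" using E by (auto simp: incident_def)
        then have "vdegree ?H v = vdegree T v" by (simp add: vdegree_incident incident_Un)
        then show ?thesis using T(4) 2 by simp
      qed
    qed
  qed
  then have sup: "suppress_all (delete_edge {x, ?y} (planted 0 t1))
    \<lparr>verts = verts (planted 0 t) \<union> verts T, edges = edges (planted 0 t) \<union> edges T\<rparr>"
    by (simp add: planted_def)
  have dj: "verts (planted 0 t) \<inter> verts T = {}" using T(2) disj(3) by (auto simp: planted_def)
  have at: "attach (planted 0 t) x \<lparr>verts = insert x ?V, edges = ?E - {{c, d}} \<union> {{c, x}, {x, d}}\<rparr>"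
    using cd(1) disj(1) unfolding attach_def by (auto simp: planted_def)
  show ?thesis
  proof (rule tbr_graphI[OF e sup is_tree_planted[OF dt] T(1) dj at T(5)])
    show "planted 0 t2 =
      \<lparr>verts = verts \<lparr>verts = insert x ?V, edges = ?E - {{c, d}} \<union> {{c, x}, {x, d}}\<rparr> \<union>
         verts \<lparr>verts = set (nodes s), edges = ?I\<rparr>,
       edges = edges \<lparr>verts = insert x ?V, edges = ?E - {{c, d}} \<union> {{c, x}, {x, d}}\<rparr> \<union>
         edges \<lparr>verts = set (nodes s), edges = ?I\<rparr> \<union> {{x, ?y}}\<rparr>"
      by (auto simp: planted_def n2 cd(2) F)
  qed (use disj in auto)
qed

lemma regraft_move:
  assumes d: "distinct (0 # x # nodes s @ nodes t)"
    and g: "igraft x s t t1" "igraft x s' t t2"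
    and s': "planted_edges x s' = planted_edges x s" "set (nodes s') = set (nodes s)" "distinct (nodes s')"
    and n: "n \<ge> 2"
  shows "ltree_of t1 = ltree_of t2 \<or> move \<chi> {0..n} (ltree_of t1) (ltree_of t2)"
proof -
  have d': "distinct (0 # x # nodes s' @ nodes t)" using d s' by auto
  obtain a b where ab: "a \<noteq> b" "{a, b} \<in> planted_edges 0 t"
      "planted_edges 0 t1 = planted_edges 0 t - {{a, b}} \<union> {{a, x}, {x, b}} \<union> planted_edges x s"
    using igraft_edges[OF g(1) d] by blast
  obtain c d where cd: "c \<noteq> d" "{c, d} \<in> planted_edges 0 t"
      "planted_edges 0 t2 = planted_edges 0 t - {{c, d}} \<union> {{c, x}, {x, d}} \<union> planted_edges x s"
    using igraft_edges[OF g(2) d'] unfolding s' by blast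
  show ?thesis
  proof (cases "{a, b} = {c, d}")
    case True
    then have "{{a, x}, {x, b}} = {{c, x}, {x, d}}" by (auto simp: doubleton_eq_iff)
    then have "planted_edges 0 t1 = planted_edges 0 t2" using True ab(3) cd(3) by simp
    moreover have "set (nodes t1) = set (nodes t2)"
      using igraft_nodes(1)[OF g(1)] igraft_nodes(1)[OF g(2)] s' by simp
    ultimately show ?thesis by (simp add: ltree_of_def planted_def)
  next
    case False
    note spr = regraft_spr[OF assms(1) g s' ab cd False]
    have "tbr_graph (planted 0 t1) (planted 0 t2)"
      by (rule regraft_tbr[OF assms(1) g s'(1,2) ab cd(2,3)])
    then have "move TBR {0..n} (ltree_of t1) (ltree_of t2)" using n by (simp add: ltree_of_def)
    moreover have "move rSPR {0..n} (ltree_of t1) (ltree_of t2)"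
      using spr by (simp add: ltree_of_def) blast
    moreover have "move SPR {0..n} (ltree_of t1) (ltree_of t2)"
      using spr(1) by (simp add: ltree_of_def) blast
    ultimately show ?thesis by (cases \<chi>) auto
  qed
qed

lemma itree_exists:
  assumes "distinct (tips b)" "finite F"
  shows "\<exists>t. erase t = b \<and> distinct (nodes t) \<and> (set (nodes t) - set (tips b)) \<inter> F = {}"
  using assms
proof (induction b arbitrary: F)
  case (Tip v)
  then show ?case by (intro exI[of _ "ITip v"]) auto
next
  case (Fork l r)
  let ?T = "set (tips (Fork l r))"
  obtain l' where l': "erase l' = l" "distinct (nodes l')" "(set (nodes l') - set (tips l)) \<inter> (F \<union> ?T) = {}"
    using Fork.IH(1)[of "F \<union> ?T"] Fork.prems by auto
  obtain r' where r': "erase r' = r" "distinct (nodes r')"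
    "(set (nodes r') - set (tips r)) \<inter> (F \<union> ?T \<union> set (nodes l')) = {}"
    using Fork.IH(2)[of "F \<union> ?T \<union> set (nodes l')"] Fork.prems by auto
  obtain x where x: "x \<notin> F \<union> ?T \<union> set (nodes l') \<union> set (nodes r')"
    using ex_new_if_finite[OF infinite_UNIV_nat, of "F \<union> ?T \<union> set (nodes l') \<union> set (nodes r')"]
      Fork.prems by auto
  have "set (tips l) \<inter> set (tips r) = {}" using Fork.prems by simp
  then have "set (nodes l') \<inter> set (nodes r') = {}" using l'(3) r'(3) by auto
  then show ?case using l' r' x by (intro exI[of _ "IFork x l' r'"]) auto
qed

definition btree_on :: "nat \<Rightarrow> btree \<Rightarrow> bool" where
  "btree_on n b \<longleftrightarrow> distinct (tips b) \<and> set (tips b) = {1..n}"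

definition tree_class :: "nat \<Rightarrow> btree \<Rightarrow> ltree set" where
  "tree_class n b = {S. \<exists>t. itree_on n t \<and> erase t = b \<and> (ltree_of t, S) \<in> ltree_iso {0..n}}"

lemma itree_on_erase: "itree_on n t \<Longrightarrow> btree_on n (erase t)"
  by (simp add: itree_on_def btree_on_def distinct_tips_erase)

lemma btree_on_itree:
  assumes "btree_on n b"
  obtains t where "itree_on n t" "erase t = b"
proof -
  obtain t where t: "erase t = b" "distinct (nodes t)" "(set (nodes t) - set (tips b)) \<inter> {0} = {}"
    using itree_exists[of b "{0}"] assms by (auto simp: btree_on_def)
  then have "itree_on n t" using assms by (auto simp: itree_on_def btree_on_def)
  then show ?thesis using that t by blast
qed

lemma tree_class_erase:
  assumes "itree_on n t"
  shows "tree_class n (erase t) = ltree_iso {0..n} `` {ltree_of t}"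
proof -
  have "(ltree_of t, S) \<in> ltree_iso {0..n}"
    if "itree_on n t'" "erase t' = erase t" "(ltree_of t', S) \<in> ltree_iso {0..n}" for t' S
    using erase_eq_iso[OF assms that(1)] that(2,3) equiv_ltree_iso[of "{0..n}"]
    by (metis equivE transD)
  then show ?thesis using assms by (auto simp: tree_class_def)
qed

lemma ltree_of_in_tree_class: "itree_on n t \<Longrightarrow> ltree_of t \<in> tree_class n (erase t)"
  using tree_class_erase[of n t] equiv_class_self[OF equiv_ltree_iso] binary_ltree_of by simp

lemma BTrees_tree_class:
  assumes "n \<ge> 1"
  shows "BTrees {0..n} = tree_class n ` {b. btree_on n b}"
proof (intro equalityI subsetI)
  fix A assume "A \<in> BTrees {0..n}"
  then obtain S where S: "binary_ltree {0..n} S" "A = ltree_iso {0..n} `` {S}"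
    by (auto simp: BTrees_def quotient_def)
  then obtain t where t: "itree_on n t" "(S, ltree_of t) \<in> ltree_iso {0..n}"
    using binary_ltree_iso_ltree_of assms by blast
  then have "A = tree_class n (erase t)"
    using tree_class_erase S(2) equiv_class_eq[OF equiv_ltree_iso t(2)] by simp
  then show "A \<in> tree_class n ` {b. btree_on n b}" using itree_on_erase[OF t(1)] by blast
next
  fix A assume "A \<in> tree_class n ` {b. btree_on n b}"
  then obtain b where b: "btree_on n b" "A = tree_class n b" by blast
  then obtain t where t: "itree_on n t" "erase t = b" using btree_on_itree by blast
  then have "A = ltree_iso {0..n} `` {ltree_of t}" using tree_class_erase b by blast
  then show "A \<in> BTrees {0..n}"
    using binary_ltree_of[OF t(1)] by (auto simp: BTrees_def quotient_def)
qed

lemma tree_class_swap: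
  assumes "btree_on n (Fork l r)"
  shows "tree_class n (Fork l r) = tree_class n (Fork r l)"
proof -
  obtain t where t: "itree_on n t" "erase t = Fork l r" using assms btree_on_itree by blast
  then obtain x l' r' where t': "t = IFork x l' r'" "erase l' = l" "erase r' = r" by (cases t) auto
  let ?u = "IFork x r' l'"
  have "itree_on n ?u" "erase ?u = Fork r l" using t t' by (auto simp: itree_on_def)
  moreover have "ltree_of t = ltree_of ?u"
    by (simp add: t' ltree_of_def planted_def Un_commute)
  ultimately show ?thesis using tree_class_erase t by metis
qed

definition top_swap :: "btree \<Rightarrow> btree \<Rightarrow> bool" where
  "top_swap s s' \<longleftrightarrow> s' = s \<or> (\<exists>l r. s = Fork l r \<and> s' = Fork r l)"

lemma regraft_class_moves:
  assumes "graft s t b1" "graft s' t b2" "top_swap s s'" "btree_on n b1" "n \<ge> 2"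
  shows "tree_class n b1 = tree_class n b2 \<or>
    (tree_class n b1, tree_class n b2) \<in> class_moves \<chi> {0..n}"
proof -
  have tp: "set (tips s) \<union> set (tips t) = {1..n}" "distinct (tips s @ tips t)"
    using graft_tips[OF assms(1)] assms(4) by (auto simp: btree_on_def)
  obtain s1 where s1: "erase s1 = s" "distinct (nodes s1)" "(set (nodes s1) - set (tips s)) \<inter> {0..n} = {}"
    using itree_exists[of s "{0..n}"] tp by auto
  obtain t0 where t0: "erase t0 = t" "distinct (nodes t0)"
    "(set (nodes t0) - set (tips t)) \<inter> ({0..n} \<union> set (nodes s1)) = {}"
    using itree_exists[of t "{0..n} \<union> set (nodes s1)"] tp by auto
  obtain x where x: "x \<notin> {0..n} \<union> set (nodes s1) \<union> set (nodes t0)"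
    using ex_new_if_finite[OF infinite_UNIV_nat, of "{0..n} \<union> set (nodes s1) \<union> set (nodes t0)"] by auto
  have "set (tips s) \<inter> set (tips t) = {}" using tp(2) by auto
  moreover have "set (tips t) \<subseteq> {0..n}" using tp(1) by auto
  ultimately have "set (nodes s1) \<inter> set (nodes t0) = {}" using s1(3) t0(3) by blast
  moreover have "0 \<notin> set (nodes s1)" "0 \<notin> set (nodes t0)"
    using s1(3) t0(3) tp(1) by (metis Diff_iff Int_iff UnCI atLeastAtMost_iff empty_iff le0 not_one_le_zero)+
  ultimately have d: "distinct (0 # x # nodes s1 @ nodes t0)" using s1 t0 x by auto
  obtain s2 where s2: "erase s2 = s'" "planted_edges x s2 = planted_edges x s1"
    "set (nodes s2) = set (nodes s1)" "distinct (nodes s2)"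
  proof (cases "s' = s")
    case True
    then show ?thesis using that s1 by blast
  next
    case False
    then obtain l r where lr: "s = Fork l r" "s' = Fork r l" using assms(3) by (auto simp: top_swap_def)
    then obtain y il ir where "s1 = IFork y il ir" "erase il = l" "erase ir = r"
      using s1(1) by (cases s1) auto
    then show ?thesis using that[of "IFork y ir il"] lr s1(2) by (auto simp: Un_commute)
  qed
  obtain i1 where i1: "igraft x s1 t0 i1" "erase i1 = b1"
    using graft_imp_igraft[of s1 t b1 t0 x] assms(1) s1(1) t0(1) by blast
  obtain i2 where i2: "igraft x s2 t0 i2" "erase i2 = b2"
    using graft_imp_igraft[of s2 t b2 t0 x] assms(2) s2(1) t0(1) by blast
  have b2: "btree_on n b2"
    using graft_tips[OF assms(2)] graft_tips[OF assms(1)] assms(3,4)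
    by (auto simp: btree_on_def top_swap_def)
  have on1: "itree_on n i1"
    using igraft_nodes[OF i1(1)] d assms(4) i1(2) by (auto simp: itree_on_def btree_on_def)
  have "distinct (x # nodes s2 @ nodes t0)" using d s2 by auto
  then have on2: "itree_on n i2"
    using igraft_nodes[OF i2(1)] d b2 i2(2) s2 by (auto simp: itree_on_def btree_on_def)
  have mem: "ltree_of i1 \<in> tree_class n b1" "ltree_of i2 \<in> tree_class n b2"
    using ltree_of_in_tree_class on1 on2 i1(2) i2(2) by blast+
  have "tree_class n b1 \<in> BTrees {0..n}" "tree_class n b2 \<in> BTrees {0..n}"
    using BTrees_tree_class[of n] assms(4,5) b2 by auto
  moreover have "tree_class n b1 = tree_class n b2" if "ltree_of i1 = ltree_of i2"
    using tree_class_erase[OF on1] tree_class_erase[OF on2] i1(2) i2(2) that by metis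
  ultimately show ?thesis
    using regraft_move[OF d i1(1) i2(1) s2(2-4) assms(5), of \<chi>] mem
    by (auto simp: class_moves_def)
qed

section \<open>Clusters and restrictions\<close>

fun clusters :: "btree \<Rightarrow> nat set set" where
  "clusters (Tip v) = {{v}}"
| "clusters (Fork l r) = insert (set (tips l) \<union> set (tips r)) (clusters l \<union> clusters r)"

fun join :: "btree option \<Rightarrow> btree option \<Rightarrow> btree option" where
  "join None y = y"
| "join (Some a) None = Some a"
| "join (Some a) (Some b) = Some (Fork a b)"

fun restrict :: "nat set \<Rightarrow> btree \<Rightarrow> btree option" where
  "restrict Y (Tip v) = (if v \<in> Y then Some (Tip v) else None)"
| "restrict Y (Fork l r) = join (restrict Y l) (restrict Y r)"

lemma tips_cluster [simp]: "set (tips t) \<in> clusters t"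
  by (cases t) auto

lemma cluster_subset_tips: "C \<in> clusters t \<Longrightarrow> C \<subseteq> set (tips t)"
  by (induction t) auto

lemma clusters_laminar:
  assumes "distinct (tips t)" "C \<in> clusters t" "D \<in> clusters t" "C \<inter> D \<noteq> {}"
  shows "C \<subseteq> D \<or> D \<subseteq> C"
  using assms
proof (induction t)
  case (Fork l r)
  have sub: "E \<in> clusters l \<Longrightarrow> E \<subseteq> set (tips l)" "E \<in> clusters r \<Longrightarrow> E \<subseteq> set (tips r)" for E
    by (auto dest: cluster_subset_tips)
  have disj: "set (tips l) \<inter> set (tips r) = {}" using Fork.prems by simp
  consider "C = set (tips (Fork l r))" | "D = set (tips (Fork l r))"
    | "C \<in> clusters l" "D \<in> clusters l" | "C \<in> clusters r" "D \<in> clusters r"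
    | "C \<in> clusters l" "D \<in> clusters r" | "C \<in> clusters r" "D \<in> clusters l"
    using Fork.prems by auto
  then show ?case
  proof cases
    case 1
    then show ?thesis using Fork.prems(3) cluster_subset_tips by blast
  next
    case 2
    then show ?thesis using Fork.prems(2) cluster_subset_tips by blast
  next
    case 5
    then show ?thesis using sub disj Fork.prems(4) by blast
  next
    case 6
    then show ?thesis using sub disj Fork.prems(4) by blast
  qed (use Fork in auto)
qed auto

lemma join_None [simp]: "join x y = None \<longleftrightarrow> x = None \<and> y = None" "join x None = x"
  by (cases x; cases y; simp)+

lemma restrict_None: "restrict Y t = None \<longleftrightarrow> Y \<inter> set (tips t) = {}"
  by (induction t) auto

lemma restrict_cong: "Y \<inter> set (tips t) = Z \<inter> set (tips t) \<Longrightarrow> restrict Y t = restrict Z t"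
proof (induction t)
  case (Fork l r)
  have "Y \<inter> set (tips l) = Z \<inter> set (tips l)" "Y \<inter> set (tips r) = Z \<inter> set (tips r)"
    using Fork.prems by auto
  then show ?case using Fork.IH by simp
qed auto

lemma restrict_all: "set (tips t) \<subseteq> Y \<Longrightarrow> restrict Y t = Some t"
  by (induction t) auto

lemma restrict_single:
  assumes "distinct (tips t)" "Y \<inter> set (tips t) = {a}"
  shows "restrict Y t = Some (Tip a)"
  using assms
proof (induction t)
  case (Tip v)
  then have "a \<in> Y \<inter> {v}" by simp
  then show ?case by auto
next
  case (Fork l r)
  from Fork.prems have "a \<in> set (tips l) \<or> a \<in> set (tips r)" by auto
  then show ?case
  proof
    assume "a \<in> set (tips l)"
    then have "Y \<inter> set (tips l) = {a}" "Y \<inter> set (tips r) = {}" using Fork.prems by auto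
    then show ?thesis using Fork by (simp add: restrict_None[symmetric])
  next
    assume "a \<in> set (tips r)"
    then have "Y \<inter> set (tips r) = {a}" "Y \<inter> set (tips l) = {}" using Fork.prems by auto
    then show ?thesis using Fork by (simp add: restrict_None[symmetric])
  qed
qed

lemma restrict_pair:
  assumes "distinct (tips t)" "Y \<inter> set (tips t) = {a, b}" "a \<noteq> b"
  shows "restrict Y t \<in> {Some (Fork (Tip a) (Tip b)), Some (Fork (Tip b) (Tip a))}"
  using assms
proof (induction t)
  case (Tip v)
  then have "{a, b} \<subseteq> {v}" by auto
  then show ?case using Tip.prems(3) by auto
next
  case (Fork l r)
  have disj: "set (tips l) \<inter> set (tips r) = {}" using Fork.prems by simp
  consider "{a, b} \<subseteq> set (tips l)" | "{a, b} \<subseteq> set (tips r)"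
    | "a \<in> set (tips l)" "b \<in> set (tips r)" | "b \<in> set (tips l)" "a \<in> set (tips r)"
    using Fork.prems(2) by auto
  then show ?case
  proof cases
    case 1
    then have "Y \<inter> set (tips l) = {a, b}" "Y \<inter> set (tips r) = {}" using Fork.prems(2) disj by auto
    then show ?thesis using Fork by (auto simp: restrict_None[symmetric])
  next
    case 2
    then have "Y \<inter> set (tips r) = {a, b}" "Y \<inter> set (tips l) = {}" using Fork.prems(2) disj by auto
    then show ?thesis using Fork by (auto simp: restrict_None[symmetric])
  next
    case 3
    then have "Y \<inter> set (tips l) = {a}" "Y \<inter> set (tips r) = {b}" using Fork.prems(2,3) disj by auto
    then show ?thesis using Fork.prems(1) by (simp add: restrict_single)
  next
    case 4
    then have "Y \<inter> set (tips l) = {b}" "Y \<inter> set (tips r) = {a}" using Fork.prems(2,3) disj by auto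
    then show ?thesis using Fork.prems(1) by (simp add: restrict_single)
  qed
qed

definition crosses :: "nat set \<Rightarrow> nat set \<Rightarrow> bool" where
  "crosses c C \<longleftrightarrow> c \<inter> C \<noteq> {} \<and> \<not> c \<subseteq> C"

text \<open>The subtrees of \<open>t\<close> spanned by the sets in \<open>P\<close> and by \<open>Y\<close> together with the root are
  edge-disjoint; an edge is represented by the cluster of leaves below it.\<close>

definition disjoint_spans :: "nat set set \<Rightarrow> nat set \<Rightarrow> btree \<Rightarrow> bool" where
  "disjoint_spans P Y t \<longleftrightarrow> (\<forall>C\<in>clusters t.
     (\<forall>c\<in>P. \<forall>d\<in>P. crosses c C \<longrightarrow> crosses d C \<longrightarrow> c = d) \<and>
     (Y \<inter> C \<noteq> {} \<longrightarrow> (\<forall>c\<in>P. \<not> crosses c C)))"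

lemma lowest_subtree:
  assumes "distinct (tips t)" "{a, b} \<subseteq> set (tips t)"
  obtains s where "clusters s \<subseteq> clusters t" "distinct (tips s)"
    "s = Tip a \<and> a = b \<or> (\<exists>l r. s = Fork l r \<and>
      (a \<in> set (tips l) \<and> b \<in> set (tips r) \<or> b \<in> set (tips l) \<and> a \<in> set (tips r)))"
    "t = s \<or> (\<exists>t0. graft s t0 t \<and>
      (\<forall>D\<in>clusters t0. D \<in> clusters t \<or> D \<union> set (tips s) \<in> clusters t))"
  using assms
proof (induction t arbitrary: thesis)
  case (Tip v)
  show ?case by (rule Tip.prems(1)[of "Tip v"]) (use Tip.prems in auto)
next
  case (Fork l r)
  let ?lowest = "\<lambda>s. s = Tip a \<and> a = b \<or> (\<exists>l r. s = Fork l r \<and>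
      (a \<in> set (tips l) \<and> b \<in> set (tips r) \<or> b \<in> set (tips l) \<and> a \<in> set (tips r)))"
  consider "{a, b} \<subseteq> set (tips l)" | "{a, b} \<subseteq> set (tips r)"
    | "a \<in> set (tips l) \<and> b \<in> set (tips r) \<or> b \<in> set (tips l) \<and> a \<in> set (tips r)"
    using Fork.prems(3) by auto
  then show ?case
  proof cases
    case 1
    obtain s where s: "clusters s \<subseteq> clusters l" "distinct (tips s)" "?lowest s"
      "l = s \<or> (\<exists>t0. graft s t0 l \<and>
        (\<forall>D\<in>clusters t0. D \<in> clusters l \<or> D \<union> set (tips s) \<in> clusters l))"
      using Fork.IH(1)[OF _ _ 1] Fork.prems(2) by auto
    have "\<exists>t0. graft s t0 (Fork l r) \<and> (\<forall>D\<in>clusters t0.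
      D \<in> clusters (Fork l r) \<or> D \<union> set (tips s) \<in> clusters (Fork l r))"
      using s(4)
    proof
      assume "l = s"
      then show ?thesis by (intro exI[of _ r]) (auto intro: graft_left)
    next
      assume "\<exists>t0. graft s t0 l \<and>
        (\<forall>D\<in>clusters t0. D \<in> clusters l \<or> D \<union> set (tips s) \<in> clusters l)"
      then obtain t0 where t0: "graft s t0 l"
        "\<forall>D\<in>clusters t0. D \<in> clusters l \<or> D \<union> set (tips s) \<in> clusters l" by blast
      have "set (tips t0) \<union> set (tips r) \<union> set (tips s) = set (tips (Fork l r))"
        using graft_tips(1)[OF t0(1)] by auto
      then show ?thesis using t0
        by (intro exI[of _ "Fork t0 r"]) (auto intro: graft_in_left)
    qed
    then show ?thesis using Fork.prems(1)[of s] s by auto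
  next
    case 2
    obtain s where s: "clusters s \<subseteq> clusters r" "distinct (tips s)" "?lowest s"
      "r = s \<or> (\<exists>t0. graft s t0 r \<and>
        (\<forall>D\<in>clusters t0. D \<in> clusters r \<or> D \<union> set (tips s) \<in> clusters r))"
      using Fork.IH(2)[OF _ _ 2] Fork.prems(2) by auto
    have "\<exists>t0. graft s t0 (Fork l r) \<and> (\<forall>D\<in>clusters t0.
      D \<in> clusters (Fork l r) \<or> D \<union> set (tips s) \<in> clusters (Fork l r))"
      using s(4)
    proof
      assume "r = s"
      then show ?thesis by (intro exI[of _ l]) (auto intro: graft_right)
    next
      assume "\<exists>t0. graft s t0 r \<and>
        (\<forall>D\<in>clusters t0. D \<in> clusters r \<or> D \<union> set (tips s) \<in> clusters r)"
      then obtain t0 where t0: "graft s t0 r"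
        "\<forall>D\<in>clusters t0. D \<in> clusters r \<or> D \<union> set (tips s) \<in> clusters r" by blast
      have "set (tips l) \<union> set (tips t0) \<union> set (tips s) = set (tips (Fork l r))"
        using graft_tips(1)[OF t0(1)] by auto
      then show ?thesis using t0
        by (intro exI[of _ "Fork l t0"]) (auto intro: graft_in_right)
    qed
    then show ?thesis using Fork.prems(1)[of s] s by auto
  next
    case 3
    show ?thesis by (rule Fork.prems(1)[of "Fork l r"]) (use 3 Fork.prems in auto)
  qed
qed

lemma graft_lift:
  assumes "restrict W t = Some z" "restrict W s = Some q" "graft q z z'"
  shows "\<exists>t'. graft s t t' \<and> restrict W t' = Some z' \<and>
    (\<forall>C\<in>clusters t'. C \<in> clusters s \<union> clusters t \<or>
       (\<exists>D\<in>clusters t. D \<inter> W \<noteq> {} \<and> C = D \<union> set (tips s)))"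
    (is "\<exists>t'. ?P t z' t'")
  using assms(1,3)
proof (induction t arbitrary: z z')
  case (Tip v)
  then have v: "v \<in> W" "z = Tip v" by (auto split: if_splits)
  from Tip(2) v have "z' = Fork q (Tip v) \<or> z' = Fork (Tip v) q"
    by (auto elim: graft.cases)
  then show ?case
  proof
    assume "z' = Fork q (Tip v)"
    then have "?P (Tip v) z' (Fork s (Tip v))" using v assms(2) by (auto intro: graft_left)
    then show ?thesis by blast
  next
    assume "z' = Fork (Tip v) q"
    then have "?P (Tip v) z' (Fork (Tip v) s)" using v assms(2) by (auto intro: graft_right)
    then show ?thesis by blast
  qed
next
  case (Fork l r)
  have meets: "set (tips (Fork l r)) \<inter> W \<noteq> {}"
    using Fork.prems(1) restrict_None[of W "Fork l r"] by auto
  have in_left: "?P (Fork l r) w (Fork l' r)"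
    if "?P l zl l'" "join (Some zl) (restrict W r) = Some w" for l' zl w
  proof -
    have "set (tips l') \<union> set (tips r) = set (tips (Fork l r)) \<union> set (tips s)"
      using that(1) graft_tips(1) by auto
    then show ?thesis using that meets by (auto intro: graft_in_left)
  qed
  have in_right: "?P (Fork l r) w (Fork l r')"
    if "?P r zr r'" "join (restrict W l) (Some zr) = Some w" for r' zr w
  proof -
    have "set (tips l) \<union> set (tips r') = set (tips (Fork l r)) \<union> set (tips s)"
      using that(1) graft_tips(1) by auto
    then show ?thesis using that meets by (auto intro: graft_in_right)
  qed
  consider "restrict W l = None" "restrict W r = Some z" | "restrict W l = Some z" "restrict W r = None"
    | zl zr where "restrict W l = Some zl" "restrict W r = Some zr" "z = Fork zl zr"
    using Fork.prems(1) by (cases "restrict W l"; cases "restrict W r") auto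
  then show ?case
  proof cases
    case 1
    then obtain r' where "?P r z' r'" using Fork.IH(2) Fork.prems(2) by blast
    then have "?P (Fork l r) z' (Fork l r')" using in_right[of r' z' z'] 1 by simp
    then show ?thesis by blast
  next
    case 2
    then obtain l' where "?P l z' l'" using Fork.IH(1) Fork.prems(2) by blast
    then have "?P (Fork l r) z' (Fork l' r)" using in_left[of l' z' z'] 2 by simp
    then show ?thesis by blast
  next
    case 3
    from Fork.prems(2)[unfolded 3(3)] show ?thesis
    proof cases
      case graft_left
      then have "?P (Fork l r) z' (Fork s (Fork l r))"
        using 3 assms(2) meets by (auto intro: graft.graft_left)
      then show ?thesis by blast
    next
      case graft_right
      then have "?P (Fork l r) z' (Fork (Fork l r) s)"
        using 3 assms(2) meets by (auto intro: graft.graft_right)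
      then show ?thesis by blast
    next
      case (graft_in_left zl')
      then obtain l' where "?P l zl' l'" using Fork.IH(1)[OF 3(1)] by blast
      then have "?P (Fork l r) z' (Fork l' r)" using in_left[of l' zl' z'] 3 graft_in_left by simp
      then show ?thesis by blast
    next
      case (graft_in_right zr')
      then obtain r' where "?P r zr' r'" using Fork.IH(2)[OF 3(2)] by blast
      then have "?P (Fork l r) z' (Fork l r')" using in_right[of r' zr' z'] 3 graft_in_right by simp
      then show ?thesis by blast
    qed
  qed
qed

lemma restrict_extend_graft:
  assumes "distinct (tips u)" "{a, b} \<subseteq> set (tips u)" "Y \<inter> {a, b} = {}" "restrict Y u = Some z"
    "\<And>C. C \<in> clusters u \<Longrightarrow> crosses {a, b} C \<Longrightarrow> Y \<inter> C = {}"
  shows "\<exists>q z'. restrict {a, b} u = Some q \<and> restrict (Y \<union> {a, b}) u = Some z' \<and> graft q z z'"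
  using assms
proof (induction u arbitrary: z)
  case (Tip v)
  then show ?case by (auto split: if_splits)
next
  case (Fork l r)
  let ?c = "{a, b}"
  have disj: "set (tips l) \<inter> set (tips r) = {}" using Fork.prems by simp
  have split: False if "crosses ?c (set (tips l))" "crosses ?c (set (tips r))"
  proof -
    have "Y \<inter> set (tips l) = {}" "Y \<inter> set (tips r) = {}"
      using that Fork.prems(5)[of "set (tips l)"] Fork.prems(5)[of "set (tips r)"] by auto
    then show False using Fork.prems(4) by (simp add: restrict_None[symmetric])
  qed
  consider "?c \<subseteq> set (tips l)" | "?c \<subseteq> set (tips r)"
    using split Fork.prems(2) disj unfolding crosses_def by auto
  then show ?case
  proof cases
    case 1
    then have r: "?c \<inter> set (tips r) = {}" using disj by auto
    then have rc: "restrict ?c r = None" "restrict (Y \<union> ?c) r = restrict Y r"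
      by (auto simp: restrict_None Int_Un_distrib2 intro!: restrict_cong)
    show ?thesis
    proof (cases "restrict Y l")
      case None
      then have zr: "restrict Y r = Some z" using Fork.prems(4) by simp
      have "restrict (Y \<union> ?c) l = restrict ?c l"
        by (rule restrict_cong) (use None in \<open>auto simp: restrict_None\<close>)
      moreover obtain q where "restrict ?c l = Some q"
        using 1 restrict_None[of ?c l] by (cases "restrict ?c l") auto
      ultimately show ?thesis using rc zr by (auto intro: graft_left)
    next
      case (Some zl)
      then obtain q zl' where "restrict ?c l = Some q" "restrict (Y \<union> ?c) l = Some zl'" "graft q zl zl'"
        using Fork.IH(1)[OF _ 1 Fork.prems(3) Some] Fork.prems by auto
      then show ?thesis using rc Some Fork.prems(4)
        by (cases "restrict Y r") (auto intro: graft_in_left)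
    qed
  next
    case 2
    then have l: "?c \<inter> set (tips l) = {}" using disj by auto
    then have lc: "restrict ?c l = None" "restrict (Y \<union> ?c) l = restrict Y l"
      by (auto simp: restrict_None Int_Un_distrib2 intro!: restrict_cong)
    show ?thesis
    proof (cases "restrict Y r")
      case None
      then have zl: "restrict Y l = Some z" using Fork.prems(4) by simp
      have "restrict (Y \<union> ?c) r = restrict ?c r"
        by (rule restrict_cong) (use None in \<open>auto simp: restrict_None\<close>)
      moreover obtain q where "restrict ?c r = Some q"
        using 2 restrict_None[of ?c r] by (cases "restrict ?c r") auto
      ultimately show ?thesis using lc zl by (auto intro: graft_right)
    next
      case (Some zr)
      then obtain q zr' where "restrict ?c r = Some q" "restrict (Y \<union> ?c) r = Some zr'" "graft q zr zr'"
        using Fork.IH(2)[OF _ 2 Fork.prems(3) Some] Fork.prems by auto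
      then show ?thesis using lc Some Fork.prems(4)
        by (cases "restrict Y l") (auto intro: graft_in_right)
    qed
  qed
qed

section \<open>Moving components one at a time\<close>

lemma graft_restrict_None:
  assumes "graft s t t'" "restrict Y s = None"
  shows "restrict Y t' = restrict Y t"
  using assms by (induction rule: graft.induct) auto

lemma top_swap_tips:
  assumes "top_swap s s'"
  shows "set (tips s') = set (tips s)" "distinct (tips s') \<longleftrightarrow> distinct (tips s)"
    "clusters s' = clusters s"
  using assms by (auto simp: top_swap_def)

definition near :: "btree \<Rightarrow> btree \<Rightarrow> bool" where
  "near t t' \<longleftrightarrow> top_swap t t' \<or> (\<exists>s s' t0. graft s t0 t \<and> graft s' t0 t' \<and> top_swap s s')"

lemma near_tips:
  assumes "near t t'"
  shows "set (tips t') = set (tips t)" "distinct (tips t') \<longleftrightarrow> distinct (tips t)"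
  using assms
  by (auto simp: near_def top_swap_tips graft_tips)

lemma near_class_moves:
  assumes "near t t'" "btree_on n t" "n \<ge> 2"
  shows "tree_class n t = tree_class n t' \<or> (tree_class n t, tree_class n t') \<in> class_moves \<chi> {0..n}"
  using assms(1) unfolding near_def
proof
  assume "top_swap t t'"
  then show ?thesis using tree_class_swap assms(2) by (auto simp: top_swap_def)
next
  assume "\<exists>s s' t0. graft s t0 t \<and> graft s' t0 t' \<and> top_swap s s'"
  then show ?thesis using regraft_class_moves assms(2,3) by blast
qed

text \<open>One move takes the subtree below the lowest common ancestor of \<open>a\<close> and \<open>b\<close>, with whatever
  hangs off it, to the place that \<open>u\<close> prescribes.\<close>

lemma component_step:
  assumes dt: "distinct (tips t)" and du: "distinct (tips u)" and tu: "set (tips t) = set (tips u)"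
    and sub: "\<And>d. d \<in> P \<Longrightarrow> d \<subseteq> set (tips t)" and PY: "\<And>d. d \<in> P \<Longrightarrow> d \<inter> Y = {}"
    and PP: "\<And>d e. d \<in> P \<Longrightarrow> e \<in> P \<Longrightarrow> d \<noteq> e \<Longrightarrow> d \<inter> e = {}"
    and ds_t: "disjoint_spans P Y t" and ds_u: "disjoint_spans P Y u"
    and c: "{a, b} \<in> P" and eq: "restrict Y t = restrict Y u"
  shows "\<exists>t'. near t t' \<and> disjoint_spans (P - {{a, b}}) (Y \<union> {a, b}) t' \<and>
    restrict (Y \<union> {a, b}) t' = restrict (Y \<union> {a, b}) u"
proof -
  let ?c = "{a, b}" and ?W = "Y \<union> {a, b}"
  have ab: "?c \<subseteq> set (tips t)" and cY: "Y \<inter> ?c = {}" using sub[OF c] PY[OF c] by auto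
  obtain s where s: "clusters s \<subseteq> clusters t" "distinct (tips s)"
    "s = Tip a \<and> a = b \<or> (\<exists>l r. s = Fork l r \<and>
      (a \<in> set (tips l) \<and> b \<in> set (tips r) \<or> b \<in> set (tips l) \<and> a \<in> set (tips r)))"
    "t = s \<or> (\<exists>t0. graft s t0 t \<and>
      (\<forall>D\<in>clusters t0. D \<in> clusters t \<or> D \<union> set (tips s) \<in> clusters t))"
    using lowest_subtree[OF dt ab] by metis
  let ?S = "set (tips s)"
  have uniq: "d = e" if "C \<in> clusters t" "d \<in> P" "e \<in> P" "crosses d C" "crosses e C" for C d e
    using ds_t that unfolding disjoint_spans_def by blast
  have noY: "Y \<inter> C = {}" if "C \<in> clusters t" "d \<in> P" "crosses d C" for C d
    using ds_t that unfolding disjoint_spans_def by blast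
  have c_cross: "crosses ?c C" if C: "C \<in> clusters s" "C \<noteq> ?S" "?c \<inter> C \<noteq> {}" for C
  proof -
    from s(3) C obtain l r where lr: "s = Fork l r"
      "a \<in> set (tips l) \<and> b \<in> set (tips r) \<or> b \<in> set (tips l) \<and> a \<in> set (tips r)" by auto
    have "C \<subseteq> set (tips l) \<or> C \<subseteq> set (tips r)"
      using C lr cluster_subset_tips by auto
    moreover have "set (tips l) \<inter> set (tips r) = {}" using s(2) lr by simp
    ultimately show ?thesis using C(3) lr(2) unfolding crosses_def by blast
  qed
  have c_in_S: "?c \<subseteq> ?S" using s(3) by auto
  have S_cases: "e \<in> ?c \<or> (\<exists>C\<in>clusters s. e \<in> C \<and> crosses ?c C)" if "e \<in> ?S" for e
  proof (cases "s = Tip a \<and> a = b")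
    case False
    then obtain l r where lr: "s = Fork l r"
      "a \<in> set (tips l) \<and> b \<in> set (tips r) \<or> b \<in> set (tips l) \<and> a \<in> set (tips r)" using s(3) by blast
    have disj: "set (tips l) \<inter> set (tips r) = {}" using s(2) lr by simp
    have "crosses ?c (set (tips l))" "crosses ?c (set (tips r))"
      using lr(2) disj unfolding crosses_def by blast+
    moreover have "set (tips l) \<in> clusters s" "set (tips r) \<in> clusters s" using lr by auto
    ultimately show ?thesis using that lr by auto
  qed (use that in auto)
  have YS: "Y \<inter> ?S = {}"
  proof (rule ccontr)
    assume "Y \<inter> ?S \<noteq> {}"
    then obtain e where e: "e \<in> Y" "e \<in> ?S" by blast
    then obtain C where "C \<in> clusters s" "e \<in> C" "crosses ?c C" using S_cases[of e] cY by blast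
    then show False using noY[of C ?c] s(1) c e(1) by blast
  qed
  have dS: "d \<subseteq> ?S \<or> d \<inter> ?S = {}" if d: "d \<in> P" "d \<noteq> ?c" for d
  proof (rule ccontr)
    assume n: "\<not> (d \<subseteq> ?S \<or> d \<inter> ?S = {})"
    then obtain e where e: "e \<in> d" "e \<in> ?S" by blast
    have "e \<notin> ?c" using PP[OF d(1) c d(2)] e by blast
    then obtain C where C: "C \<in> clusters s" "e \<in> C" "crosses ?c C" using S_cases[of e] e by blast
    have "C \<subseteq> ?S" using C cluster_subset_tips by blast
    then have "crosses d C" using n C(2) e(1) unfolding crosses_def by blast
    then show False using uniq[of C d ?c] C s(1) d c by blast
  qed
  have d_cross: "crosses d (C \<union> ?S)" if "d \<in> P" "d \<noteq> ?c" "crosses d C" "C \<inter> ?S = {}" for d C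
    using dS[OF that(1,2)] that(3,4) unfolding crosses_def by blast
  have d_cross': "crosses d D" if "d \<in> P" "d \<noteq> ?c" "crosses d (D \<union> ?S)" for d D
    using dS[OF that(1,2)] that(3) unfolding crosses_def by blast
  have abu: "?c \<subseteq> set (tips u)" using ab tu by simp
  obtain q where q: "restrict ?c u = Some q"
    using abu restrict_None[of ?c u] by (cases "restrict ?c u") auto
  obtain s' where s': "top_swap s s'" "restrict ?c s' = Some q"
  proof (cases "s = Tip a \<and> a = b")
    case True
    then have "q = Tip a" using restrict_single[OF du, of ?c a] abu q by auto
    then show ?thesis using that[of s] True by (auto simp: top_swap_def)
  next
    case False
    then obtain l r where lr: "s = Fork l r"
      "a \<in> set (tips l) \<and> b \<in> set (tips r) \<or> b \<in> set (tips l) \<and> a \<in> set (tips r)" using s(3) by blast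
    have disj: "set (tips l) \<inter> set (tips r) = {}" "distinct (tips l)" "distinct (tips r)"
      using s(2) lr by auto
    have "a \<noteq> b" using lr(2) disj by auto
    moreover have "?c \<inter> set (tips u) = {a, b}" using abu by auto
    ultimately have q': "q = Fork (Tip a) (Tip b) \<or> q = Fork (Tip b) (Tip a)"
      using restrict_pair[OF du, of ?c a b] q by auto
    obtain e f where ef: "e \<in> set (tips l)" "f \<in> set (tips r)" "?c = {e, f}" using lr(2) by blast
    then have "?c \<inter> set (tips l) = {e}" "?c \<inter> set (tips r) = {f}" using disj by auto
    then have "restrict ?c l = Some (Tip e)" "restrict ?c r = Some (Tip f)"
      using disj restrict_single by blast+
    moreover have "q = Fork (Tip e) (Tip f) \<or> q = Fork (Tip f) (Tip e)"
      using q' ef(3) by (auto simp: doubleton_eq_iff)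
    ultimately show ?thesis using that[of "Fork l r"] that[of "Fork r l"] lr(1)
      by (auto simp: top_swap_def)
  qed
  note s'_tips = top_swap_tips[OF s'(1)]
  have Ws': "restrict ?W s' = Some q"
    unfolding s'(2)[symmetric] by (rule restrict_cong) (use YS s'_tips in auto)
  have Wu: "restrict ?W u = Some q" if "restrict Y t = None"
    unfolding q[symmetric] by (rule restrict_cong) (use that tu in \<open>auto simp: restrict_None\<close>)
  have "\<exists>t'. near t t' \<and> restrict ?W t' = restrict ?W u \<and>
    (\<forall>C\<in>clusters t'. C \<in> clusters s \<or> C = set (tips t) \<or>
      C \<inter> ?S = {} \<and> (C \<in> clusters t \<or> C \<union> ?S \<in> clusters t) \<or>
      (\<exists>D. C = D \<union> ?S \<and> D \<inter> Y \<noteq> {} \<and> (D \<in> clusters t \<or> D \<union> ?S \<in> clusters t)))"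
    using s(4)
  proof
    assume t: "t = s"
    then have "restrict Y t = None" using YS by (simp add: restrict_None)
    then show ?thesis using t s' Ws' Wu s'_tips by (intro exI[of _ s']) (auto simp: near_def)
  next
    assume "\<exists>t0. graft s t0 t \<and> (\<forall>D\<in>clusters t0. D \<in> clusters t \<or> D \<union> ?S \<in> clusters t)"
    then obtain t0 where t0: "graft s t0 t"
      and cl0: "\<And>D. D \<in> clusters t0 \<Longrightarrow> D \<in> clusters t \<or> D \<union> ?S \<in> clusters t" by blast
    have St0: "?S \<inter> set (tips t0) = {}" "set (tips t) = ?S \<union> set (tips t0)"
      using graft_tips[OF t0] dt by auto
    have D0: "D \<inter> ?S = {}" if "D \<in> clusters t0" for D
      using that cluster_subset_tips St0 by blast
    have Yt0: "restrict Y t0 = restrict Y t"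
      using graft_restrict_None[OF t0] YS by (simp add: restrict_None)
    have Wt0: "restrict ?W t0 = restrict Y t0"
      by (rule restrict_cong) (use c_in_S St0 in auto)
    show ?thesis
    proof (cases "restrict Y t")
      case None
      let ?t' = "Fork s' t0"
      have "near t ?t'" using t0 s'(1) unfolding near_def by (blast intro: graft_left)
      moreover have "restrict ?W ?t' = restrict ?W u" using Ws' Wt0 Yt0 None Wu by simp
      moreover have "C \<in> clusters s \<or> C = set (tips t) \<or> C \<in> clusters t0" if "C \<in> clusters ?t'" for C
        using that St0 s'_tips by auto
      then have "\<forall>C\<in>clusters ?t'. C \<in> clusters s \<or> C = set (tips t) \<or>
        C \<inter> ?S = {} \<and> (C \<in> clusters t \<or> C \<union> ?S \<in> clusters t) \<or>
        (\<exists>D. C = D \<union> ?S \<and> D \<inter> Y \<noteq> {} \<and> (D \<in> clusters t \<or> D \<union> ?S \<in> clusters t))"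
        using cl0 D0 by meson
      ultimately show ?thesis by blast
    next
      case (Some z)
      have "restrict Y u = Some z" using Some eq by simp
      moreover have "Y \<inter> C = {}" if "C \<in> clusters u" "crosses ?c C" for C
        using ds_u that c unfolding disjoint_spans_def by blast
      ultimately obtain z' where z': "restrict ?W u = Some z'" "graft q z z'"
        using restrict_extend_graft[OF du abu cY, of z] q by auto
      obtain t' where t': "graft s' t0 t'" "restrict ?W t' = Some z'"
        "\<forall>C\<in>clusters t'. C \<in> clusters s' \<union> clusters t0 \<or>
           (\<exists>D\<in>clusters t0. D \<inter> ?W \<noteq> {} \<and> C = D \<union> set (tips s'))"
        using graft_lift[of ?W t0 z s' q z'] Wt0 Yt0 Some Ws' z'(2) by auto
      have "near t t'" using t0 t'(1) s'(1) unfolding near_def by blast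
      moreover have "C \<in> clusters s \<or> C \<in> clusters t0 \<or>
        (\<exists>D\<in>clusters t0. D \<inter> Y \<noteq> {} \<and> C = D \<union> ?S)" if C: "C \<in> clusters t'" for C
      proof -
        have "D \<inter> Y \<noteq> {}" if "D \<in> clusters t0" "D \<inter> ?W \<noteq> {}" for D
          using D0[OF that(1)] c_in_S that(2) by blast
        then show ?thesis using bspec[OF t'(3) C] unfolding s'_tips by blast
      qed
      then have "\<forall>C\<in>clusters t'. C \<in> clusters s \<or> C = set (tips t) \<or>
        C \<inter> ?S = {} \<and> (C \<in> clusters t \<or> C \<union> ?S \<in> clusters t) \<or>
        (\<exists>D. C = D \<union> ?S \<and> D \<inter> Y \<noteq> {} \<and> (D \<in> clusters t \<or> D \<union> ?S \<in> clusters t))"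
        using cl0 D0 by meson
      moreover have "restrict ?W t' = restrict ?W u" using z'(1) t'(2) by simp
      ultimately show ?thesis by blast
    qed
  qed
  then obtain t' where near: "near t t'" and res: "restrict ?W t' = restrict ?W u"
    and cl': "\<forall>C\<in>clusters t'. C \<in> clusters s \<or> C = set (tips t) \<or>
      C \<inter> ?S = {} \<and> (C \<in> clusters t \<or> C \<union> ?S \<in> clusters t) \<or>
      (\<exists>D. C = D \<union> ?S \<and> D \<inter> Y \<noteq> {} \<and> (D \<in> clusters t \<or> D \<union> ?S \<in> clusters t))"
    by (elim exE conjE) (rule that)
  note cl = bspec[OF cl']
  have "(\<forall>d\<in>P - {?c}. \<forall>e\<in>P - {?c}. crosses d C \<longrightarrow> crosses e C \<longrightarrow> d = e) \<and>
     (?W \<inter> C \<noteq> {} \<longrightarrow> (\<forall>d\<in>P - {?c}. \<not> crosses d C))" if "C \<in> clusters t'" for C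
    using cl[OF that]
  proof (elim disjE exE conjE)
    assume C: "C \<in> clusters s"
    have "?W \<inter> C = {}" if d: "d \<in> P" "d \<noteq> ?c" "crosses d C" for d
    proof -
      have "C \<noteq> ?S" using dS[OF d(1,2)] d(3) unfolding crosses_def by blast
      moreover have "\<not> crosses ?c C" using uniq[of C d ?c] C s(1) d c by blast
      ultimately have "?c \<inter> C = {}" using c_cross[OF C] by blast
      moreover have "Y \<inter> C = {}" using YS cluster_subset_tips[OF C] by blast
      ultimately show ?thesis by blast
    qed
    moreover have "C \<in> clusters t" using C s(1) by blast
    ultimately show ?thesis using uniq by blast
  next
    assume "C = set (tips t)"
    then show ?thesis using sub unfolding crosses_def by blast
  next
    assume C: "C \<inter> ?S = {}" "C \<in> clusters t"
    then show ?thesis using uniq noY c_in_S by blast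
  next
    assume C: "C \<inter> ?S = {}" "C \<union> ?S \<in> clusters t"
    have "d = e" if "d \<in> P - {?c}" "e \<in> P - {?c}" "crosses d C" "crosses e C" for d e
      using uniq[OF C(2)] d_cross C(1) that by blast
    moreover have "?W \<inter> C = {}" if "d \<in> P - {?c}" "crosses d C" for d
      using noY[OF C(2)] d_cross C(1) that c_in_S by blast
    ultimately show ?thesis by blast
  next
    fix D assume D: "C = D \<union> ?S" "D \<inter> Y \<noteq> {}" "D \<in> clusters t"
    have "\<not> crosses d C" if "d \<in> P - {?c}" for d
      using noY[OF D(3)] d_cross' D that by blast
    then show ?thesis by blast
  next
    fix D assume D: "C = D \<union> ?S" "D \<inter> Y \<noteq> {}" "D \<union> ?S \<in> clusters t"
    have "\<not> crosses d C" if "d \<in> P - {?c}" for d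
      using noY[OF D(3)] D that by blast
    then show ?thesis by blast
  qed
  then have "disjoint_spans (P - {?c}) ?W t'" unfolding disjoint_spans_def by blast
  then show ?thesis using near res by blast
qed

text \<open>The component whose minimal enclosing cluster is largest is not below any other one.\<close>

lemma top_component_exists:
  assumes "distinct (tips u)" "finite P" "P \<noteq> {}" "\<And>d. d \<in> P \<Longrightarrow> d \<subseteq> set (tips u)"
    "disjoint_spans P Y u"
  shows "\<exists>c\<in>P. disjoint_spans (P - {c}) (Y \<union> c) u"
proof -
  define \<mu> where "\<mu> d = (LEAST k. \<exists>C\<in>clusters u. d \<subseteq> C \<and> card C = k)" for d
  have \<mu>: "\<exists>C\<in>clusters u. d \<subseteq> C \<and> card C = \<mu> d" if "d \<in> P" for d
    unfolding \<mu>_def by (rule LeastI_ex) (use assms(4)[OF that] tips_cluster in blast)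
  have "finite (\<mu> ` P)" "\<mu> ` P \<noteq> {}" using assms by auto
  then obtain c where c: "c \<in> P" "\<mu> c = Max (\<mu> ` P)" by (metis Max_in imageE)
  then have max: "\<mu> d \<le> \<mu> c" if "d \<in> P" for d using that assms(2) by simp
  have "(Y \<union> c) \<inter> C = {}" if d: "d \<in> P - {c}" "C \<in> clusters u" "crosses d C" for d C
  proof -
    have "Y \<inter> C = {}" using assms(5) d unfolding disjoint_spans_def by blast
    moreover have "c \<inter> C = {}"
    proof (rule ccontr)
      assume n: "c \<inter> C \<noteq> {}"
      have "\<not> crosses c C" using assms(5) d c(1) unfolding disjoint_spans_def by blast
      then have "c \<subseteq> C" using n unfolding crosses_def by blast
      then have le: "\<mu> c \<le> card C" unfolding \<mu>_def using d(2) by (intro Least_le) blast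
      obtain D where D: "D \<in> clusters u" "d \<subseteq> D" "card D = \<mu> d" using \<mu> d(1) by blast
      have "C \<inter> D \<noteq> {}" "\<not> D \<subseteq> C" using d(3) D(2) unfolding crosses_def by blast+
      then have "C \<subset> D" using clusters_laminar[OF assms(1) d(2) D(1)] by blast
      moreover have "finite D" by (rule finite_subset[OF cluster_subset_tips[OF D(1)]]) simp
      ultimately have "card C < \<mu> d" using psubset_card_mono[of D C] D(3) by simp
      then show False using le max[of d] d(1) by simp
    qed
    ultimately show ?thesis by blast
  qed
  moreover have "d = e" if "C \<in> clusters u" "d \<in> P" "e \<in> P" "crosses d C" "crosses e C" for C d e
    using assms(5) that unfolding disjoint_spans_def by blast
  ultimately have "disjoint_spans (P - {c}) (Y \<union> c) u"
    unfolding disjoint_spans_def by (metis DiffD1)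
  then show ?thesis using c(1) by blast
qed

lemma components_distance:
  assumes "finite P" "btree_on n t" "btree_on n u" "n \<ge> 2"
    and "\<Union> P \<union> Y = {1..n}" "\<And>d. d \<in> P \<Longrightarrow> \<exists>a b. d = {a, b}" "\<And>d. d \<in> P \<Longrightarrow> d \<inter> Y = {}"
    and "\<And>d e. d \<in> P \<Longrightarrow> e \<in> P \<Longrightarrow> d \<noteq> e \<Longrightarrow> d \<inter> e = {}"
    and "disjoint_spans P Y t" "disjoint_spans P Y u" "restrict Y t = restrict Y u"
  shows "\<exists>k\<le>card P. (tree_class n t, tree_class n u) \<in> class_moves \<chi> {0..n} ^^ k"
  using assms
proof (induction "card P" arbitrary: P Y t)
  case 0
  then have "Y = {1..n}" by auto
  then have "t = u" using 0 restrict_all[of t Y] restrict_all[of u Y] by (auto simp: btree_on_def)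
  then show ?case by (intro exI[of _ 0]) auto
next
  case (Suc m)
  have on: "distinct (tips t)" "distinct (tips u)" "set (tips t) = {1..n}" "set (tips u) = {1..n}"
    using Suc.prems by (auto simp: btree_on_def)
  have sub: "d \<subseteq> {1..n}" if "d \<in> P" for d using Suc.prems(5) that by blast
  have "P \<noteq> {}" using Suc.hyps(2) by auto
  then obtain c where c: "c \<in> P" "disjoint_spans (P - {c}) (Y \<union> c) u"
    using top_component_exists[OF on(2) Suc.prems(1) _ _ Suc.prems(10)] sub on(4) by blast
  obtain a b where ab: "c = {a, b}" using Suc.prems(6) c(1) by blast
  obtain t' where t': "near t t'" "disjoint_spans (P - {c}) (Y \<union> c) t'"
    "restrict (Y \<union> c) t' = restrict (Y \<union> c) u"
    using component_step[OF on(1,2) _ _ Suc.prems(7,8,9,10), of a b] c(1) sub on Suc.prems(11)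
    unfolding ab by auto
  have t'_on: "btree_on n t'" using near_tips[OF t'(1)] Suc.prems(2) by (simp add: btree_on_def)
  have card_m: "card (P - {c}) = m" using Suc.hyps(2) c(1) Suc.prems(1) by (simp add: card_Diff_singleton)
  have "\<exists>k\<le>card (P - {c}). (tree_class n t', tree_class n u) \<in> class_moves \<chi> {0..n} ^^ k"
  proof (rule Suc.hyps(1)[OF _ _ t'_on Suc.prems(3,4) _ _ _ _ t'(2) c(2) t'(3)])
    show "m = card (P - {c})" by (simp add: card_m)
    show "\<Union> (P - {c}) \<union> (Y \<union> c) = {1..n}" using Suc.prems(5) c(1) by blast
    show "d \<inter> (Y \<union> c) = {}" if "d \<in> P - {c}" for d
      using Suc.prems(7,8) c(1) that by blast
  qed (use Suc.prems in auto)
  then obtain k where k: "k \<le> m" "(tree_class n t', tree_class n u) \<in> class_moves \<chi> {0..n} ^^ k"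
    unfolding card_m by blast
  show ?case
    using near_class_moves[OF t'(1) Suc.prems(2,4), of \<chi>]
  proof
    assume "tree_class n t = tree_class n t'"
    then show ?thesis using k Suc.hyps(2) by (intro exI[of _ k]) auto
  next
    assume "(tree_class n t, tree_class n t') \<in> class_moves \<chi> {0..n}"
    then have "(tree_class n t, tree_class n u) \<in> class_moves \<chi> {0..n} ^^ Suc k"
      using k(2) by (metis relpow_Suc_I2)
    then show ?thesis using k(1) Suc.hyps(2) by (intro exI[of _ "Suc k"]) auto
  qed
qed

section \<open>Block decompositions and the upper bound\<close>

fun breaks :: "(nat \<Rightarrow> nat) \<Rightarrow> nat \<Rightarrow> itree \<Rightarrow> nat" where
  "breaks g p (ITip v) = of_bool (g p \<noteq> g v)"
| "breaks g p (IFork x l r) = of_bool (g p \<noteq> g x) + breaks g x l + breaks g x r"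

lemma disjoint_spans_close:
  assumes "disjoint_spans B R t"
  shows "disjoint_spans (insert R B) {} t"
proof -
  have "R \<inter> C \<noteq> {}" if "crosses R C" for C using that by (simp add: crosses_def)
  then show ?thesis using assms unfolding disjoint_spans_def by blast
qed

lemma disjoint_spans_Fork:
  assumes "disjoint_spans B1 R1 l" "disjoint_spans B2 R2 r" "distinct (tips (Fork l r))"
    "\<Union> B1 \<union> R1 \<subseteq> set (tips l)" "\<Union> B2 \<union> R2 \<subseteq> set (tips r)"
  shows "disjoint_spans (B1 \<union> B2) (R1 \<union> R2) (Fork l r)"
proof -
  have disj: "set (tips l) \<inter> set (tips r) = {}" using assms(3) by simp
  have "(\<forall>c\<in>B1 \<union> B2. \<forall>d\<in>B1 \<union> B2. crosses c C \<longrightarrow> crosses d C \<longrightarrow> c = d) \<and>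
     ((R1 \<union> R2) \<inter> C \<noteq> {} \<longrightarrow> (\<forall>c\<in>B1 \<union> B2. \<not> crosses c C))" if C: "C \<in> clusters (Fork l r)" for C
  proof -
    consider "C = set (tips (Fork l r))" | "C \<in> clusters l" | "C \<in> clusters r" using C by auto
    then show ?thesis
    proof cases
      case 1
      then have "\<not> crosses c C" if "c \<in> B1 \<union> B2" for c
        using assms(4,5) that by (auto simp: crosses_def)
      then show ?thesis by blast
    next
      case 2
      then have "C \<subseteq> set (tips l)" by (rule cluster_subset_tips)
      then have "R2 \<inter> C = {}" "\<And>c. c \<in> B2 \<Longrightarrow> \<not> crosses c C"
        using disj assms(5) unfolding crosses_def by blast+
      then show ?thesis using 2 assms(1) unfolding disjoint_spans_def by blast
    next
      case 3
      then have "C \<subseteq> set (tips r)" by (rule cluster_subset_tips)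
      then have "R1 \<inter> C = {}" "\<And>c. c \<in> B1 \<Longrightarrow> \<not> crosses c C"
        using disj assms(4) unfolding crosses_def by blast+
      then show ?thesis using 3 assms(2) unfolding disjoint_spans_def by blast
    qed
  qed
  then show ?thesis unfolding disjoint_spans_def by blast
qed

lemma card_colours_merge:
  assumes "finite A" "finite B"
  shows "card (insert y (A \<union> B)) - 1 \<le>
    of_bool (y \<noteq> x) + (card (insert x A) - 1) + (card (insert x B) - 1)"
proof -
  let ?A = "insert x A" and ?B = "insert x B"
  have "card (?A \<union> ?B) + card (?A \<inter> ?B) = card ?A + card ?B"
    using card_Un_Int[of ?A ?B] assms by simp
  moreover have "card (?A \<inter> ?B) \<ge> 1"
    using assms by (metis IntI One_nat_def Suc_leI card_gt_0_iff empty_iff finite_Int finite_insert insertI1)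
  moreover have "card (insert y (A \<union> B)) \<le> of_bool (y \<noteq> x) + card (?A \<union> ?B)"
  proof (cases "y = x")
    case False
    have "card (insert y (A \<union> B)) \<le> card (insert y (?A \<union> ?B))"
      by (rule card_mono) (use assms in auto)
    also have "\<dots> \<le> Suc (card (?A \<union> ?B))" using card_insert_le_m1 assms
      by (simp add: card_insert_if)
    finally show ?thesis using False by simp
  qed simp
  ultimately show ?thesis by linarith
qed

definition block_family :: "nat \<Rightarrow> nat set set \<Rightarrow> nat set \<Rightarrow> nat set \<Rightarrow> bool" where
  "block_family m B R X \<longleftrightarrow> finite B \<and> (\<forall>b\<in>B. m \<le> card b \<and> card b < 2 * m) \<and> card R < m \<and>
     (\<forall>b\<in>insert R B. \<forall>b'\<in>insert R B. b \<noteq> b' \<longrightarrow> b \<inter> b' = {}) \<and> R \<notin> B \<and> \<Union> (insert R B) = X"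

text \<open>Cut off a subtree as soon as it holds at least \<open>m\<close> leaves that are not yet cut off; \<open>R\<close> is the
  remainder, still connected to the root.\<close>

lemma block_decomposition:
  assumes "distinct (nodes t)" "m \<ge> 2"
  shows "\<exists>B R. block_family m B R (set (tips (erase t))) \<and> disjoint_spans B R (erase t) \<and>
    (\<forall>g p. (\<Sum>b\<in>B. card (g ` b) - 1) + (card (insert (g p) (g ` R)) - 1) \<le> breaks g p t)"
  using assms(1)
proof (induction t)
  case (ITip v)
  have "block_family m {} {v} {v}" using assms(2) by (auto simp: block_family_def)
  moreover have "disjoint_spans {} {v} (Tip v)" by (simp add: disjoint_spans_def)
  moreover have "card (insert (g p) (g ` {v})) - 1 \<le> breaks g p (ITip v)" for g p
    by (simp add: card_insert_if)
  ultimately show ?case by (intro exI[of _ "{}"] exI[of _ "{v}"]) auto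
next
  case (IFork x l r)
  let ?L = "set (tips (erase l))" and ?R = "set (tips (erase r))"
  have dist: "distinct (tips (Fork (erase l) (erase r)))"
    using distinct_tips_erase[OF IFork.prems] by simp
  then have disj: "?L \<inter> ?R = {}" by simp
  obtain B1 R1 where 1: "block_family m B1 R1 ?L" "disjoint_spans B1 R1 (erase l)"
    "\<And>g p. (\<Sum>b\<in>B1. card (g ` b) - 1) + (card (insert (g p) (g ` R1)) - 1) \<le> breaks g p l"
    using IFork by auto
  obtain B2 R2 where 2: "block_family m B2 R2 ?R" "disjoint_spans B2 R2 (erase r)"
    "\<And>g p. (\<Sum>b\<in>B2. card (g ` b) - 1) + (card (insert (g p) (g ` R2)) - 1) \<le> breaks g p r"
    using IFork by auto
  define B R where "B = B1 \<union> B2" and "R = R1 \<union> R2"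
  have "R1 \<subseteq> ?L" "R2 \<subseteq> ?R" using 1(1) 2(1) by (auto simp: block_family_def)
  then have "finite R1" "finite R2" using finite_subset[of R1 ?L] finite_subset[of R2 ?R] by auto
  then have fin: "finite B1" "finite B2" "finite R1" "finite R2" "finite R"
    using 1(1) 2(1) by (auto simp: block_family_def R_def)
  have U: "\<Union> (insert R1 B1) = ?L" "\<Union> (insert R2 B2) = ?R"
    using 1(1) 2(1) by (simp_all add: block_family_def)
  have sub: "\<And>b. b \<in> insert R1 B1 \<Longrightarrow> b \<subseteq> ?L" "\<And>b. b \<in> insert R2 B2 \<Longrightarrow> b \<subseteq> ?R"
    using U by blast+
  have big: "m \<le> card b" "card b < 2 * m" if "b \<in> B" for b
    using 1(1) 2(1) that by (auto simp: block_family_def B_def)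
  have ne: "b \<noteq> {}" if "b \<in> B" for b using assms(2) big(1)[OF that] by auto
  have "B1 \<inter> B2 = {}"
  proof (rule ccontr)
    assume "B1 \<inter> B2 \<noteq> {}"
    then obtain b where b: "b \<in> B1" "b \<in> B2" by blast
    then have "b \<subseteq> {}" using sub[of b] disj by blast
    then show False using ne[of b] b by (simp add: B_def)
  qed
  have pd1: "b \<inter> b' = {}" if "b \<in> insert R1 B1" "b' \<in> insert R1 B1" "b \<noteq> b'" for b b'
    using 1(1) that unfolding block_family_def by blast
  have pd2: "b \<inter> b' = {}" if "b \<in> insert R2 B2" "b' \<in> insert R2 B2" "b \<noteq> b'" for b b'
    using 2(1) that unfolding block_family_def by blast
  have pd12: "b \<inter> b' = {}" if "b \<in> insert R1 B1" "b' \<in> insert R2 B2" for b b'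
    using sub(1)[OF that(1)] sub(2)[OF that(2)] disj by blast
  have RB: "R1 \<notin> B1" "R2 \<notin> B2" using 1(1) 2(1) by (simp_all add: block_family_def)
  have BB: "b \<inter> b' = {}" if "b \<in> B" "b' \<in> B" "b \<noteq> b'" for b b'
    using that pd1[of b b'] pd2[of b b'] pd12[of b b'] pd12[of b' b] unfolding B_def by auto
  have BR: "b \<inter> R = {}" if "b \<in> B" for b
  proof -
    have "b \<inter> R1 = {}" using that pd1[of b R1] pd12[of R1 b] RB unfolding B_def by auto
    moreover have "b \<inter> R2 = {}" using that pd2[of b R2] pd12[of b R2] RB unfolding B_def by auto
    ultimately show ?thesis unfolding R_def by blast
  qed
  have RnB: "R \<notin> B" using BR ne by blast
  have cover: "\<Union> (insert R B) = ?L \<union> ?R"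
    unfolding B_def R_def U[symmetric] by blast
  have spans: "disjoint_spans B R (erase (IFork x l r))"
    unfolding B_def R_def erase.simps
    by (rule disjoint_spans_Fork[OF 1(2) 2(2) dist]) (use sub in auto)
  have score: "(\<Sum>b\<in>B. card (g ` b) - 1) + (card (insert (g p) (g ` R)) - 1) \<le> breaks g p (IFork x l r)"
    for g p
  proof -
    have "(\<Sum>b\<in>B. card (g ` b) - 1) = (\<Sum>b\<in>B1. card (g ` b) - 1) + (\<Sum>b\<in>B2. card (g ` b) - 1)"
      unfolding B_def using fin \<open>B1 \<inter> B2 = {}\<close> by (intro sum.union_disjoint) auto
    moreover have "card (insert (g p) (g ` R)) - 1 \<le>
      of_bool (g p \<noteq> g x) + (card (insert (g x) (g ` R1)) - 1) + (card (insert (g x) (g ` R2)) - 1)"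
      unfolding R_def image_Un using fin by (intro card_colours_merge) auto
    ultimately show ?thesis using 1(3)[of g x] 2(3)[of g x] by simp
  qed
  show ?case
  proof (cases "card R < m")
    case True
    have "block_family m B R (?L \<union> ?R)"
      using True big fin BB BR RnB cover unfolding block_family_def
      by (auto simp: B_def Int_commute)
    then show ?thesis using spans score by (intro exI[of _ B] exI[of _ R]) auto
  next
    case False
    have "card R < 2 * m" using card_Un_le[of R1 R2] 1(1) 2(1) by (simp add: R_def block_family_def)
    moreover have "R \<noteq> {}" using False assms(2) by auto
    moreover have "{} \<notin> B" using ne by blast
    ultimately have "block_family m (insert R B) {} (?L \<union> ?R)"
      using False big fin BB BR RnB cover assms(2) unfolding block_family_def
      by (auto simp: B_def Int_commute)
    moreover have "(\<Sum>b\<in>insert R B. card (g ` b) - 1) + (card (insert (g p) (g ` {})) - 1)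
        \<le> breaks g p (IFork x l r)" for g p
    proof -
      have "card (g ` R) - 1 \<le> card (insert (g p) (g ` R)) - 1"
        using fin by (intro diff_le_mono card_mono) auto
      moreover have "(\<Sum>b\<in>insert R B. card (g ` b) - 1) = (card (g ` R) - 1) + (\<Sum>b\<in>B. card (g ` b) - 1)"
        using fin RnB by (simp add: B_def)
      ultimately show ?thesis using score[of g p] by simp
    qed
    ultimately show ?thesis using disjoint_spans_close[OF spans]
      by (intro exI[of _ "insert R B"] exI[of _ "{}"]) auto
  qed
qed

lemma block_family_card:
  assumes "block_family m B R X" "finite X" "m \<ge> 2"
  shows "card (insert R B) \<le> card X div m + 1"
    and "\<And>b. b \<in> insert R B \<Longrightarrow> card b \<le> 2 * m"
proof -
  have fb: "finite B" "\<And>b. b \<in> B \<Longrightarrow> b \<subseteq> X" "R \<subseteq> X" "\<And>b. b \<in> B \<Longrightarrow> m \<le> card b"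
    using assms(1) by (auto simp: block_family_def)
  have "m * card B = (\<Sum>b\<in>B. m)" by simp
  also have "\<dots> \<le> (\<Sum>b\<in>B. card b)" using fb by (intro sum_mono) auto
  also have "\<dots> = card (\<Union> B)"
    using assms(1) fb finite_subset[OF _ assms(2)]
    by (intro card_Union_disjoint[symmetric]) (auto simp: pairwise_def disjnt_def block_family_def)
  also have "\<dots> \<le> card X" using fb assms(2) by (intro card_mono) auto
  finally have "card B \<le> card X div m"
    using assms(3) by (simp add: less_eq_div_iff_mult_less_eq mult.commute)
  then show "card (insert R B) \<le> card X div m + 1" using fb(1) by (simp add: card_insert_if)
  show "card b \<le> 2 * m" if "b \<in> insert R B" for b
    using assms(1) that by (fastforce simp: block_family_def)
qed

text \<open>A maximum matching \<open>Q\<close> between blocks with two common elements: all elements outside the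
  matched blocks are determined by the pair of blocks containing them.\<close>

lemma block_matching:
  assumes "finite A" "finite B" "\<Union> A = X" "\<Union> B = X" "finite X"
    and M: "\<And>a. a \<in> A \<union> B \<Longrightarrow> card a \<le> M" and K: "card A \<le> K" "card B \<le> K"
  shows "\<exists>Q\<subseteq>A \<times> B. inj_on fst Q \<and> inj_on snd Q \<and> (\<forall>q\<in>Q. card (fst q \<inter> snd q) \<ge> 2) \<and>
    card X \<le> 2 * M * card Q + K * K"
proof -
  define matching where "matching Q \<longleftrightarrow> Q \<subseteq> A \<times> B \<and> inj_on fst Q \<and> inj_on snd Q \<and>
    (\<forall>q\<in>Q. card (fst q \<inter> snd q) \<ge> 2)" for Q
  have fAB: "finite (A \<times> B)" using assms by simp
  have "matching {}" by (simp add: matching_def)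
  moreover have "\<forall>Q. matching Q \<longrightarrow> card Q < Suc (card (A \<times> B))"
    using fAB by (auto simp: matching_def less_Suc_eq_le intro: card_mono)
  ultimately obtain Q where Q: "matching Q" "\<And>Q'. matching Q' \<Longrightarrow> card Q' \<le> card Q"
    using ex_has_greatest_nat[of matching "{}" card "Suc (card (A \<times> B))"] by blast
  have fQ: "finite Q" using Q(1) fAB finite_subset by (auto simp: matching_def)
  have fin: "finite a" if "a \<in> A \<union> B" for a using that assms(3,4,5) by (auto intro: finite_subset)
  define S where "S = {p \<in> A \<times> B. card (fst p \<inter> snd p) \<le> 1}"
  have cov: "X \<subseteq> (\<Union>q\<in>Q. fst q) \<union> (\<Union>q\<in>Q. snd q) \<union> (\<Union>p\<in>S. fst p \<inter> snd p)"
  proof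
    fix x assume "x \<in> X"
    then obtain a b where ab: "a \<in> A" "b \<in> B" "x \<in> a" "x \<in> b" using assms(3,4) by blast
    show "x \<in> (\<Union>q\<in>Q. fst q) \<union> (\<Union>q\<in>Q. snd q) \<union> (\<Union>p\<in>S. fst p \<inter> snd p)"
    proof (rule ccontr)
      assume n: "x \<notin> (\<Union>q\<in>Q. fst q) \<union> (\<Union>q\<in>Q. snd q) \<union> (\<Union>p\<in>S. fst p \<inter> snd p)"
      then have "a \<notin> fst ` Q" "b \<notin> snd ` Q" "(a, b) \<notin> S" using ab by auto
      then have "card (a \<inter> b) \<ge> 2" using ab by (auto simp: S_def)
      then have "matching (insert (a, b) Q)"
        using Q(1) ab \<open>a \<notin> fst ` Q\<close> \<open>b \<notin> snd ` Q\<close>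
        by (auto simp: matching_def inj_on_insert)
      moreover have "(a, b) \<notin> Q" using \<open>a \<notin> fst ` Q\<close> by force
      ultimately show False using Q(2)[of "insert (a, b) Q"] fQ by simp
    qed
  qed
  have fS: "finite S" using fAB by (simp add: S_def)
  have "card (\<Union>q\<in>Q. fst q) \<le> (\<Sum>q\<in>Q. M)"
    using card_UN_le[OF fQ, of fst] Q(1) M
    by (intro order.trans[OF _ sum_mono[of Q "\<lambda>q. card (fst q)" "\<lambda>_. M"]]) (auto simp: matching_def)
  moreover have "card (\<Union>q\<in>Q. snd q) \<le> (\<Sum>q\<in>Q. M)"
    using card_UN_le[OF fQ, of snd] Q(1) M
    by (intro order.trans[OF _ sum_mono[of Q "\<lambda>q. card (snd q)" "\<lambda>_. M"]]) (auto simp: matching_def)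
  moreover have "card (\<Union>p\<in>S. fst p \<inter> snd p) \<le> (\<Sum>p\<in>S. 1)"
    using card_UN_le[OF fS, of "\<lambda>p. fst p \<inter> snd p"]
    by (intro order.trans[OF _ sum_mono[of S "\<lambda>p. card (fst p \<inter> snd p)" "\<lambda>_. 1"]]) (auto simp: S_def)
  moreover have "card S \<le> K * K"
  proof -
    have "card S \<le> card (A \<times> B)" by (rule card_mono[OF fAB]) (auto simp: S_def)
    also have "\<dots> = card A * card B" by (rule card_cartesian_product)
    also have "\<dots> \<le> K * K" using K by (rule mult_le_mono)
    finally show ?thesis .
  qed
  moreover have "card X \<le> card (\<Union>q\<in>Q. fst q) + card (\<Union>q\<in>Q. snd q) + card (\<Union>p\<in>S. fst p \<inter> snd p)"
  proof -
    let ?U = "(\<Union>q\<in>Q. fst q) \<union> (\<Union>q\<in>Q. snd q)" and ?V = "\<Union>p\<in>S. fst p \<inter> snd p"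
    have "finite (\<Union>q\<in>Q. fst q)" "finite (\<Union>q\<in>Q. snd q)" "finite ?V"
      using fQ fS fin Q(1) by (auto simp: matching_def S_def)
    then have "card X \<le> card (?U \<union> ?V)" using cov by (intro card_mono) auto
    also have "\<dots> \<le> card ?U + card ?V" by (rule card_Un_le)
    also have "card ?U \<le> card (\<Union>q\<in>Q. fst q) + card (\<Union>q\<in>Q. snd q)" by (rule card_Un_le)
    finally show ?thesis by simp
  qed
  moreover have "(\<Sum>q\<in>Q. M) + (\<Sum>q\<in>Q. M) = 2 * M * card Q" "(\<Sum>p\<in>S. 1) = card S" by simp_all
  ultimately have "card X \<le> 2 * M * card Q + K * K" by linarith
  then show ?thesis using Q(1) unfolding matching_def by (intro exI[of _ Q]) blast
qed

lemma crosses_mono: "crosses c C \<Longrightarrow> c \<subseteq> d \<Longrightarrow> crosses d C"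
  unfolding crosses_def by blast

lemma disjoint_spans_subsets:
  assumes "disjoint_spans F {} t" "inj_on f Q" "\<And>q. q \<in> Q \<Longrightarrow> f q \<in> F \<and> h q \<subseteq> f q"
  shows "disjoint_spans (h ` Q \<union> (\<lambda>x. {x}) ` Z) {} t"
proof -
  have sing: "\<not> crosses {x} C" for x C by (auto simp: crosses_def)
  have "h q = h q'" if "C \<in> clusters t" "q \<in> Q" "q' \<in> Q" "crosses (h q) C" "crosses (h q') C" for C q q'
  proof -
    have "crosses (f q) C" "crosses (f q') C" using crosses_mono that assms(3) by blast+
    then have "f q = f q'" using assms(1,3) that unfolding disjoint_spans_def by blast
    then show ?thesis using inj_onD[OF assms(2)] that by blast
  qed
  then show ?thesis unfolding disjoint_spans_def using sing by blast
qed

lemma distance_upper: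
  assumes "btree_on n t" "btree_on n u" "n \<ge> 2" "m \<ge> 2"
  shows "\<exists>k q. (tree_class n t, tree_class n u) \<in> class_moves \<chi> {0..n} ^^ k \<and> k + q \<le> n \<and>
    n \<le> 4 * m * q + (n div m + 1) * (n div m + 1)"
proof -
  let ?X = "{1..n}" and ?K = "n div m + 1"
  have blocks: "\<exists>F. finite F \<and> \<Union> F = ?X \<and> (\<forall>a\<in>F. card a \<le> 2 * m) \<and> card F \<le> ?K \<and>
    (\<forall>a\<in>F. \<forall>b\<in>F. a \<noteq> b \<longrightarrow> a \<inter> b = {}) \<and> disjoint_spans F {} v" if v: "btree_on n v" for v
  proof -
    obtain i where i: "itree_on n i" "erase i = v" using btree_on_itree v by blast
    then obtain B R where BR: "block_family m B R ?X" "disjoint_spans B R v"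
      using block_decomposition[OF _ assms(4), of i] by (auto simp: itree_on_def)
    have "finite (insert R B)" "\<Union> (insert R B) = ?X"
      "\<forall>a\<in>insert R B. \<forall>b\<in>insert R B. a \<noteq> b \<longrightarrow> a \<inter> b = {}"
      using BR(1) unfolding block_family_def by auto
    then show ?thesis
      using block_family_card[OF BR(1) _ assms(4)] disjoint_spans_close[OF BR(2)]
      by (intro exI[of _ "insert R B"]) auto
  qed
  obtain A where A: "finite A" "\<Union> A = ?X" "\<forall>a\<in>A. card a \<le> 2 * m" "card A \<le> ?K"
    "\<forall>a\<in>A. \<forall>b\<in>A. a \<noteq> b \<longrightarrow> a \<inter> b = {}" "disjoint_spans A {} t" using blocks[OF assms(1)] by blast
  obtain B where B: "finite B" "\<Union> B = ?X" "\<forall>a\<in>B. card a \<le> 2 * m" "card B \<le> ?K"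
    "\<forall>a\<in>B. \<forall>b\<in>B. a \<noteq> b \<longrightarrow> a \<inter> b = {}" "disjoint_spans B {} u" using blocks[OF assms(2)] by blast
  have "card a \<le> 2 * m" if "a \<in> A \<union> B" for a using A(3) B(3) that by blast
  then obtain Q where Q: "Q \<subseteq> A \<times> B" "inj_on fst Q" "inj_on snd Q" "\<forall>q\<in>Q. card (fst q \<inter> snd q) \<ge> 2"
    "n \<le> 2 * (2 * m) * card Q + ?K * ?K"
    using block_matching[OF A(1) B(1) A(2) B(2) _ _ A(4) B(4), of "2 * m"] by auto
  have fQ: "finite Q" using Q(1) A(1) B(1) finite_subset by blast
  have "\<exists>c. c \<subseteq> fst q \<inter> snd q \<and> card c = 2" if "q \<in> Q" for q
    using Q(4) that by (meson obtain_subset_with_card_n)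
  then obtain h where h: "\<And>q. q \<in> Q \<Longrightarrow> h q \<subseteq> fst q \<inter> snd q" "\<And>q. q \<in> Q \<Longrightarrow> card (h q) = 2"
    by metis
  have hX: "h q \<subseteq> ?X" if "q \<in> Q" for q using h(1)[OF that] Q(1) A(2) that by fastforce
  have hd: "h q \<inter> h q' = {}" if "q \<in> Q" "q' \<in> Q" "q \<noteq> q'" for q q'
  proof -
    have "fst q \<noteq> fst q'" using Q(2) that by (auto dest: inj_onD)
    then have "fst q \<inter> fst q' = {}" using A(5) Q(1) that by (metis mem_Times_iff subsetD)
    then show ?thesis using h(1) that by blast
  qed
  define Z where "Z = ?X - (\<Union>q\<in>Q. h q)"
  define P where "P = h ` Q \<union> (\<lambda>x. {x}) ` Z"
  have cU: "card (\<Union>q\<in>Q. h q) = 2 * card Q"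
  proof -
    have "card (\<Union>q\<in>Q. h q) = (\<Sum>q\<in>Q. card (h q))"
      using fQ hd h(2) by (intro card_UN_disjoint) (auto intro: card_ge_0_finite)
    also have "\<dots> = 2 * card Q" using h(2) by simp
    finally show ?thesis .
  qed
  have Usub: "(\<Union>q\<in>Q. h q) \<subseteq> ?X" using hX by blast
  have "card Z = n - 2 * card Q"
    unfolding Z_def using card_Diff_subset[OF finite_subset[OF Usub] Usub] cU by simp
  moreover have "2 * card Q \<le> n" using card_mono[OF _ Usub] cU by simp
  moreover have "card P \<le> card Q + card Z"
    unfolding P_def
    by (rule order.trans[OF card_Un_le add_mono]) (use fQ in \<open>auto simp: Z_def intro: card_image_le\<close>)
  ultimately have cP: "card P + card Q \<le> n" by simp
  have "\<exists>k\<le>card P. (tree_class n t, tree_class n u) \<in> class_moves \<chi> {0..n} ^^ k"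
  proof (rule components_distance[OF _ assms(1,2,3)])
    show "finite P" using fQ by (simp add: P_def Z_def)
    show "\<Union> P \<union> {} = ?X" unfolding P_def Z_def using Usub by auto
    show "\<exists>a b. d = {a, b}" if "d \<in> P" for d
    proof (cases "d \<in> h ` Q")
      case True
      then have "card d = 2" using h(2) by auto
      then show ?thesis by (meson card_2_iff)
    next
      case False
      then show ?thesis using that by (auto simp: P_def)
    qed
    show "d \<inter> e = {}" if "d \<in> P" "e \<in> P" "d \<noteq> e" for d e
      using that hd unfolding P_def Z_def by blast
    show "disjoint_spans P {} t"
      unfolding P_def by (rule disjoint_spans_subsets[OF A(6) Q(2)]) (use Q(1) h(1) in fastforce)
    show "disjoint_spans P {} u"
      unfolding P_def by (rule disjoint_spans_subsets[OF B(6) Q(3)]) (use Q(1) h(1) in fastforce)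
    have "restrict {} v = None" for v by (simp add: restrict_None)
    then show "restrict {} t = restrict {} u" by simp
  qed auto
  then obtain k where "k \<le> card P" "(tree_class n t, tree_class n u) \<in> class_moves \<chi> {0..n} ^^ k"
    by blast
  then show ?thesis using cP Q(5) by (intro exI[of _ k] exI[of _ "card Q"]) auto
qed

section \<open>Parsimony\<close>

definition bichromatic :: "(nat \<Rightarrow> nat) \<Rightarrow> nat set set \<Rightarrow> nat set set" where
  "bichromatic g E = {e \<in> E. \<exists>u\<in>e. \<exists>v\<in>e. g u \<noteq> g v}"

definition parsimony_le :: "(nat \<Rightarrow> nat) \<Rightarrow> nat set \<Rightarrow> ltree \<Rightarrow> nat \<Rightarrow> bool" where
  "parsimony_le f X T k \<longleftrightarrow>
     (\<exists>g. (\<forall>x\<in>X. g (leaf T x) = f x) \<and> card (bichromatic g (edges (shape T))) \<le> k)"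

lemma bichromatic_edge: "{a, b} \<in> bichromatic g E \<longleftrightarrow> {a, b} \<in> E \<and> g a \<noteq> g b"
  by (auto simp: bichromatic_def)

lemma bichromatic_Un: "bichromatic g (A \<union> B) = bichromatic g A \<union> bichromatic g B"
  by (auto simp: bichromatic_def)

lemma bichromatic_mono: "A \<subseteq> B \<Longrightarrow> bichromatic g A \<subseteq> bichromatic g B"
  by (auto simp: bichromatic_def)

lemma bichromatic_subset: "bichromatic g A \<subseteq> A"
  by (auto simp: bichromatic_def)

lemma bichromatic_single: "bichromatic g {{a, b}} = (if g a = g b then {} else {{a, b}})"
  by (auto simp: bichromatic_def)

lemma finite_bichromatic: "finite A \<Longrightarrow> finite (bichromatic g A)"
  using finite_subset[OF bichromatic_subset] .

lemma bichromatic_cong: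
  assumes "\<And>e v. e \<in> E \<Longrightarrow> v \<in> e \<Longrightarrow> g v = h v"
  shows "bichromatic g E = bichromatic h E"
  using assms unfolding bichromatic_def by (intro Collect_cong) metis

lemma bichromatic_suppress:
  assumes "finite E" "{a, v} \<in> E" "{v, b} \<in> E"
  shows "card (bichromatic g ((E - {{a, v}, {v, b}}) \<union> {{a, b}})) \<le> card (bichromatic g E)"
proof (cases "g a = g b")
  case True
  then have "bichromatic g ((E - {{a, v}, {v, b}}) \<union> {{a, b}}) \<subseteq> bichromatic g E"
    unfolding bichromatic_Un bichromatic_single using bichromatic_mono[of "E - {{a, v}, {v, b}}" E g] by auto
  then show ?thesis using assms(1) by (intro card_mono finite_bichromatic)
next
  case False
  obtain e where e: "e \<in> {{a, v}, {v, b}}" "e \<in> bichromatic g E"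
  proof (cases "g a = g v")
    case True
    then show ?thesis using that[of "{v, b}"] False assms(3) by (simp add: bichromatic_edge)
  next
    case False
    then show ?thesis using that[of "{a, v}"] assms(2) by (simp add: bichromatic_edge)
  qed
  have "bichromatic g ((E - {{a, v}, {v, b}}) \<union> {{a, b}}) \<subseteq> insert {a, b} (bichromatic g E - {e})"
    using e(1) by (auto simp: bichromatic_def)
  then have "card (bichromatic g ((E - {{a, v}, {v, b}}) \<union> {{a, b}})) \<le> card (insert {a, b} (bichromatic g E - {e}))"
    using assms by (intro card_mono) (auto simp: finite_bichromatic)
  also have "\<dots> \<le> Suc (card (bichromatic g E - {e}))"
    using assms by (simp add: card_insert_if finite_bichromatic)
  also have "\<dots> = card (bichromatic g E)"
    using e(2) assms by (intro card_Suc_Diff1) (auto simp: finite_bichromatic)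
  finally show ?thesis .
qed

lemma bichromatic_suppress_steps:
  assumes "suppress_step\<^sup>*\<^sup>* G H" "finite (edges G)"
  shows "finite (edges H) \<and> card (bichromatic g (edges H)) \<le> card (bichromatic g (edges G))"
  using assms
proof (induction rule: rtranclp_induct)
  case (step H K)
  then obtain v a b where vab: "{e \<in> edges H. v \<in> e} = {{a, v}, {v, b}}"
    "K = \<lparr>verts = verts H - {v}, edges = (edges H - {{a, v}, {v, b}}) \<union> {{a, b}}\<rparr>"
    unfolding suppress_step_def by blast
  then have "{a, v} \<in> edges H" "{v, b} \<in> edges H" by blast+
  then have "card (bichromatic g (edges K)) \<le> card (bichromatic g (edges H))"
    using bichromatic_suppress step vab(2) by simp
  then show ?case using step vab(2) by simp
qed simp

lemma tree_edges:
  assumes "is_tree T"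
  shows "\<And>e. e \<in> edges T \<Longrightarrow> e \<subseteq> verts T" "finite (edges T)"
    "\<And>a b. {a, b} \<in> edges T \<Longrightarrow> a \<noteq> b" "\<And>e. e \<in> edges T \<Longrightarrow> e \<noteq> {}"
proof -
  have wf: "finite (verts T)" "\<And>e. e \<in> edges T \<Longrightarrow> \<exists>u v. u \<in> verts T \<and> v \<in> verts T \<and> u \<noteq> v \<and> e = {u, v}"
    using assms unfolding is_tree_def ugraph_wf_def by blast+
  show sub: "e \<subseteq> verts T" if "e \<in> edges T" for e using wf(2)[OF that] by auto
  show "finite (edges T)" by (rule finite_subset[of _ "Pow (verts T)"]) (use sub wf(1) in auto)
  show "a \<noteq> b" if "{a, b} \<in> edges T" for a b using wf(2)[OF that] by (auto simp: doubleton_eq_iff)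
  show "e \<noteq> {}" if "e \<in> edges T" for e using wf(2)[OF that] by auto
qed

lemma attach_colour:
  assumes "is_tree T" "attach T p H"
  obtains c where "card (bichromatic (g(p := c)) (edges H)) \<le> card (bichromatic g (edges T))"
    "p \<in> verts H" "\<And>e. e \<in> edges H \<Longrightarrow> e \<subseteq> verts H" "finite (edges H)"
    "c = g p \<or> (\<exists>a b. a \<noteq> b \<and> {a, p} \<in> edges H \<and> {p, b} \<in> edges H)"
proof -
  note te = tree_edges[OF assms(1)]
  from assms(2) consider "verts T = {p}" "H = T" | a b where "{a, b} \<in> edges T" "p \<notin> verts T"
    "H = \<lparr>verts = insert p (verts T), edges = (edges T - {{a, b}}) \<union> {{a, p}, {p, b}}\<rparr>"
    unfolding attach_def by blast
  then show ?thesis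
  proof cases
    case 1
    then show ?thesis using that[of "g p"] te by auto
  next
    case 2
    have abv: "a \<in> verts T" "b \<in> verts T" using te(1)[OF 2(1)] by auto
    have ne: "a \<noteq> b" "a \<noteq> p" "b \<noteq> p" using te(3)[OF 2(1)] abv 2(2) by auto
    let ?g = "g(p := g a)"
    have E: "bichromatic ?g (edges T - {{a, b}}) = bichromatic g (edges T - {{a, b}})"
      by (rule bichromatic_cong) (use te(1) 2(2) in auto)
    have "bichromatic ?g (edges H) \<subseteq> bichromatic g (edges T - {{a, b}}) \<union> bichromatic ?g {{p, b}}"
    proof -
      have "edges H = (edges T - {{a, b}}) \<union> {{a, p}} \<union> {{p, b}}" by (simp add: 2(3) insert_commute)
      moreover have "bichromatic ?g {{a, p}} = {}" using ne by (simp add: bichromatic_single)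
      ultimately show ?thesis using E by (simp only: bichromatic_Un Un_empty_right)
    qed
    then have "card (bichromatic ?g (edges H)) \<le> card (bichromatic g (edges T - {{a, b}}) \<union> bichromatic ?g {{p, b}})"
      using te(2) by (intro card_mono) (auto simp: finite_bichromatic)
    also have "\<dots> \<le> card (bichromatic g (edges T - {{a, b}})) + card (bichromatic ?g {{p, b}})"
      by (rule card_Un_le)
    also have "\<dots> \<le> card (bichromatic g (edges T - {{a, b}})) + card (bichromatic g {{a, b}})"
      using ne by (simp add: bichromatic_single)
    also have "\<dots> = card (bichromatic g (edges T - {{a, b}}) \<union> bichromatic g {{a, b}})"
      using te(2) by (intro card_Un_disjoint[symmetric]) (auto simp: finite_bichromatic bichromatic_def)
    also have "\<dots> = card (bichromatic g (edges T))"
      unfolding bichromatic_Un[symmetric] using 2(1) by (simp add: insert_absorb)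
    finally have "card (bichromatic ?g (edges H)) \<le> card (bichromatic g (edges T))" .
    moreover have "\<exists>a b. a \<noteq> b \<and> {a, p} \<in> edges H \<and> {p, b} \<in> edges H"
      using ne(1) 2(3) by (intro exI[of _ a] exI[of _ b]) simp
    moreover have "e \<subseteq> verts H" if "e \<in> edges H" for e using that te(1) abv 2(3) by auto
    ultimately show ?thesis using that[of "g a"] 2(3) te(2) by simp
  qed
qed

lemma leaf_degree:
  assumes "binary_ltree X T" "card X \<noteq> 1" "x \<in> X"
  shows "card (incident (edges (shape T)) (leaf T x)) = 1"
  using assms by (auto simp: binary_ltree_def bij_betw_def vdegree_incident[symmetric])

lemma not_leaf:
  assumes "binary_ltree X T" "card X \<noteq> 1" "x \<in> X" "a \<noteq> b"
    "{a, p} \<in> edges (shape T)" "{p, b} \<in> edges (shape T)"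
  shows "leaf T x \<noteq> p"
proof
  assume "leaf T x = p"
  then obtain e where "incident (edges (shape T)) p = {e}"
    using leaf_degree[OF assms(1-3)] by (auto simp: card_1_singleton_iff)
  moreover have "{a, p} \<in> incident (edges (shape T)) p" "{p, b} \<in> incident (edges (shape T)) p"
    using assms(5,6) by (simp_all add: incident_def)
  ultimately have "{a, p} = e" "{p, b} = e" by simp_all
  then show False using assms(4) by (metis doubleton_eq_iff)
qed

lemma parsimony_tbr:
  assumes "binary_ltree X S" "binary_ltree X T" "card X \<noteq> 1" "move TBR X S T" "parsimony_le f X S k"
  shows "parsimony_le f X T (k + 1)"
proof -
  obtain g where g: "\<And>x. x \<in> X \<Longrightarrow> g (leaf S x) = f x" "card (bichromatic g (edges (shape S))) \<le> k"
    using assms(5) unfolding parsimony_le_def by blast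
  have leaf: "leaf T = leaf S" and "tbr_graph (shape S) (shape T)" using assms(4) by auto
  then obtain e H T1 T2 p q H1 H2 where
    sup: "suppress_all (delete_edge e (shape S)) H"
    and tr: "is_tree T1" "is_tree T2" and dj: "verts T1 \<inter> verts T2 = {}"
    and H: "H = \<lparr>verts = verts T1 \<union> verts T2, edges = edges T1 \<union> edges T2\<rparr>"
    and at: "attach T1 p H1" "attach T2 q H2" and dj': "verts H1 \<inter> verts H2 = {}"
    and G': "shape T = \<lparr>verts = verts H1 \<union> verts H2, edges = edges H1 \<union> edges H2 \<union> {{p, q}}\<rparr>"
    unfolding tbr_graph_def by blast
  have fS: "finite (edges (shape S))" using assms(1) tree_edges(2) by (auto simp: binary_ltree_def)
  obtain c where c: "card (bichromatic (g(p := c)) (edges H1)) \<le> card (bichromatic g (edges T1))"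
    "p \<in> verts H1" "\<And>e. e \<in> edges H1 \<Longrightarrow> e \<subseteq> verts H1" "finite (edges H1)"
    "c = g p \<or> (\<exists>a b. a \<noteq> b \<and> {a, p} \<in> edges H1 \<and> {p, b} \<in> edges H1)"
    using attach_colour[OF tr(1) at(1), of g] by metis
  obtain d where d: "card (bichromatic (g(q := d)) (edges H2)) \<le> card (bichromatic g (edges T2))"
    "q \<in> verts H2" "\<And>e. e \<in> edges H2 \<Longrightarrow> e \<subseteq> verts H2" "finite (edges H2)"
    "d = g q \<or> (\<exists>a b. a \<noteq> b \<and> {a, q} \<in> edges H2 \<and> {q, b} \<in> edges H2)"
    using attach_colour[OF tr(2) at(2), of g] by metis
  have pq: "p \<noteq> q" using c(2) d(2) dj' by auto
  define h where "h = g(p := c, q := d)"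
  have b1: "bichromatic h (edges H1) = bichromatic (g(p := c)) (edges H1)"
    by (rule bichromatic_cong) (use c(3) d(2) dj' in \<open>auto simp: h_def\<close>)
  have b2: "bichromatic h (edges H2) = bichromatic (g(q := d)) (edges H2)"
    by (rule bichromatic_cong) (use d(3) c(2) dj' pq in \<open>auto simp: h_def\<close>)
  have "card (bichromatic h (edges (shape T))) \<le>
      card (bichromatic h (edges H1) \<union> bichromatic h (edges H2)) + card (bichromatic h {{p, q}})"
    unfolding G' by (simp add: bichromatic_Un[symmetric] card_Un_le flip: insert_is_Un)
      (metis Un_insert_right bichromatic_Un card_Un_le sup_bot.right_neutral)
  also have "\<dots> \<le> card (bichromatic h (edges H1)) + card (bichromatic h (edges H2)) + 1"
    using card_Un_le[of "bichromatic h (edges H1)" "bichromatic h (edges H2)"]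
    by (simp add: bichromatic_single)
  also have "\<dots> \<le> card (bichromatic g (edges T1)) + card (bichromatic g (edges T2)) + 1"
    using b1 b2 c(1) d(1) by simp
  also have "\<dots> = card (bichromatic g (edges T1) \<union> bichromatic g (edges T2)) + 1"
  proof -
    have "edges T1 \<inter> edges T2 = {}"
      using tree_edges(1,4)[OF tr(1)] tree_edges(1)[OF tr(2)] dj by blast
    then have "bichromatic g (edges T1) \<inter> bichromatic g (edges T2) = {}"
      using bichromatic_subset by blast
    then show ?thesis
      using tree_edges(2)[OF tr(1)] tree_edges(2)[OF tr(2)] by (simp add: card_Un_disjoint finite_bichromatic)
  qed
  also have "\<dots> = card (bichromatic g (edges H)) + 1" unfolding H by (simp add: bichromatic_Un)
  also have "\<dots> \<le> card (bichromatic g (edges (delete_edge e (shape S)))) + 1"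
    using bichromatic_suppress_steps[of "delete_edge e (shape S)" H g] sup fS
    by (simp add: suppress_all_def delete_edge_def)
  also have "\<dots> \<le> card (bichromatic g (edges (shape S))) + 1"
    using fS by (auto simp: delete_edge_def finite_bichromatic intro!: card_mono bichromatic_mono)
  finally have "card (bichromatic h (edges (shape T))) \<le> k + 1" using g(2) by simp
  moreover have "h (leaf T x) = f x" if x: "x \<in> X" for x
  proof -
    have "leaf T x \<noteq> p \<or> c = g p"
      using c(5) not_leaf[OF assms(2,3) x, of _ _ p] G' by auto
    moreover have "leaf T x \<noteq> q \<or> d = g q"
      using d(5) not_leaf[OF assms(2,3) x, of _ _ q] G' by auto
    ultimately show ?thesis using g(1)[OF x] leaf pq by (auto simp: h_def)
  qed
  ultimately show ?thesis unfolding parsimony_le_def by blast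
qed

lemma parsimony_spr:
  assumes "binary_ltree X S" "binary_ltree X T" "card X \<noteq> 1" "leaf T = leaf S"
    "spr_graph x y a b c d (shape S) (shape T)" "parsimony_le f X S k"
  shows "parsimony_le f X T (k + 1)"
proof -
  let ?E = "edges (shape S)"
  obtain g where g: "\<And>z. z \<in> X \<Longrightarrow> g (leaf S z) = f z" "card (bichromatic g ?E) \<le> k"
    using assms(6) unfolding parsimony_le_def by blast
  have tree: "is_tree (shape S)" using assms(1) by (simp add: binary_ltree_def)
  note te = tree_edges[OF tree]
  have E: "{x, y} \<in> ?E" "{a, x} \<in> ?E" "{x, b} \<in> ?E" "{c, d} \<in> ?E"
    and di: "distinct [{x, y}, {a, x}, {x, b}, {c, d}]"
    and G': "edges (shape T) = (((?E - {{a, x}, {x, b}}) \<union> {{a, b}}) - {{c, d}}) \<union> {{c, x}, {x, d}}"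
    using assms(5) by (auto simp: spr_graph_def)
  have inc: "incident ?E x = {{x, y}, {a, x}, {x, b}}"
  proof -
    have sub: "{{x, y}, {a, x}, {x, b}} \<subseteq> incident ?E x" using E by (auto simp: incident_def)
    have "x \<in> verts (shape S)" using te(1)[OF E(1)] by simp
    then have "card (incident ?E x) \<in> {1, 3}"
      using assms(1,3) by (auto simp: binary_ltree_def vdegree_incident)
    moreover have c3: "card {{x, y}, {a, x}, {x, b}} = 3" using di by simp
    moreover have fin: "finite (incident ?E x)" using te(2) by (simp add: incident_def)
    ultimately have "card (incident ?E x) = 3" using card_mono[OF fin sub] by auto
    then show ?thesis using card_subset_eq[OF fin sub] c3 by simp
  qed
  have ne: "a \<noteq> x" "b \<noteq> x" "a \<noteq> b" using te(3)[OF E(2)] te(3)[OF E(3)] di by auto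
  have neq: "{x, y} \<noteq> {c, d}" "{a, x} \<noteq> {c, d}" "{x, b} \<noteq> {c, d}" using di by simp_all
  then have "{c, d} \<notin> incident ?E x" unfolding inc by blast
  then have cd: "c \<noteq> x" "d \<noteq> x" using E(4) by (auto simp: incident_def)
  define E1 where "E1 = (?E - {{a, x}, {x, b}}) \<union> {{a, b}}"
  define E2 where "E2 = E1 - {{x, y}, {c, d}}"
  have xE2: "x \<notin> e" if "e \<in> E2" for e
  proof
    assume "x \<in> e"
    then have "e \<noteq> {a, b}" using ne by auto
    then have "e \<in> incident ?E x" "e \<notin> {{a, x}, {x, b}}" "e \<noteq> {x, y}"
      using that \<open>x \<in> e\<close> unfolding E2_def E1_def incident_def by blast+
    then show False unfolding inc by blast
  qed
  have cdE1: "{c, d} \<in> E1" using E(4) neq unfolding E1_def by blast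
  have fE1: "finite E1" using te(2) by (simp add: E1_def)
  let ?h = "g(x := g c)"
  have E': "edges (shape T) \<subseteq> E2 \<union> {{c, x}, {x, d}, {x, y}}" unfolding G' E2_def E1_def by auto
  have "bichromatic ?h (edges (shape T)) \<subseteq> bichromatic g E2 \<union> bichromatic ?h {{x, d}} \<union> {{x, y}}"
  proof -
    have "bichromatic ?h E2 = bichromatic g E2" by (rule bichromatic_cong) (use xE2 in auto)
    moreover have "bichromatic ?h {{c, x}} = {}" by (simp add: bichromatic_single)
    moreover have "bichromatic ?h (edges (shape T)) \<subseteq>
      bichromatic ?h (E2 \<union> {{c, x}} \<union> {{x, d}} \<union> {{x, y}})"
      using E' by (intro bichromatic_mono) auto
    ultimately show ?thesis using bichromatic_subset[of ?h "{{x, y}}"] unfolding bichromatic_Un by blast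
  qed
  then have "card (bichromatic ?h (edges (shape T))) \<le>
      card (bichromatic g E2 \<union> bichromatic ?h {{x, d}} \<union> {{x, y}})"
    using fE1 by (intro card_mono) (auto simp: finite_bichromatic E2_def)
  also have "\<dots> \<le> card (bichromatic g E2 \<union> bichromatic ?h {{x, d}}) + 1"
    by (rule order.trans[OF card_Un_le]) simp
  also have "\<dots> \<le> card (bichromatic g E2) + card (bichromatic ?h {{x, d}}) + 1"
    using card_Un_le by simp
  also have "\<dots> = card (bichromatic g E2) + card (bichromatic g {{c, d}}) + 1"
    using cd by (simp add: bichromatic_single)
  also have "\<dots> = card (bichromatic g E2 \<union> bichromatic g {{c, d}}) + 1"
    using fE1 by (subst card_Un_disjoint) (auto simp: finite_bichromatic E2_def bichromatic_def)
  also have "\<dots> \<le> card (bichromatic g E1) + 1"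
    using fE1 cdE1 by (auto simp: bichromatic_Un[symmetric] finite_bichromatic E2_def
      simp del: Un_insert_right intro!: card_mono bichromatic_mono)
  also have "\<dots> \<le> card (bichromatic g ?E) + 1"
    using bichromatic_suppress[OF te(2) E(2,3), of g] by (simp add: E1_def)
  finally have "card (bichromatic ?h (edges (shape T))) \<le> k + 1" using g(2) by simp
  moreover have "?h (leaf T z) = f z" if "z \<in> X" for z
    using not_leaf[OF assms(1,3) that ne(3) E(2,3)] g(1)[OF that] assms(4) by simp
  ultimately show ?thesis unfolding parsimony_le_def by blast
qed

lemma parsimony_move:
  assumes "binary_ltree X S" "binary_ltree X T" "card X \<noteq> 1" "move \<chi> X S T" "parsimony_le f X S k"
  shows "parsimony_le f X T (k + 1)"
proof (cases \<chi>)
  case TBR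
  then show ?thesis using parsimony_tbr assms by blast
next
  case SPR
  then obtain x y a b c d where "leaf T = leaf S" "spr_graph x y a b c d (shape S) (shape T)"
    using assms(4) by auto
  then show ?thesis using parsimony_spr[OF assms(1-3) _ _ assms(5)] by blast
next
  case rSPR
  then obtain x y a b c d where "leaf T = leaf S" "spr_graph x y a b c d (shape S) (shape T)"
    using assms(4) by auto
  then show ?thesis using parsimony_spr[OF assms(1-3) _ _ assms(5)] by blast
qed

lemma parsimony_iso:
  assumes "(S, T) \<in> ltree_iso X" "card X \<noteq> 1" "parsimony_le f X S k"
  shows "parsimony_le f X T k"
proof -
  obtain \<phi> where b: "binary_ltree X S" and bij: "bij_betw \<phi> (verts (shape S)) (verts (shape T))"
    and e: "edges (shape T) = (\<lambda>e. \<phi> ` e) ` edges (shape S)"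
    and l: "\<forall>x\<in>X. \<phi> (leaf S x) = leaf T x"
    using assms(1) by (auto simp: ltree_iso_def)
  obtain g where g: "\<And>x. x \<in> X \<Longrightarrow> g (leaf S x) = f x" "card (bichromatic g (edges (shape S))) \<le> k"
    using assms(3) unfolding parsimony_le_def by blast
  have tree: "is_tree (shape S)" using b by (simp add: binary_ltree_def)
  define h where "h v = g (inv_into (verts (shape S)) \<phi> v)" for v
  have h: "h (\<phi> v) = g v" if "v \<in> verts (shape S)" for v
    using bij_betw_inv_into_left[OF bij that] by (simp add: h_def)
  have "bichromatic h (edges (shape T)) \<subseteq> (\<lambda>e. \<phi> ` e) ` bichromatic g (edges (shape S))"
  proof
    fix e' assume "e' \<in> bichromatic h (edges (shape T))"
    then obtain e0 u v where e0: "e0 \<in> edges (shape S)" "e' = \<phi> ` e0" "u \<in> e0" "v \<in> e0" "h (\<phi> u) \<noteq> h (\<phi> v)"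
      unfolding e bichromatic_def by blast
    then have "g u \<noteq> g v" using h tree_edges(1)[OF tree e0(1)] by (metis subsetD)
    then show "e' \<in> (\<lambda>e. \<phi> ` e) ` bichromatic g (edges (shape S))"
      using e0 unfolding bichromatic_def by blast
  qed
  then have "card (bichromatic h (edges (shape T))) \<le> k"
    using g(2) surj_card_le[OF finite_bichromatic[OF tree_edges(2)[OF tree], of g]] by fastforce
  moreover have "h (leaf T x) = f x" if "x \<in> X" for x
  proof -
    have "leaf S x \<in> verts (shape S)"
      using b assms(2) that by (auto simp: binary_ltree_def bij_betw_def)
    then show ?thesis using h l g(1) that by metis
  qed
  ultimately show ?thesis unfolding parsimony_le_def by blast
qed

lemma BTrees_iso:
  assumes "A \<in> BTrees X" "S \<in> A" "T \<in> A"
  shows "(S, T) \<in> ltree_iso X" "binary_ltree X S"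
proof -
  have A: "A \<in> {T. binary_ltree X T} // ltree_iso X" using assms(1) by (simp add: BTrees_def)
  show "(S, T) \<in> ltree_iso X"
    using quotient_eqI[OF equiv_ltree_iso A A assms(2,3)] in_quotient_imp_in_rel[OF equiv_ltree_iso A] assms by blast
  then show "binary_ltree X S" by (simp add: ltree_iso_def)
qed

lemma parsimony_moves:
  assumes "(A, B) \<in> class_moves \<chi> X ^^ j" "A \<in> BTrees X" "card X \<noteq> 1" "S \<in> A" "parsimony_le f X S k" "T \<in> B"
  shows "parsimony_le f X T (k + j)"
  using assms
proof (induction j arbitrary: B T)
  case 0
  then have "(S, T) \<in> ltree_iso X" using BTrees_iso by auto
  then show ?case using parsimony_iso 0 by auto
next
  case (Suc j)
  then obtain C where C: "(A, C) \<in> class_moves \<chi> X ^^ j" "(C, B) \<in> class_moves \<chi> X" by auto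
  then obtain U V where UV: "C \<in> BTrees X" "B \<in> BTrees X" "U \<in> C" "V \<in> B" "move \<chi> X U V"
    by (auto simp: class_moves_def)
  have "parsimony_le f X U (k + j)" using Suc.IH[OF C(1) _ _ _ _ UV(3)] Suc.prems by blast
  then have "parsimony_le f X V (k + j + 1)"
    using parsimony_move[OF _ _ Suc.prems(3) UV(5)] BTrees_iso(2)[OF UV(1,3,3)] BTrees_iso(2)[OF UV(2,4,4)]
    by blast
  then show ?case
    using parsimony_iso[OF BTrees_iso(1)[OF UV(2,4) Suc.prems(6)] Suc.prems(3)] by simp
qed

section \<open>The lower bound\<close>

lemma planted_edges_meet: "e \<in> planted_edges p t \<Longrightarrow> e \<inter> set (nodes t) \<noteq> {}"
  by (induction t arbitrary: p) auto

lemma card_bichromatic_planted: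
  assumes "distinct (p # nodes t)"
  shows "card (bichromatic g (planted_edges p t)) = breaks g p t"
  using assms
proof (induction t arbitrary: p)
  case (ITip v)
  then show ?case by (simp add: bichromatic_single)
next
  case (IFork x l r)
  let ?L = "planted_edges x l" and ?R = "planted_edges x r"
  have px: "{p, x} \<notin> ?L \<union> ?R"
    using planted_edges_meet[of "{p, x}" x l] planted_edges_meet[of "{p, x}" x r] IFork.prems by auto
  have LR: "?L \<inter> ?R = {}"
  proof (rule ccontr)
    assume "?L \<inter> ?R \<noteq> {}"
    then obtain e where e: "e \<in> ?L" "e \<in> ?R" by blast
    have "e \<inter> set (nodes l) \<noteq> {}" "e \<subseteq> insert x (set (nodes r))"
      using planted_edges_meet[OF e(1)] planted_edges_subset[OF e(2)] by auto
    then show False using IFork.prems by auto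
  qed
  have fin: "finite (bichromatic g E)" if "E \<in> {?L, ?R, {{p, x}}}" for E
    using that by (auto intro!: finite_bichromatic)
  have "bichromatic g (planted_edges p (IFork x l r)) =
    bichromatic g {{p, x}} \<union> (bichromatic g ?L \<union> bichromatic g ?R)"
    by (auto simp: bichromatic_def)
  moreover have "card (bichromatic g {{p, x}} \<union> (bichromatic g ?L \<union> bichromatic g ?R)) =
    card (bichromatic g {{p, x}}) + card (bichromatic g ?L \<union> bichromatic g ?R)"
  proof (rule card_Un_disjoint)
    show "bichromatic g {{p, x}} \<inter> (bichromatic g ?L \<union> bichromatic g ?R) = {}"
      using px bichromatic_subset[of g ?L] bichromatic_subset[of g ?R] bichromatic_subset[of g "{{p, x}}"]
      by blast
  qed (use fin in simp_all)
  moreover have "card (bichromatic g ?L \<union> bichromatic g ?R) =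
    card (bichromatic g ?L) + card (bichromatic g ?R)"
  proof (rule card_Un_disjoint)
    show "bichromatic g ?L \<inter> bichromatic g ?R = {}"
      using LR bichromatic_subset[of g ?L] bichromatic_subset[of g ?R] by blast
  qed (use fin in simp_all)
  ultimately show ?case using IFork by (simp add: bichromatic_single)
qed

fun inner_breaks :: "(nat \<Rightarrow> nat) \<Rightarrow> itree \<Rightarrow> nat" where
  "inner_breaks g (ITip v) = 0"
| "inner_breaks g (IFork x l r) = of_bool (g x \<noteq> g (top_node l)) + inner_breaks g l +
     of_bool (g x \<noteq> g (top_node r)) + inner_breaks g r"

lemma breaks_inner: "breaks g p t = of_bool (g p \<noteq> g (top_node t)) + inner_breaks g t"
  by (induction t arbitrary: p) auto

lemma inner_breaks_cong: "(\<And>v. v \<in> set (nodes t) \<Longrightarrow> g v = h v) \<Longrightarrow> inner_breaks g t = inner_breaks h t"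
  by (induction t) auto

inductive colouring_cost :: "(nat \<Rightarrow> nat) \<Rightarrow> btree \<Rightarrow> nat \<Rightarrow> nat \<Rightarrow> bool" for f where
  "colouring_cost f (Tip v) (f v) 0"
| "colouring_cost f l c k \<Longrightarrow> colouring_cost f r d k' \<Longrightarrow>
     colouring_cost f (Fork l r) c (k + k' + of_bool (c \<noteq> d))"

lemma colouring_cost_realized:
  assumes "colouring_cost f b c k" "erase t = b" "distinct (nodes t)"
  shows "\<exists>g. (\<forall>x\<in>set (tips b). g x = f x) \<and> g (top_node t) = c \<and> inner_breaks g t = k"
  using assms
proof (induction arbitrary: t rule: colouring_cost.induct)
  case (1 v)
  then show ?case by (cases t) (auto intro!: exI[of _ f])
next
  case (2 l c k r d k')
  then obtain x tl tr where t: "t = IFork x tl tr" "erase tl = l" "erase tr = r" by (cases t) auto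
  obtain g1 where g1: "\<forall>x\<in>set (tips l). g1 x = f x" "g1 (top_node tl) = c" "inner_breaks g1 tl = k"
    using "2.IH"(1)[OF t(2)] "2.prems" t(1) by auto
  obtain g2 where g2: "\<forall>x\<in>set (tips r). g2 x = f x" "g2 (top_node tr) = d" "inner_breaks g2 tr = k'"
    using "2.IH"(2)[OF t(3)] "2.prems" t(1) by auto
  define g where "g v = (if v = x then c else if v \<in> set (nodes tl) then g1 v else g2 v)" for v
  have disj: "x \<notin> set (nodes tl)" "x \<notin> set (nodes tr)" "set (nodes tl) \<inter> set (nodes tr) = {}"
    using 2(6) t by auto
  have gl: "g v = g1 v" if "v \<in> set (nodes tl)" for v using that disj by (auto simp: g_def)
  have gr: "g v = g2 v" if "v \<in> set (nodes tr)" for v using that disj by (auto simp: g_def)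
  have gx: "g x = c" by (simp add: g_def)
  have "inner_breaks g tl = k" "inner_breaks g tr = k'"
    using inner_breaks_cong[of tl g g1] inner_breaks_cong[of tr g g2] gl gr g1(3) g2(3) by auto
  then have "inner_breaks g t = k + k' + of_bool (c \<noteq> d)"
    using t gx gl[of "top_node tl"] gr[of "top_node tr"] g1(2) g2(2) by simp
  moreover have "g y = f y" if "y \<in> set (tips (Fork l r))" for y
    using that gl gr g1(1) g2(1) tips_erase_subset_nodes[of tl] tips_erase_subset_nodes[of tr] t by auto
  ultimately show ?case using gx t by (intro exI[of _ g]) auto
qed

lemma monochromatic_tree:
  assumes "finite X" "X \<noteq> {}" "\<And>x. x \<in> X \<Longrightarrow> f x = c"
  shows "\<exists>b. distinct (tips b) \<and> set (tips b) = X \<and> colouring_cost f b c 0"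
  using assms
proof (induction rule: finite_ne_induct)
  case (singleton x)
  then show ?case using colouring_cost.intros(1)[of f x] by (intro exI[of _ "Tip x"]) auto
next
  case (insert x X)
  then obtain b where b: "distinct (tips b)" "set (tips b) = X" "colouring_cost f b c 0" by auto
  have "colouring_cost f (Fork b (Tip x)) c 0"
    using colouring_cost.intros(2)[OF b(3) colouring_cost.intros(1)[of f x]] insert.prems by simp
  then show ?case using b insert.hyps by (intro exI[of _ "Fork b (Tip x)"]) auto
qed

lemma cheap_tree_exists:
  assumes "finite X" "X \<noteq> {}"
  shows "\<exists>b c k. distinct (tips b) \<and> set (tips b) = X \<and> colouring_cost f b c k \<and> k < card (f ` X)"
  using assms
proof (induction "card (f ` X)" arbitrary: X rule: less_induct)
  case less
  then obtain x where x: "x \<in> X" by blast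
  define Y Z where "Y = {y \<in> X. f y = f x}" and "Z = {y \<in> X. f y \<noteq> f x}"
  have X: "X = Y \<union> Z" "Y \<inter> Z = {}" "finite Y" "finite Z" "x \<in> Y"
    using less.prems x by (auto simp: Y_def Z_def)
  obtain b where b: "distinct (tips b)" "set (tips b) = Y" "colouring_cost f b (f x) 0"
  proof -
    have "Y \<noteq> {}" "\<And>y. y \<in> Y \<Longrightarrow> f y = f x" using X(5) by (auto simp: Y_def)
    then show ?thesis using monochromatic_tree[of Y f "f x"] X(3) that by blast
  qed
  have c: "card (f ` X) = Suc (card (f ` Z))"
  proof -
    have "f ` X = insert (f x) (f ` Z)" "f x \<notin> f ` Z" using x by (auto simp: Z_def)
    then show ?thesis using X(4) by simp
  qed
  show ?case
  proof (cases "Z = {}")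
    case True
    then show ?thesis using b X c by (intro exI[of _ b] exI[of _ "f x"] exI[of _ 0]) auto
  next
    case False
    then obtain b' d k where b': "distinct (tips b')" "set (tips b') = Z" "colouring_cost f b' d k"
      "k < card (f ` Z)" using less.hyps[of Z] c X by auto
    have "colouring_cost f (Fork b b') (f x) (0 + k + of_bool (f x \<noteq> d))"
      by (rule colouring_cost.intros(2)[OF b(3) b'(3)])
    moreover have "0 + k + of_bool (f x \<noteq> d) < card (f ` X)" using b'(4) c by simp
    moreover have "distinct (tips (Fork b b'))" "set (tips (Fork b b')) = X" using b b' X by auto
    ultimately show ?thesis by blast
  qed
qed

lemma cheap_tree_parsimony:
  assumes "n \<ge> 1"
  shows "\<exists>t. itree_on n t \<and> parsimony_le f {0..n} (ltree_of t) (card (f ` {1..n}))"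
proof -
  obtain b c k where b: "distinct (tips b)" "set (tips b) = {1..n}" "colouring_cost f b c k"
    "k < card (f ` {1..n})"
    using cheap_tree_exists[of "{1..n}" f] assms by auto
  then obtain t where t: "itree_on n t" "erase t = b" using btree_on_itree[of n b] by (auto simp: btree_on_def)
  have d: "distinct (0 # nodes t)" using t(1) by (simp add: itree_on_def)
  obtain g where g: "\<forall>x\<in>set (tips b). g x = f x" "inner_breaks g t = k"
    using colouring_cost_realized[OF b(3) t(2)] d by auto
  define h where "h = g(0 := f 0)"
  have "inner_breaks h t = k"
    unfolding g(2)[symmetric] by (rule inner_breaks_cong) (use d in \<open>auto simp: h_def\<close>)
  then have "breaks h 0 t \<le> card (f ` {1..n})" using b(4) by (simp add: breaks_inner)
  then have "card (bichromatic h (planted_edges 0 t)) \<le> card (f ` {1..n})"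
    using card_bichromatic_planted[OF d] by simp
  moreover have "\<forall>x\<in>{0..n}. h x = f x" using g(1) b(2) by (auto simp: h_def)
  ultimately have "parsimony_le f {0..n} (ltree_of t) (card (f ` {1..n}))"
    unfolding parsimony_le_def ltree_of_def planted_def by auto
  then show ?thesis using t(1) by blast
qed

lemma block_colouring:
  assumes "block_family m B R X" "finite X" "m \<ge> 2"
  obtains f :: "nat \<Rightarrow> nat" where "\<And>b. b \<in> insert R B \<Longrightarrow> inj_on f b" "\<And>x. x \<in> X \<Longrightarrow> f x < 2 * m"
proof -
  have U: "\<Union> (insert R B) = X"
    and pd: "\<forall>b\<in>insert R B. \<forall>b'\<in>insert R B. b \<noteq> b' \<longrightarrow> b \<inter> b' = {}"
    using assms(1) unfolding block_family_def by simp_all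
  have fb: "finite b" if "b \<in> insert R B" for b using U that assms(2) by (meson Union_upper finite_subset)
  have "\<exists>h. bij_betw h b {0..<card b}" if "b \<in> insert R B" for b
    using ex_bij_betw_finite_nat[OF fb[OF that]] .
  then obtain H where H: "\<And>b. b \<in> insert R B \<Longrightarrow> bij_betw (H b) b {0..<card b}" by metis
  have "\<exists>b. b \<in> insert R B \<and> x \<in> b" if "x \<in> X" for x using U that by blast
  then obtain blk where blk: "\<And>x. x \<in> X \<Longrightarrow> blk x \<in> insert R B \<and> x \<in> blk x" by metis
  have blk_eq: "blk x = b" if "b \<in> insert R B" "x \<in> b" for b x
  proof -
    have "x \<in> X" using U that by blast
    then show ?thesis using blk[of x] pd that by blast
  qed
  define f where "f x = H (blk x) x" for x
  show ?thesis
  proof (rule that[of f])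
    show "inj_on f b" if b: "b \<in> insert R B" for b
    proof -
      have "f x = H b x" if "x \<in> b" for x using blk_eq[OF b that] by (simp add: f_def)
      then show ?thesis using H[OF b] unfolding bij_betw_def by (metis inj_on_cong)
    qed
    show "f x < 2 * m" if "x \<in> X" for x
    proof -
      have "f x \<in> {0..<card (blk x)}" using H blk[OF that] unfolding f_def bij_betw_def by blast
      moreover have "card (blk x) \<le> 2 * m" using block_family_card(2)[OF assms] blk[OF that] by blast
      ultimately show ?thesis by simp
    qed
  qed
qed

lemma block_family_sum:
  assumes "block_family m B R X" "finite X"
  shows "card X \<le> (\<Sum>b\<in>B. card b) + card R"
proof -
  have "X = \<Union> B \<union> R" using assms(1) by (auto simp: block_family_def)
  then have "card X \<le> card (\<Union> B) + card R" using card_Un_le by blast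
  also have "card (\<Union> B) \<le> (\<Sum>b\<in>B. card b)" by (rule card_Union_le_sum_card)
  finally show ?thesis by simp
qed

lemma distance_lower:
  assumes "n \<ge> 1" "m \<ge> 2" "C \<in> BTrees {0..n}"
  shows "\<exists>B\<in>BTrees {0..n}. \<forall>j. (B, C) \<in> class_moves \<chi> {0..n} ^^ j \<longrightarrow> n \<le> 2 * m + j + n div m + 1"
proof -
  obtain v where v: "btree_on n v" "C = tree_class n v" using BTrees_tree_class assms by auto
  then obtain t where t: "itree_on n t" "erase t = v" using btree_on_itree by blast
  have d: "distinct (0 # nodes t)" "set (tips v) = {1..n}" using t by (auto simp: itree_on_def)
  obtain B R where BR: "block_family m B R {1..n}"
    and score: "\<And>g p. (\<Sum>b\<in>B. card (g ` b) - 1) + (card (insert (g p) (g ` R)) - 1) \<le> breaks g p t"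
    using block_decomposition[OF _ assms(2), of t] d t(2) by auto
  obtain f where f: "\<And>b. b \<in> insert R B \<Longrightarrow> inj_on f b" "\<And>x. x \<in> {1..n} \<Longrightarrow> f x < 2 * m"
    using block_colouring[OF BR _ assms(2)] by blast
  obtain u where u: "itree_on n u" "parsimony_le f {0..n} (ltree_of u) (card (f ` {1..n}))"
    using cheap_tree_parsimony assms(1) by blast
  have "card (f ` {1..n}) \<le> card {..<2 * m}" using f(2) by (intro card_mono) auto
  then have cf: "card (f ` {1..n}) \<le> 2 * m" by simp
  let ?B = "tree_class n (erase u)"
  have B: "?B \<in> BTrees {0..n}" using BTrees_tree_class[OF assms(1)] itree_on_erase[OF u(1)] by blast
  have "n \<le> 2 * m + j + n div m + 1" if j: "(?B, C) \<in> class_moves \<chi> {0..n} ^^ j" for j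
  proof -
    have "card {0..n} \<noteq> 1" using assms(1) by simp
    moreover have "ltree_of t \<in> C" using ltree_of_in_tree_class[OF t(1)] t(2) v(2) by simp
    ultimately have "parsimony_le f {0..n} (ltree_of t) (card (f ` {1..n}) + j)"
      using parsimony_moves[OF j B _ ltree_of_in_tree_class[OF u(1)] u(2)] by blast
    then obtain g where g: "\<forall>x\<in>{0..n}. g x = f x"
      "card (bichromatic g (planted_edges 0 t)) \<le> card (f ` {1..n}) + j"
      unfolding parsimony_le_def ltree_of_def planted_def by auto
    have gb: "card (g ` b) = card b" if "b \<in> insert R B" for b
    proof -
      have "b \<subseteq> {1..n}" using BR that unfolding block_family_def by blast
      then have "g ` b = f ` b" using g(1) by (intro image_cong) auto
      then show ?thesis using f(1)[OF that] by (simp add: card_image)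
    qed
    have "finite R" using BR by (auto simp: block_family_def intro: finite_subset)
    then have "card R \<le> card (insert (g 0) (g ` R))"
      using gb[of R] card_mono[of "insert (g 0) (g ` R)" "g ` R"] by auto
    moreover have "(\<Sum>b\<in>B. card b) \<le> (\<Sum>b\<in>B. card (g ` b) - 1) + card B"
    proof -
      have "(\<Sum>b\<in>B. card b) \<le> (\<Sum>b\<in>B. (card (g ` b) - 1) + 1)" using gb by (intro sum_mono) auto
      also have "\<dots> = (\<Sum>b\<in>B. card (g ` b) - 1) + (\<Sum>b\<in>B. 1)" by (rule sum.distrib)
      finally show ?thesis by simp
    qed
    moreover have "n \<le> (\<Sum>b\<in>B. card b) + card R" using block_family_sum[OF BR] by simp
    moreover have "card B + 1 \<le> n div m + 1"
    proof -
      have "finite B" "R \<notin> B" using BR by (auto simp: block_family_def)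
      then show ?thesis using block_family_card(1)[OF BR _ assms(2)] by simp
    qed
    moreover have "(\<Sum>b\<in>B. card (g ` b) - 1) + (card (insert (g 0) (g ` R)) - 1) \<le> card (f ` {1..n}) + j"
      using score[of g 0] g(2) card_bichromatic_planted[OF d(1), of g] by simp
    ultimately show ?thesis using cf by linarith
  qed
  then show ?thesis using B by blast
qed

lemma tree_dist_le:
  assumes "n \<ge> 2" "m \<ge> 2" "A \<in> BTrees {0..n}" "B \<in> BTrees {0..n}"
  shows "(A, B) \<in> class_moves \<chi> {0..n} ^^ tree_dist \<chi> {0..n} A B"
    and "\<exists>q. tree_dist \<chi> {0..n} A B + q \<le> n \<and> n \<le> 4 * m * q + (n div m + 1) * (n div m + 1)"
proof -
  obtain t u where "btree_on n t" "btree_on n u" "A = tree_class n t" "B = tree_class n u"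
    using BTrees_tree_class[of n] assms by auto
  then obtain k q where k: "(A, B) \<in> class_moves \<chi> {0..n} ^^ k" "k + q \<le> n"
    "n \<le> 4 * m * q + (n div m + 1) * (n div m + 1)"
    using distance_upper[OF _ _ assms(1,2), of t u \<chi>] by blast
  show "(A, B) \<in> class_moves \<chi> {0..n} ^^ tree_dist \<chi> {0..n} A B"
    unfolding tree_dist_def using k(1) by (rule LeastI)
  have "tree_dist \<chi> {0..n} A B \<le> k" unfolding tree_dist_def using k(1) by (rule Least_le)
  then show "\<exists>q. tree_dist \<chi> {0..n} A B + q \<le> n \<and> n \<le> 4 * m * q + (n div m + 1) * (n div m + 1)"
    using k by (intro exI[of _ q]) simp
qed

lemma ceiling_sqrt:
  obtains r :: nat where "n \<le> r * r" "real r \<le> sqrt (real n) + 1" "sqrt (real n) \<le> real r"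
proof -
  define r where "r = nat \<lceil>sqrt (real n)\<rceil>"
  have r: "real r = of_int \<lceil>sqrt (real n)\<rceil>" by (simp add: r_def)
  have le: "sqrt (real n) \<le> real r" unfolding r by linarith
  have "real n = sqrt (real n) * sqrt (real n)" by simp
  also have "\<dots> \<le> real r * real r" using le by (intro mult_mono) auto
  finally have "n \<le> r * r" by (metis of_nat_le_iff of_nat_mult)
  moreover have "real r \<le> sqrt (real n) + 1" unfolding r by linarith
  ultimately show ?thesis using that le by blast
qed

lemma tree_dist_upper:
  assumes "n \<ge> 100" "A \<in> BTrees {0..n}" "B \<in> BTrees {0..n}"
  shows "real (tree_dist \<chi> {0..n} A B) \<le> real n - sqrt (real n) / 16"
proof -
  define s where "s = sqrt (real n)"
  have s: "s \<ge> 10" "real n = s * s"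
    using assms(1) real_le_rsqrt[of 10 "real n"] by (auto simp: s_def)
  obtain r where r: "n \<le> r * r" "real r \<le> s + 1" "s \<le> real r" unfolding s_def by (rule ceiling_sqrt)
  obtain q where q: "tree_dist \<chi> {0..n} A B + q \<le> n"
    "n \<le> 4 * (2 * r) * q + (n div (2 * r) + 1) * (n div (2 * r) + 1)"
    using tree_dist_le(2)[of n "2 * r" A B \<chi>] assms r s(1) by auto
  define K where "K = real (n div (2 * r))"
  have "n div (2 * r) * 2 \<le> r"
  proof -
    have "n div (2 * r) * 2 * r \<le> n" using div_times_less_eq_dividend[of n "2 * r"] by (simp add: mult.assoc)
    also have "\<dots> \<le> r * r" by (rule r(1))
    finally show ?thesis using r(3) s(1) by simp
  qed
  then have K: "2 * K \<le> s + 1" "K \<ge> 0" using r(2) unfolding K_def by linarith+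
  have "real n \<le> 8 * real r * real q + (K + 1) * (K + 1)"
    using of_nat_mono[OF q(2), where ?'a = real] by (simp add: K_def algebra_simps)
  moreover have "(K + 1) * (K + 1) \<le> ((s + 3) / 2) * ((s + 3) / 2)" using K by (intro mult_mono) auto
  moreover have "8 * real r * real q \<le> 8 * (s + 1) * real q" using r(2) by (intro mult_right_mono) auto
  ultimately have main: "s * s \<le> 8 * (s + 1) * real q + ((s + 3) / 2) * ((s + 3) / 2)" using s(2) by linarith
  have "s / 16 \<le> real q"
  proof (rule ccontr)
    assume "\<not> s / 16 \<le> real q"
    then have "8 * (s + 1) * real q \<le> 8 * (s + 1) * (s / 16)" using s(1) by (intro mult_left_mono) auto
    then have "s * s \<le> 8 * (s + 1) * (s / 16) + ((s + 3) / 2) * ((s + 3) / 2)" using main by linarith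
    then have "s * s \<le> 8 * s + 9" by (simp add: field_simps)
    moreover have "s * s \<ge> 10 * s" using s(1) by (intro mult_right_mono) auto
    ultimately show False using s(1) by linarith
  qed
  moreover have "real (tree_dist \<chi> {0..n} A B) + real q \<le> real n" using q(1) by linarith
  ultimately show ?thesis unfolding s_def by linarith
qed

lemma tree_dist_lower:
  assumes "n \<ge> 100" "C \<in> BTrees {0..n}"
  shows "\<exists>B\<in>BTrees {0..n}. real n - 7 * sqrt (real n) \<le> real (tree_dist \<chi> {0..n} B C)"
proof -
  define s where "s = sqrt (real n)"
  have s: "s \<ge> 10" using assms(1) real_le_rsqrt[of 10 "real n"] by (auto simp: s_def)
  obtain r where r: "n \<le> r * r" "real r \<le> s + 1" "s \<le> real r" unfolding s_def by (rule ceiling_sqrt)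
  have "r \<ge> 2" using r(3) s by linarith
  then obtain B where B: "B \<in> BTrees {0..n}"
    "\<And>j. (B, C) \<in> class_moves \<chi> {0..n} ^^ j \<Longrightarrow> n \<le> 2 * r + j + n div r + 1"
    using distance_lower[of n r C \<chi>] assms by auto
  have "n div r \<le> r" using r(1) by (metis div_le_mono div_mult_self1_is_m le_zero_eq not_gr0 div_by_0)
  then have "n \<le> 3 * r + tree_dist \<chi> {0..n} B C + 1"
    using B(2)[OF tree_dist_le(1)[of n 2 B C \<chi>]] B(1) assms by simp
  then have "real n \<le> 3 * real r + real (tree_dist \<chi> {0..n} B C) + 1" by linarith
  then show ?thesis using r(2) s B(1) unfolding s_def[symmetric] by (intro bexI[of _ B]) linarith+
qed

lemma n_minus_Theta_sqrtI:
  assumes "\<And>n. n \<ge> N \<Longrightarrow> real n - 7 * sqrt (real n) \<le> real (F n)"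
    "\<And>n. n \<ge> N \<Longrightarrow> real (F n) \<le> real n - sqrt (real n) / 16"
  shows "n_minus_Theta_sqrt F"
  unfolding n_minus_Theta_sqrt_def
proof
  show "(\<lambda>n. real n - real (F n)) \<in> \<Theta>(\<lambda>n. sqrt (real n))"
  proof (rule bigthetaI'[of "1 / 16" 7])
    show "\<forall>\<^sub>F n in sequentially. 1 / 16 * norm (sqrt (real n)) \<le> norm (real n - real (F n)) \<and>
      norm (real n - real (F n)) \<le> 7 * norm (sqrt (real n))"
      using eventually_ge_at_top[of N]
    proof eventually_elim
      case (elim n)
      have "0 \<le> sqrt (real n)" by simp
      then show ?case using assms[OF elim] unfolding real_norm_def by linarith
    qed
  qed auto
  show "\<forall>\<^sub>F n in sequentially. F n \<le> n"
    using eventually_ge_at_top[of N]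
  proof eventually_elim
    case (elim n)
    have "0 \<le> sqrt (real n)" by simp
    then show ?case using assms(2)[OF elim] by linarith
  qed
qed

lemma diameter_radius_bounds:
  assumes "n \<ge> 100"
  shows "real n - 7 * sqrt (real n) \<le> real (tree_diameter \<chi> n)"
    "real (tree_diameter \<chi> n) \<le> real n - sqrt (real n) / 16"
    "real n - 7 * sqrt (real n) \<le> real (tree_radius \<chi> n)"
    "real (tree_radius \<chi> n) \<le> real n - sqrt (real n) / 16"
proof -
  let ?T = "BTrees {0..n}" and ?d = "tree_dist \<chi> {0..n}" and ?u = "real n - sqrt (real n) / 16"
  let ?D = "{?d A B | A B. A \<in> ?T \<and> B \<in> ?T}"
  define ecc where "ecc C = Max {?d B C | B. B \<in> ?T}" for C
  have d_le: "real (?d A B) \<le> ?u" if "A \<in> ?T" "B \<in> ?T" for A B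
    using tree_dist_upper[OF assms that] .
  have "?u \<le> real n" by simp
  then have d_le_n: "?d A B \<le> n" if "A \<in> ?T" "B \<in> ?T" for A B using d_le[OF that] by linarith
  obtain t where "itree_on n t" using cheap_tree_parsimony[of n id] assms by auto
  then obtain C0 where C0: "C0 \<in> ?T" using BTrees_tree_class[of n] itree_on_erase assms by force
  have finD: "finite ?D" by (rule finite_subset[of _ "{0..n}"]) (use d_le_n in auto)
  have neD: "?D \<noteq> {}" using C0 by blast
  have finE: "finite {?d B C | B. B \<in> ?T}" if "C \<in> ?T" for C
    by (rule finite_subset[of _ "{0..n}"]) (use d_le_n that in auto)
  have ecc_in: "\<exists>B\<in>?T. ecc C = ?d B C" if "C \<in> ?T" for C
    using Max_in[OF finE[OF that]] C0 unfolding ecc_def by blast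
  have ecc_ge: "?d B C \<le> ecc C" if "B \<in> ?T" "C \<in> ?T" for B C
    using Max_ge[OF finE[OF that(2)]] that unfolding ecc_def by blast
  have ecc_lower: "real n - 7 * sqrt (real n) \<le> real (ecc C)" if "C \<in> ?T" for C
    using tree_dist_lower[OF assms that, of \<chi>] ecc_ge[OF _ that] by force
  have rad: "tree_radius \<chi> n = Min (ecc ` ?T)"
    unfolding tree_radius_def ecc_def by (rule arg_cong[of _ _ Min]) auto
  have finR: "finite (ecc ` ?T)"
    by (rule finite_subset[of _ "{0..n}"]) (use ecc_in d_le_n in fastforce)+
  obtain C where C: "C \<in> ?T" "tree_radius \<chi> n = ecc C"
    using Min_in[OF finR] C0 unfolding rad by blast
  show "real n - 7 * sqrt (real n) \<le> real (tree_radius \<chi> n)" using ecc_lower C by simp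
  show "real (tree_radius \<chi> n) \<le> ?u" using ecc_in[OF C(1)] C d_le by force
  have "tree_diameter \<chi> n \<in> ?D" unfolding tree_diameter_def by (rule Max_in[OF finD neD])
  then show "real (tree_diameter \<chi> n) \<le> ?u" using d_le by auto
  obtain B where B: "B \<in> ?T" "ecc C0 = ?d B C0" using ecc_in[OF C0] by blast
  have "?d B C0 \<le> tree_diameter \<chi> n"
    unfolding tree_diameter_def using B(1) C0 by (intro Max_ge[OF finD]) blast
  then show "real n - 7 * sqrt (real n) \<le> real (tree_diameter \<chi> n)" using ecc_lower[OF C0] B(2) by simp
qed

theorem theorem1p10:
  fixes \<chi> :: move_kind
  shows "n_minus_Theta_sqrt (tree_diameter \<chi>) \<and> n_minus_Theta_sqrt (tree_radius \<chi>)"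
  using diameter_radius_bounds by (intro conjI n_minus_Theta_sqrtI[of 100])

end
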